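(* Let $H$ be the three dimensional Heisenberg group and $\Gamma$ its integral lattice. Then the relative analytic torsion of the pair $(H,\Gamma)$ satisfies \[ \mathfrak T_\Gamma(H)=\int_0^1 T(N,\alpha)\,d\alpha+\int_0^1 E(H_{\rm red},\alpha)\,\alpha\,d\alpha , \] where $T(N,\alpha)$ and $E(H_{\rm red},\alpha)$ are the spectral invariants defined in the context.
   Context: $H=\mathbb R^3$ with product $(a,b,t)(a',b',t')=(a+a',b+b',t+t'+ab')$, and $\Gamma=\{(l,m,n)\in H: l,m,n\in\mathbb Z\}$. $H$ carries the left invariant metric for which $X=\partial_a$, $Y=\partial_b+a\partial_t$, $T=\partial_t$ are orthonormal; $\Delta^{(q)}$ is the Hodge Laplace operator on square integrable $q$-forms. For $h\in\mathbb R-\{0\}$, $\rho_h$ is the Schrödinger representation on $L^2(\mathbb R)$, $\rho_h(a,b,t)(f)(x)=e^{2\pi i ht+2\pi i bx}f(x+ha)$, so $d\rho_h(X)=h\partial_x$, $d\rho_h(Y)=2\pi i x$, $d\rho_h(T)=2\pi i h$; $d\rho_h\Delta^{(q)}$ is the self adjoint operator with discrete spectrum on $L^2(\mathbb R)\otimes\Lambda^q\mathfrak h^*$ obtained by replacing $X,Y,T$ in $\Delta^{(q)}$ by these operators. The Plancherel measure is $|h|dh$. Put $\zeta(s,d\rho_h\Delta^{(q)})=\sum_{\lambda\in\mathrm{Sp}_+d\rho_h\Delta^{(q)}}\lambda^{-s}$ (positive eigenvalues; large $\mathrm{Re}(s)$, then analytic continuation), $\mathfrak t(s;H,h)=\sum_{q=0}^3(-1)^q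 q\,\zeta(s,d\rho_h\Delta^{(q)})$, and $\mathfrak T(H,h)=\frac{d}{ds}\mathfrak t(s;H,h)|_{s=0}$. One has $\mathfrak t(s;H,-h)=\mathfrak t(s;H,h)$. The relative analytic torsion is, for $\delta>0$ (the paper takes $\delta=1$), \[ \mathfrak T_\Gamma(H)=\frac{d}{ds}\,2\int_\delta^\infty\mathfrak t(s;H,h)\,h\,dh\Big|_{s=0}+2\int_0^\delta\mathfrak T(H,h)\,h\,dh, \] the first integral being defined for large $\mathrm{Re}(s)$ and continued analytically. For $0<\alpha<1$, $T(N,\alpha)=\frac{d}{ds}t(s;N,\alpha)|_{s=0}$, where $t(s;N,\alpha)$ is the analytic torsion zeta function associated to the spectrum in which, for each $n\in\mathbb Z$, the eigenvalues of $d\rho_{n+\alpha}\Delta^{(q)}$ occur with multiplicity $|n|$ (the paper's torsion of the quotient it denotes $N$, twisted by the character $e^{2\pi i\alpha n}$ of the central direction), i.e. the analytic continuation of \[ t(s;N,\alpha)=\sum_{n\in\mathbb Z}|n|\,\mathfrak t(s;H,n+\alpha). \] $E(H_{\rm red},\alpha)=\frac{d}{ds}e(s;H_{\rm red},\alpha)|_{s=0}$, where $e(s;H_{\rm red},\alpha)$ is the analytic continuation from large $\mathrm{Re}(s)$ of \[ e(s;H_{\rm red},\alpha)=\sum_{q=0}^3(-1)^q q\sum_{m,\,n}\mathrm{sgn}(n)\,\big(\lambda^{(q)}_{m,n}(\alpha)\big)^{-s}=\sum_{n=0}^\infty\mathfrak t(s;H,n+\alpha)-\sum_{n=-\infty}^{-1}\mathfrak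 t(s;H,n+\alpha), \] with $\lambda_{m,n}^{(q)}(\alpha)$, indexed by $m$, the eigenvalues of $d\rho_{n+\alpha}\Delta^{(q)}$ and the convention $\mathrm{sgn}(0)=+1$. This measures the spectral asymmetry of the decomposition of the $L^2$ sections of the line bundle $E_\alpha$ over the reduced Heisenberg group $H_{\rm red}=(\{0\}\times\{0\}\times\mathbb Z)\backslash H$ into subspaces of central character $e^{2\pi i(n+\alpha)t}$.
   Formalization: Each of the two integrals over (0,1) diverges at α=1 (integrands ~ ±1/(4π(1−α))); the formula is proved with both taken over (0,β) and β→1⁻, and as the convergent integral of T(N,α)+αE(H_red,α) over (0,1). *)

theory Defs
  imports "HOL-Complex_Analysis.Complex_Analysis"
begin

section \<open>The Heisenberg group and its Schroedinger representations\<close>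

type_synonym heis = "real \<times> real \<times> real"

definition heis_mult :: "heis \<Rightarrow> heis \<Rightarrow> heis" where
  "heis_mult = (\<lambda>(a, b, t) (a', b', t'). (a + a', b + b', t + t' + a * b'))"

text \<open>
  The indices 1, 2, 3 stand for the orthonormal left invariant frame
  X = d/da, Y = d/db + a d/dt, T = d/dt, and heis_exp i r is exp (r X), exp (r Y), exp (r T).
\<close>

definition heis_exp :: "nat \<Rightarrow> real \<Rightarrow> heis" where
  "heis_exp i r = (if i = 1 then (r, 0, 0) else if i = 2 then (0, r, 0) else (0, 0, r))"

definition rho :: "real \<Rightarrow> heis \<Rightarrow> (real \<Rightarrow> complex) \<Rightarrow> real \<Rightarrow> complex" where
  "rho h = (\<lambda>(a, b, t) f x.
     exp (2 * of_real pi * \<i> * of_real (h * t) + 2 * of_real pi * \<i> * of_real (b * x))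
       * f (x + h * a))"

lemma rho_mult: "rho h (heis_mult g g') f = rho h g (rho h g' f)"
  by (cases g; cases g')
     (auto simp: rho_def heis_mult_def fun_eq_iff exp_add [symmetric] algebra_simps)

definition drho :: "real \<Rightarrow> nat \<Rightarrow> (real \<Rightarrow> complex) \<Rightarrow> real \<Rightarrow> complex" where
  "drho h i f x = vector_derivative (\<lambda>r. rho h (heis_exp i r) f x) (at 0)"

lemma drho_X:
  assumes "f differentiable (at x)"
  shows "drho h 1 f x = of_real h * vector_derivative f (at x)"
proof -
  have "(f has_vector_derivative vector_derivative f (at x)) (at (x + h * 0))"
    using assms vector_derivative_works by auto
  moreover have "((\<lambda>r. x + h * r) has_real_derivative h) (at 0)"
    by (auto intro!: derivative_eq_intros)
  ultimately have "((f \<circ> (\<lambda>r. x + h * r)) has_vector_derivative h *\<^sub>R vector_derivative f (at x)) (at 0)"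
    by (intro vector_diff_chain_at) (simp_all add: has_real_derivative_iff_has_vector_derivative)
  then show ?thesis
    by (simp add: drho_def rho_def heis_exp_def o_def vector_derivative_at scaleR_conv_of_real)
qed

lemma drho_Y: "drho h 2 f x = 2 * of_real pi * \<i> * of_real x * f x"
proof -
  have "((\<lambda>r. exp (2 * of_real pi * \<i> * of_real (r * x)) * f x) has_vector_derivative
      2 * of_real pi * \<i> * of_real x * f x) (at 0)"
    unfolding has_vector_derivative_complex_iff
    by (auto simp: Re_exp Im_exp intro!: derivative_eq_intros)
  then show ?thesis
    by (simp add: drho_def rho_def heis_exp_def vector_derivative_at)
qed

lemma drho_T: "drho h 3 f x = 2 * of_real pi * \<i> * of_real h * f x"
proof -
  have "((\<lambda>r. exp (2 * of_real pi * \<i> * of_real (h * r)) * f x) has_vector_derivative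
      2 * of_real pi * \<i> * of_real h * f x) (at 0)"
    unfolding has_vector_derivative_complex_iff
    by (auto simp: Re_exp Im_exp intro!: derivative_eq_intros)
  then show ?thesis
    by (simp add: drho_def rho_def heis_exp_def vector_derivative_at)
qed

section \<open>The Hodge Laplace operator as an expression in X, Y, T\<close>

text \<open>
  A form is given by its components with respect to the dual coframe
  (e1, e2, e3) = (da, db, dt - a db): u J is the coefficient of the wedge product of the ej,
  j in J, in increasing order.  The structure equations are de1 = de2 = 0 and
  de3 = - e1 \<and> e2, since [X, Y] = T.  All operators take the operators standing
  for X, Y, T as a parameter E.  With E the frame acting on functions on the group these are the
  exterior derivative, the codifferential and the Hodge Laplacian of the left invariant metric;
  with E = drho h one obtains the Laplacian in the representation rho h.
\<close>

type_synonym 'p form = "nat set \<Rightarrow> 'p \<Rightarrow> complex"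

definition ext_d :: "(nat \<Rightarrow> ('p \<Rightarrow> complex) \<Rightarrow> 'p \<Rightarrow> complex) \<Rightarrow> 'p form \<Rightarrow> 'p form" where
  "ext_d E u J x =
     (if J \<subseteq> {1, 2, 3}
      then (\<Sum>i\<in>J. (-1) ^ card {j \<in> J. j < i} * E i (u (J - {i})) x)
           - (if J = {1, 2} then u {3} x else 0)
      else 0)"

text \<open>The sign is that of the permutation that sorts I followed by J, where I is the complement of J.\<close>

definition hodge_star :: "'p form \<Rightarrow> 'p form" where
  "hodge_star u J x =
     (if J \<subseteq> {1, 2, 3}
      then (-1) ^ card {(i, j). i \<in> {1, 2, 3} - J \<and> j \<in> J \<and> j < i} * u ({1, 2, 3} - J) x
      else 0)"

text \<open>In dimension 3 the codifferential on forms of degree q is (-1)^q * d *; here q = card J + 1.\<close>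

definition codiff :: "(nat \<Rightarrow> ('p \<Rightarrow> complex) \<Rightarrow> 'p \<Rightarrow> complex) \<Rightarrow> 'p form \<Rightarrow> 'p form" where
  "codiff E u J x = (-1) ^ (card J + 1) * hodge_star (ext_d E (hodge_star u)) J x"

definition hodge_laplacian ::
  "(nat \<Rightarrow> ('p \<Rightarrow> complex) \<Rightarrow> 'p \<Rightarrow> complex) \<Rightarrow> 'p form \<Rightarrow> 'p form" where
  "hodge_laplacian E u J x = ext_d E (codiff E u) J x + codiff E (ext_d E u) J x"

section \<open>The self adjoint operator in the representation and its spectrum\<close>

definition schwartz :: "(real \<Rightarrow> complex) set" where
  "schwartz = {f. let D = (\<lambda>g x. vector_derivative g (at x)) in
     (\<forall>k x. (D ^^ k) f differentiable (at x)) \<and>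
     (\<forall>j k. bounded (range (\<lambda>x. of_real (x ^ j) * (D ^^ k) f x)))}"

definition schwartz_forms :: "nat \<Rightarrow> real form set" where
  "schwartz_forms q = {u. \<forall>J. if J \<subseteq> {1, 2, 3} \<and> card J = q
     then u J \<in> schwartz else u J = (\<lambda>_. 0)}"

definition l2_forms :: "nat \<Rightarrow> real form set" where
  "l2_forms q = {u. \<forall>J. if J \<subseteq> {1, 2, 3} \<and> card J = q
     then u J \<in> borel_measurable lborel \<and> integrable lborel (\<lambda>x. (cmod (u J x))\<^sup>2)
     else u J = (\<lambda>_. 0)}"

definition l2_norm :: "real form \<Rightarrow> real" where
  "l2_norm u = sqrt (\<Sum>J\<in>Pow {1, 2, 3}. LBINT x. (cmod (u J x))\<^sup>2)"

text \<open>
  The graph of the closure, in L2, of the Laplacian on Schwartz forms (the smooth vectors of rho h).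
  Functions are not identified when they agree almost everywhere; the graph is invariant
  under such changes.
\<close>

definition rep_laplacian :: "real \<Rightarrow> nat \<Rightarrow> (real form \<times> real form) set" where
  "rep_laplacian h q = {(u, v). u \<in> l2_forms q \<and> v \<in> l2_forms q \<and>
     (\<exists>\<phi>. (\<forall>k::nat. \<phi> k \<in> schwartz_forms q) \<and>
       (\<lambda>k. l2_norm (\<lambda>J x. \<phi> k J x - u J x)) \<longlonglongrightarrow> 0 \<and>
       (\<lambda>k. l2_norm (\<lambda>J x. hodge_laplacian (drho h) (\<phi> k) J x - v J x)) \<longlonglongrightarrow> 0)}"

definition eigenspace :: "real \<Rightarrow> nat \<Rightarrow> real \<Rightarrow> real form set" where
  "eigenspace h q lam = {u. (u, \<lambda>J x. of_real lam * u J x) \<in> rep_laplacian h q}"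

definition positive_spectrum :: "real \<Rightarrow> nat \<Rightarrow> real set" where
  "positive_spectrum h q = {lam. lam > 0 \<and> (\<exists>u\<in>eigenspace h q lam. l2_norm u \<noteq> 0)}"

text \<open>The dimension of the eigenspace modulo null functions.\<close>

definition multiplicity_of :: "real \<Rightarrow> nat \<Rightarrow> real \<Rightarrow> nat" where
  "multiplicity_of h q lam = Sup {k. \<exists>b :: nat \<Rightarrow> real form.
     (\<forall>i<k. b i \<in> eigenspace h q lam) \<and>
     (\<forall>c :: nat \<Rightarrow> complex. l2_norm (\<lambda>J x. \<Sum>i<k. c i * b i J x) = 0 \<longrightarrow> (\<forall>i<k. c i = 0))}"

section \<open>Zeta functions and torsion\<close>

text \<open>
  The value at s of the meromorphic continuation of f, from some half plane Re z > c
  to a half plane that contains s.  By the identity theorem it does not depend on the choices.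
  Only the values of f far to the right matter.
\<close>

definition continuation :: "(complex \<Rightarrow> complex) \<Rightarrow> complex \<Rightarrow> complex" where
  "continuation f s = (THE v. \<exists>F c d. d < Re s \<and> F nicely_meromorphic_on {z. Re z > d} \<and>
     (\<forall>z. Re z > c \<longrightarrow> F z = f z) \<and> v = F s)"

definition spectral_zeta :: "real \<Rightarrow> nat \<Rightarrow> complex \<Rightarrow> complex" where
  "spectral_zeta h q = continuation (\<lambda>s.
     \<Sum>\<^sub>\<infinity>lam\<in>positive_spectrum h q. of_nat (multiplicity_of h q lam) * of_real lam powr (- s))"

definition torsion_zeta :: "real \<Rightarrow> complex \<Rightarrow> complex" where
  "torsion_zeta h s = (\<Sum>q\<le>3. (-1) ^ q * of_nat q * spectral_zeta h q s)"

definition torsion :: "real \<Rightarrow> complex" where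
  "torsion h = deriv (torsion_zeta h) 0"

definition relative_torsion :: "real \<Rightarrow> complex" where
  "relative_torsion \<delta> =
     deriv (continuation (\<lambda>s. 2 * (LBINT h:{\<delta><..}. torsion_zeta h s * of_real h))) 0
     + 2 * (LBINT h:{0<..<\<delta>}. torsion h * of_real h)"

definition torsion_N :: "real \<Rightarrow> complex" where
  "torsion_N \<alpha> = deriv (continuation (\<lambda>s.
     \<Sum>\<^sub>\<infinity>n\<in>(UNIV :: int set). of_int \<bar>n\<bar> * torsion_zeta (of_int n + \<alpha>) s)) 0"

definition asymmetry_Hred :: "real \<Rightarrow> complex" where
  "asymmetry_Hred \<alpha> = deriv (continuation (\<lambda>s.
     (\<Sum>\<^sub>\<infinity>n\<in>{0 :: int..}. torsion_zeta (of_int n + \<alpha>) s)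
     - (\<Sum>\<^sub>\<infinity>n\<in>{..- 1 :: int}. torsion_zeta (of_int n + \<alpha>) s))) 0"

end

theory Submission
  imports Defs "HOL-Probability.Probability" "HOL-Real_Asymp.Real_Asymp"
begin

text \<open>
  Both sides can be computed, and both are zero.

  Put \<open>\<tau> = 2 \<pi> \<bar>h\<bar>\<close> and \<open>\<lambda>\<^sub>k = \<tau> (\<tau> + 2 k + 1)\<close>, the eigenvalues
  of the harmonic oscillator by which the Laplacian acts on functions.  On one-forms the Laplacian
  respects a splitting into blocks that are spanned by Hermite functions and have dimension at most
  three.  The block of \<open>k\<close> contributes one exact eigenform, with eigenvalue \<open>\<lambda>\<^sub>k\<close>, and two coexact
  ones, with eigenvalues \<open>m\<^sup>2\<close> for the two roots \<open>m\<close> of \<open>m\<^sup>2 + m = \<lambda>\<^sub>k\<close>.  Since the Hermite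
  functions are complete there is nothing else (\<open>herm_complete\<close>, \<open>eigensystem_functions\<close>,
  \<open>eigensystem_one_forms\<close>), and the Hodge star carries everything to degrees 2 and 3
  (\<open>eigensystem_dual\<close>).  So the torsion zeta function is \<open>\<zeta>\<^sub>1 - 3 \<zeta>\<^sub>0\<close>, the sum over \<open>k\<close> of
  \<open>pair_term \<lambda>\<^sub>k\<close>.

  If \<open>d\<close> is the difference of the logarithms of \<open>\<bar>m\<bar>\<close> for the two roots, then \<open>pair_term \<lambda> s\<close> is
  \<open>\<lambda> powr (- s) * (2 cosh (s d) - 2)\<close>, while \<open>2 cosh d - 2 = 1 / \<lambda>\<close> because the absolute values of
  the roots have difference 1 and product \<open>\<lambda>\<close>.  Hence each term is close to
  \<open>s\<^sup>2 \<lambda> powr (- s - 1)\<close>.  The \<open>\<lambda>\<^sub>k\<close> are the midpoints of adjacent intervals of length \<open>2 \<tau>\<close>, so the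
  sum of these main terms is, up to the error of the midpoint rule, an integral from
  \<open>\<tau>\<^sup>2\<close> to infinity, namely \<open>(s / 2) \<tau> powr (- 2 s - 1)\<close>.  The total error is holomorphic for
  \<open>Re s > - 1/4\<close>, decays in \<open>\<tau>\<close> so fast that it may be summed over characters and, away from
  \<open>h = 0\<close>, integrated over the Plancherel measure, and has derivative zero at \<open>s = 0\<close> (\<open>remainder_term_bound\<close>,
  \<open>torsion_remainder_derivatives\<close>, \<open>weighted_remainder\<close>).  It therefore contributes to none of the
  invariants, which are all read off from \<open>(s / 2) \<tau> powr (- 2 s - 1)\<close>.

  The torsion of one representation is \<open>1 / (4 \<pi> \<bar>h\<bar>)\<close>.  In the relative torsion the part beyond
  \<open>\<delta>\<close> gives \<open>- \<delta> / (2 \<pi>)\<close> and the part below \<open>\<delta>\<close> gives \<open>\<delta> / (2 \<pi>)\<close>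
  (\<open>relative_torsion_eq_0\<close>).  The spectral asymmetry \<open>E(\<alpha>)\<close> is the sum over \<open>n \<ge> 0\<close> of
  \<open>(1 / (n + \<alpha>) - 1 / (n + 1 - \<alpha>)) / (4 \<pi>)\<close>.  Adding \<open>\<alpha>\<close> times the asymmetry to the zeta function
  of \<open>T(\<alpha>)\<close> replaces the multiplicity \<open>\<bar>n\<bar>\<close> by \<open>\<bar>n + \<alpha>\<bar>\<close>, and turns the main term into \<open>s / 2\<close>
  times a sum of Hurwitz zeta functions, at \<open>2 s\<close>, with parameters \<open>\<alpha>\<close> and \<open>1 - \<alpha>\<close>.
  Their values at 0 are \<open>1/2 - \<alpha>\<close> and \<open>\<alpha> - 1/2\<close>, so the product vanishes to second order, and
  \<open>T(\<alpha>) = - \<alpha> E(\<alpha>)\<close> for every \<open>\<alpha>\<close> (\<open>torsion_N_eq\<close>).  Each of the two functions alone behaves like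
  a multiple of \<open>1 / (1 - \<alpha>)\<close> as \<open>\<alpha>\<close> tends to 1, which is why they are integrated separately
  only up to \<open>\<beta> < 1\<close> (\<open>asymmetry_integrable\<close>).
\<close>

section \<open>Continuation and parameter integrals\<close>

lemma halfplane_connected: "connected {z. Re z > d}"
  by (intro convex_connected convex_halfspace_Re_gt)

text \<open>
  The difference vanishes far to the right, hence on the whole common half plane once its removable
  singularities are filled in.  That \<open>F\<close> and \<open>G\<close> are nice then gives equality at \<open>s\<close> even where
  both have a pole.
\<close>

lemma nicely_meromorphic_halfplane_unique:
  assumes F: "F nicely_meromorphic_on {z. Re z > d}" and G: "G nicely_meromorphic_on {z. Re z > d'}"
    and eq: "\<And>z. Re z > c \<Longrightarrow> F z = G z" and s: "Re s > d" "Re s > d'"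
  shows "F s = G s"
proof -
  define e where "e = max d d'"
  define A where "A = {z. Re z > e}"
  have A: "open A" "connected A" "s \<in> A"
    using s halfplane_connected[of e] open_halfspace_Re_gt[of e] unfolding A_def by (auto simp: e_def)
  have FA: "F nicely_meromorphic_on A" and GA: "G nicely_meromorphic_on A"
    by (auto simp: A_def e_def intro: nicely_meromorphic_on_subset[OF F] nicely_meromorphic_on_subset[OF G])
  have mero: "(\<lambda>z. F z - G z) meromorphic_on A"
    using FA GA by (intro meromorphic_on_diff) (auto simp: nicely_meromorphic_on_def)
  define h where "h = remove_sings (\<lambda>z. F z - G z)"
  have h: "h nicely_meromorphic_on A"
    unfolding h_def by (rule remove_sings_nicely_meromorphic[OF mero])
  define B where "B = {z. Re z > max e c}"
  have B: "open B" "B \<subseteq> A" "B \<noteq> {}"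
    using open_halfspace_Re_gt[of "max e c"]
    by (auto simp: B_def A_def intro: exI[of _ "of_real (max e c + 1)"])
  have hB: "h z = 0" if "z \<in> B" for z
  proof -
    have "eventually (\<lambda>w. w \<in> B) (at z)"
      using B(1) that by (intro eventually_at_in_open') auto
    hence "eventually (\<lambda>w. F w - G w = 0) (at z)"
      by eventually_elim (use eq in \<open>auto simp: B_def\<close>)
    hence "(\<lambda>w. F w - G w) \<midarrow>z\<rightarrow> 0"
      by (simp add: tendsto_eventually)
    thus ?thesis unfolding h_def by (rule remove_sings_eqI)
  qed
  hence "h constant_on B" by (auto simp: constant_on_def)
  hence "h constant_on A"
    using constant_on_extend_nicely_meromorphic_on[OF h _ B(1) A(1,2) B(3,2)] by blast
  hence hA: "h z = 0" if "z \<in> A" for z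
    using that hB B by (auto simp: constant_on_def) (metis subsetD ex_in_conv)
  have "eventually (\<lambda>w. w \<in> A) (at s)"
    using A by (intro eventually_at_in_open') auto
  moreover have "isolated_singularity_at (\<lambda>z. F z - G z) s"
    using mero A(3) by (meson meromorphic_on_isolated_singularity meromorphic_on_meromorphic_at)
  hence "eventually (\<lambda>w. h w = F w - G w) (at s)"
    unfolding h_def by (rule eventually_remove_sings_eq_at)
  ultimately have ev: "eventually (\<lambda>w. F w = G w) (at s)"
    by eventually_elim (use hA in auto)
  have pole: "is_pole F s \<longleftrightarrow> is_pole G s"
    by (rule is_pole_cong[OF ev refl])
  show ?thesis
  proof (cases "is_pole F s")
    case True
    hence "\<not> F \<midarrow>s\<rightarrow> F s" "\<not> G \<midarrow>s\<rightarrow> G s"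
      using pole not_tendsto_and_filterlim_at_infinity[of "at s"] unfolding is_pole_def
      using at_neq_bot by blast+
    thus ?thesis using FA GA A(3) by (metis nicely_meromorphic_on_def)
  next
    case False
    hence "F \<midarrow>s\<rightarrow> F s" "G \<midarrow>s\<rightarrow> G s"
      using FA GA A(3) pole by (auto simp: nicely_meromorphic_on_def)
    moreover from this(2) have "F \<midarrow>s\<rightarrow> G s"
      using tendsto_cong[OF ev] by blast
    ultimately show ?thesis using LIM_unique by blast
  qed
qed

text \<open>
  This evaluates the definite description.  The continuation \<open>F\<close> may be given by a formula with wrong
  values at its isolated singularities: filling these in makes it nice and leaves unchanged the values
  at points of analyticity.
\<close>

lemma continuation_eqI:
  assumes mero: "F meromorphic_on {z. Re z > d}" and an: "F analytic_on {z. Re z > c}"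
    and eq: "\<And>z. Re z > c \<Longrightarrow> F z = f z" and s: "d < Re s" "F analytic_on {s}"
  shows "continuation f s = F s"
proof -
  define G where "G = remove_sings F"
  have G: "G nicely_meromorphic_on {z. Re z > d}"
    unfolding G_def by (rule remove_sings_nicely_meromorphic[OF mero])
  have Gf: "G z = f z" if "Re z > c" for z
    using an eq[OF that] that unfolding G_def
    by (metis (no_types) remove_sings_at_analytic analytic_on_analytic_at mem_Collect_eq)
  have Gs: "G s = F s" unfolding G_def using s(2) by simp
  show ?thesis unfolding continuation_def
  proof (rule the_equality)
    show "\<exists>F' c d. d < Re s \<and> F' nicely_meromorphic_on {z. d < Re z} \<and>
            (\<forall>z. c < Re z \<longrightarrow> F' z = f z) \<and> F s = F' s"
      using G Gf Gs s(1) by metis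
  next
    fix v assume "\<exists>F' c d. d < Re s \<and> F' nicely_meromorphic_on {z. d < Re z} \<and>
            (\<forall>z. c < Re z \<longrightarrow> F' z = f z) \<and> v = F' s"
    then obtain F' c' d' where F': "d' < Re s" "F' nicely_meromorphic_on {z. d' < Re z}"
      "\<And>z. c' < Re z \<Longrightarrow> F' z = f z" "v = F' s" by blast
    have "F' s = G s"
      by (rule nicely_meromorphic_halfplane_unique[OF F'(2) G, of "max c c'"])
         (use F' Gf s in auto)
    thus "v = F s" using Gs F' by simp
  qed
qed

text \<open>
  Cauchy's inequality turns the bound on \<open>f\<close> in a disc into a bound on its difference quotients
  in the disc of half the radius, and dominated convergence applies to these.
\<close>

lemma has_field_derivative_integral_dominated:
  fixes f :: "complex \<Rightarrow> 'a \<Rightarrow> complex"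
  assumes S: "s0 \<in> S" "open S"
    and meas: "\<And>s. s \<in> S \<Longrightarrow> f s \<in> borel_measurable M"
    and hol: "\<And>x. x \<in> space M \<Longrightarrow> (\<lambda>s. f s x) holomorphic_on S"
    and r: "r > 0" "cball s0 r \<subseteq> S" and w: "integrable M w"
    and dom: "\<And>s x. s \<in> cball s0 r \<Longrightarrow> x \<in> space M \<Longrightarrow> norm (f s x) \<le> w x"
  shows "((\<lambda>s. \<integral>x. f s x \<partial>M) has_field_derivative (\<integral>x. deriv (\<lambda>s. f s x) s0 \<partial>M)) (at s0)"
proof -
  have lip: "norm (f y x - f s0 x) \<le> 2 / r * w x * norm (y - s0)"
    if y: "y \<in> ball s0 (r/2)" and x: "x \<in> space M" for x y
  proof (rule field_differentiable_bound[of "ball s0 (r/2)" "\<lambda>s. f s x" "deriv (\<lambda>s. f s x)" "2 / r * w x"])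
    fix z assume z: "z \<in> ball s0 (r/2)"
    have sub: "cball z (r/2) \<subseteq> cball s0 r"
    proof
      fix u assume "u \<in> cball z (r/2)"
      thus "u \<in> cball s0 r" using z dist_triangle[of s0 u z] by (simp add: mem_cball mem_ball)
    qed
    have "z \<in> cball s0 r" using z r(1) by (simp add: mem_ball mem_cball)
    hence zS: "z \<in> S" using r(2) by blast
    show "((\<lambda>s. f s x) has_field_derivative deriv (\<lambda>s. f s x) z) (at z within ball s0 (r/2))"
      using holomorphic_derivI[OF hol[OF x] S(2) zS] by (rule has_field_derivative_at_within)
    have "norm ((deriv ^^ 1) (\<lambda>s. f s x) z) \<le> fact 1 * w x / (r/2) ^ 1"
    proof (rule Cauchy_inequality)
      show "(\<lambda>s. f s x) holomorphic_on ball z (r/2)"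
        using sub r(2) by (intro holomorphic_on_subset[OF hol[OF x]]) (use ball_subset_cball in blast)
      show "continuous_on (cball z (r/2)) (\<lambda>s. f s x)"
        using sub r(2) by (intro holomorphic_on_imp_continuous_on holomorphic_on_subset[OF hol[OF x]]) blast
      fix u assume "norm (z - u) = r/2"
      hence "u \<in> cball z (r/2)" by (simp add: dist_norm)
      thus "norm (f u x) \<le> w x" using sub dom x by blast
    qed (use r in auto)
    thus "norm (deriv (\<lambda>s. f s x) z) \<le> 2 / r * w x" by (simp add: field_simps)
  qed (use y r in auto)
  have intf: "integrable M (f s)" if "s \<in> cball s0 r" for s
    by (rule Bochner_Integration.integrable_bound[OF w])
       (use that r meas dom in \<open>auto intro!: AE_I2 intro: order_trans[OF _ abs_ge_self]\<close>)
  show ?thesis unfolding has_field_derivative_iff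
  proof (rule iffD2[OF tendsto_at_iff_sequentially], intro allI impI)
    fix X :: "nat \<Rightarrow> complex"
    assume X: "\<forall>i. X i \<in> UNIV - {s0}" "X \<longlonglongrightarrow> s0"
    have "eventually (\<lambda>n. X n \<in> ball s0 (r/2)) sequentially"
      using X(2) r by (intro topological_tendstoD) auto
    then obtain N where N: "\<And>n. n \<ge> N \<Longrightarrow> X n \<in> ball s0 (r/2)"
      by (auto simp: eventually_sequentially)
    define Y where "Y n = X (n + N)" for n
    have Y: "Y n \<in> ball s0 (r/2)" "Y n \<in> cball s0 r" "Y n \<noteq> s0" for n
      using N[of "n + N"] X(1) r by (auto simp: Y_def)
    have Ylim: "Y \<longlonglongrightarrow> s0" unfolding Y_def using X(2) by (rule LIMSEQ_ignore_initial_segment)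
    define q where "q n x = (f (Y n) x - f s0 x) / (Y n - s0)" for n x
    have YS: "Y n \<in> S" for n using Y(2) r(2) by blast
    have qm: "q n \<in> borel_measurable M" for n
      unfolding q_def using meas[OF YS] meas[OF S(1)] by measurable
    have qlim: "(\<lambda>n. q n x) \<longlonglongrightarrow> deriv (\<lambda>s. f s x) s0" if x: "x \<in> space M" for x
    proof -
      have "((\<lambda>s. f s x) has_field_derivative deriv (\<lambda>s. f s x) s0) (at s0)"
        using holomorphic_derivI[OF hol[OF x] S(2,1)] .
      hence "((\<lambda>y. (f y x - f s0 x) / (y - s0)) \<longlongrightarrow> deriv (\<lambda>s. f s x) s0) (at s0)"
        by (simp add: has_field_derivative_iff)
      moreover have "filterlim Y (at s0) sequentially"
        using Ylim Y(3) by (auto simp: filterlim_at)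
      ultimately show ?thesis unfolding q_def by (rule filterlim_compose)
    qed
    have dm: "(\<lambda>x. deriv (\<lambda>s. f s x) s0) \<in> borel_measurable M"
      by (rule borel_measurable_LIMSEQ_metric[OF qm qlim])
    have "(\<lambda>n. \<integral>x. q n x \<partial>M) \<longlonglongrightarrow> (\<integral>x. deriv (\<lambda>s. f s x) s0 \<partial>M)"
    proof (rule integral_dominated_convergence[OF dm qm])
      show "integrable M (\<lambda>x. 2 / r * w x)" using w by simp
      show "AE x in M. norm (q n x) \<le> 2 / r * w x" for n
        using lip[OF Y(1)] Y(3) by (intro AE_I2) (auto simp: q_def norm_divide divide_le_eq)
    qed (use qlim in auto)
    moreover have "(\<integral>x. q n x \<partial>M) = ((\<integral>x. f (Y n) x \<partial>M) - (\<integral>x. f s0 x \<partial>M)) / (Y n - s0)" for n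
      unfolding q_def using intf[OF Y(2)] intf[of s0] r(1) by simp
    ultimately have "(\<lambda>n. ((\<integral>x. f (Y n) x \<partial>M) - (\<integral>x. f s0 x \<partial>M)) / (Y n - s0))
        \<longlonglongrightarrow> (\<integral>x. deriv (\<lambda>s. f s x) s0 \<partial>M)" by simp
    thus "((\<lambda>y. ((\<integral>x. f y x \<partial>M) - (\<integral>x. f s0 x \<partial>M)) / (y - s0)) \<circ> X)
        \<longlonglongrightarrow> (\<integral>x. deriv (\<lambda>s. f s x) s0 \<partial>M)"
      unfolding Y_def o_def
      by (rule LIMSEQ_offset[where k = N])
  qed
qed

section \<open>The midpoint rule and pairs of eigenvalues\<close>

text \<open>
  This is \<open>z - 1\<close> times the difference between \<open>c powr (- z)\<close> and the mean of \<open>x powr (- z)\<close> over the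
  interval \<open>[c - r, c + r]\<close>.  The factor \<open>z - 1\<close> removes the singularity of the primitive at \<open>z = 1\<close>.
\<close>

definition midpoint_defect :: "real \<Rightarrow> real \<Rightarrow> complex \<Rightarrow> complex" where
  "midpoint_defect c r z = (z - 1) * of_real c powr (- z)
     - (of_real (c - r) powr (1 - z) - of_real (c + r) powr (1 - z)) / of_real (2 * r)"

lemma norm_of_real_powr: "x > 0 \<Longrightarrow> norm (of_real x powr w :: complex) = x powr Re w"
  by (subst norm_powr_real_powr) auto

text \<open>
  In the difference of the Taylor expansions of \<open>x powr (1 - z)\<close> at the two ends about the centre \<open>c\<close>
  the terms of even order cancel, and the term of first order is \<open>(z - 1) c powr (- z)\<close>; third
  derivatives remain.
\<close>

lemma midpoint_defect_bound:
  assumes r: "0 < r" "r < c" and z: "Re z \<ge> -2"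
  shows "norm (midpoint_defect c r z)
    \<le> norm ((z - 1) * z * (z + 1)) * r\<^sup>2 / 2 * (c - r) powr (- Re z - 2)"
proof -
  define f where "f = (\<lambda>i w. (\<Prod>j<i. (1 - z) - of_nat j) * w powr (1 - z - of_nat i))"
  define S where "S = closed_segment (of_real (c - r)) (of_real (c + r) :: complex)"
  define B where "B = norm ((z - 1) * z * (z + 1)) * (c - r) powr (- Re z - 2)"
  have S: "w \<in> of_real ` {c - r..c + r}" if "w \<in> S" for w
    using that r unfolding S_def closed_segment_of_real by (simp add: closed_segment_eq_real_ivl)
  have der: "(f i has_field_derivative f (Suc i) w) (at w within S)" if "w \<in> S" for i w
  proof -
    from S[OF that] obtain x where x: "w = of_real x" "x > 0" using r by auto
    hence "w \<notin> \<real>\<^sub>\<le>\<^sub>0" by (auto simp: complex_nonpos_Reals_iff)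
    thus ?thesis unfolding f_def
      by (auto intro!: derivative_eq_intros simp: algebra_simps)
  qed
  have bd: "norm (f (Suc 2) w) \<le> B" if "w \<in> S" for w
  proof -
    from S[OF that] obtain x where x: "w = of_real x" "x \<ge> c - r" using r by auto
    have "f (Suc 2) w = - ((z - 1) * z * (z + 1)) * w powr (1 - z - of_nat (Suc 2))"
      by (simp add: f_def numeral_2_eq_2 lessThan_Suc algebra_simps)
    also have "1 - z - of_nat (Suc 2) = - z - 2" by simp
    finally have "norm (f (Suc 2) w) = norm ((z - 1) * z * (z + 1)) * x powr (- Re z - 2)"
      using x r by (simp add: norm_mult norm_of_real_powr)
    also have "\<dots> \<le> norm ((z - 1) * z * (z + 1)) * (c - r) powr (- Re z - 2)"
      using x r z by (intro mult_left_mono powr_mono2') auto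
    finally show ?thesis by (simp add: B_def)
  qed
  have cS: "of_real c \<in> S" "of_real (c - r) \<in> S" "of_real (c + r) \<in> S"
    using r unfolding S_def closed_segment_of_real
    by (auto simp: closed_segment_eq_real_ivl simp del: of_real_add of_real_diff)
  have T: "norm (f 0 w - (\<Sum>i\<le>2. f i (of_real c) * (w - of_real c) ^ i / fact i)) \<le> B * r ^ 3 / 2"
    if "w = of_real (c - r) \<or> w = of_real (c + r)" for w
  proof -
    have "norm (f 0 w - (\<Sum>i\<le>2. f i (of_real c) * (w - of_real c) ^ i / fact i))
        \<le> B * norm (w - of_real c) ^ Suc 2 / fact 2"
      by (rule complex_Taylor[of S]) (use that cS der bd in \<open>auto simp: S_def\<close>)
    also have "norm (w - of_real c) = r" using that r by auto
    finally show ?thesis by (simp add: numeral_eq_Suc)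
  qed
  define P where "P = (\<lambda>w. f 0 w - (\<Sum>i\<le>2. f i (of_real c) * (w - of_real c) ^ i / fact i))"
  have "midpoint_defect c r z = (P (of_real (c + r)) - P (of_real (c - r))) / of_real (2 * r)"
    using r by (simp add: midpoint_defect_def P_def f_def numeral_2_eq_2 field_simps)
  also have "norm \<dots> \<le> (B * r ^ 3 / 2 + B * r ^ 3 / 2) / (2 * r)"
  proof -
    have "norm (P (of_real (c + r)) - P (of_real (c - r))) \<le> B * r ^ 3 / 2 + B * r ^ 3 / 2"
      unfolding P_def by (intro order_trans[OF norm_triangle_ineq4] add_mono T) auto
    thus ?thesis unfolding norm_divide using r by (simp add: divide_right_mono del: of_real_mult)
  qed
  also have "\<dots> = B * r\<^sup>2 / 2" using r by (simp add: field_simps power2_eq_square power3_eq_cube)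
  finally show ?thesis by (simp add: B_def mult_ac)
qed

lemma midpoint_defect_0: "0 < r \<Longrightarrow> r < c \<Longrightarrow> midpoint_defect c r 0 = 0"
  by (simp add: midpoint_defect_def)

lemma midpoint_defect_holomorphic:
  "0 < r \<Longrightarrow> r < c \<Longrightarrow> (\<lambda>z. midpoint_defect c r z) holomorphic_on S"
  unfolding midpoint_defect_def by (intro holomorphic_intros) auto

text \<open>
  The terms of odd order cancel, so the expansion to second order has an error of fourth order.
\<close>

lemma cosh_taylor4:
  fixes w :: complex
  shows "norm (exp w + exp (- w) - 2 - w\<^sup>2) \<le> norm w ^ 4 * exp (norm w)"
proof -
  have *: "norm (exp u - (\<Sum>k\<le>3. u ^ k / fact k)) \<le> exp (norm w) * norm w ^ 4 / 2" if "norm u = norm w" for u :: complex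
  proof -
    have "norm (exp u - (\<Sum>k\<le>3. u ^ k / fact k)) \<le> exp (norm u) * norm u ^ Suc 3 / fact 3"
      by (rule Taylor_exp_field)
    also have "\<dots> \<le> exp (norm w) * norm w ^ 4 / 2"
      unfolding that by (intro frac_le) (auto simp: numeral_eq_Suc fact_numeral)
    finally show ?thesis .
  qed
  have "exp w + exp (- w) - 2 - w\<^sup>2 = (exp w - (\<Sum>k\<le>3. w ^ k / fact k)) + (exp (-w) - (\<Sum>k\<le>3. (-w) ^ k / fact k))"
    by (simp add: numeral_eq_Suc fact_numeral field_simps)
  also have "norm \<dots> \<le> exp (norm w) * norm w ^ 4 / 2 + exp (norm w) * norm w ^ 4 / 2"
    by (intro order_trans[OF norm_triangle_ineq] add_mono *) auto
  finally show ?thesis by (simp add: mult.commute)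
qed

lemma square_le_exp_sum: "x\<^sup>2 \<le> exp x + exp (- x) - (2::real)"
proof -
  have "\<bar>x / 2\<bar> \<le> \<bar>(exp (x/2) - inverse (exp (x/2))) / 2\<bar>" by (rule real_le_abs_sinh)
  hence "\<bar>x\<bar> \<le> \<bar>exp (x/2) - exp (- x/2)\<bar>" by (simp add: exp_minus)
  hence "x\<^sup>2 \<le> (exp (x/2) - exp (- x/2))\<^sup>2" by (simp add: abs_le_square_iff)
  also have "\<dots> = exp x + exp (- x) - 2"
    by (simp add: power2_diff flip: exp_double exp_add)
  finally show ?thesis .
qed

text \<open>
  The contribution to \<open>\<zeta>\<^sub>1 - 3 \<zeta>\<^sub>0\<close> of one block with exact eigenvalue \<open>l\<close>: the two coexact eigenvalues
  are the squares of the roots of \<open>m\<^sup>2 + m = l\<close>, and \<open>l\<close> occurs once in \<open>\<zeta>\<^sub>1\<close> and three times in \<open>3 \<zeta>\<^sub>0\<close>.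
\<close>

definition pair_term :: "real \<Rightarrow> complex \<Rightarrow> complex" where
  "pair_term l s = of_real ((sqrt (l + 1/4) - 1/2)\<^sup>2) powr (- s)
     + of_real ((sqrt (l + 1/4) + 1/2)\<^sup>2) powr (- s) - 2 * of_real l powr (- s)"

lemma pair_roots:
  assumes "l > 0"
  shows "sqrt (l + 1/4) - 1/2 > 0" "(sqrt (l + 1/4) - 1/2) * (sqrt (l + 1/4) + 1/2) = l"
proof -
  have "sqrt (l + 1/4) > sqrt ((1/2)\<^sup>2)" using assms by (subst real_sqrt_less_iff) (simp add: power2_eq_square)
  thus "sqrt (l + 1/4) - 1/2 > 0" by simp
  show "(sqrt (l + 1/4) - 1/2) * (sqrt (l + 1/4) + 1/2) = l"
    using assms by (simp add: algebra_simps)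
qed

text \<open>
  Let \<open>p < q\<close> be the absolute values of the roots and \<open>d = ln q - ln p\<close>.  As \<open>p q = l\<close>, the pair term is
  \<open>l powr (- s) (2 cosh (s d) - 2)\<close>, and \<open>q - p = 1\<close> gives \<open>2 cosh d - 2 = 1 / l\<close>.  So the difference
  compares \<open>2 cosh (s d) - 2\<close> with \<open>s\<^sup>2 (2 cosh d - 2)\<close>, which agree to third order in \<open>d\<close>, and
  \<open>d\<^sup>2 \<le> 1 / l\<close>.
\<close>

lemma pair_term_bound:
  assumes l: "l > 0"
  shows "norm (pair_term l s - s\<^sup>2 * of_real l powr (- s - 1))
    \<le> (norm s ^ 4 * exp (norm s / sqrt l) + norm s ^ 2 * exp (1 / sqrt l)) * l powr (- Re s - 2)"
proof -
  define p where "p = sqrt (l + 1/4) - 1/2"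
  define q where "q = sqrt (l + 1/4) + 1/2"
  have pq: "p > 0" "q > 0" "p * q = l" "q - p = 1" "q > p"
    using pair_roots[OF l] by (auto simp: p_def q_def)
  define d where "d = ln q - ln p"
  have d0: "d > 0" using pq by (simp add: d_def)
  have lnl: "ln l = ln p + ln q" using pq by (metis ln_mult_pos)
  have "exp d + exp (- d) - 2 = q / p + p / q - 2"
    using pq(1,2) by (simp add: d_def exp_diff)
  also have "\<dots> = (q - p)\<^sup>2 / (p * q)" using pq(1,2) by (simp add: divide_simps power2_eq_square) (simp add: algebra_simps)
  finally have ed: "exp d + exp (- d) - 2 = 1 / l" using pq by simp
  have "d\<^sup>2 \<le> 1 / l" using square_le_exp_sum[of d] ed by simp
  hence "d \<le> sqrt (1 / l)" by (rule real_le_rsqrt)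
  hence dl: "d \<le> 1 / sqrt l" by (simp add: real_sqrt_divide)
  have d4: "d ^ 4 \<le> 1 / l\<^sup>2"
    using power_mono[OF \<open>d\<^sup>2 \<le> 1 / l\<close>, of 2] by (simp add: power_divide flip: power_mult)
  have powr_sq: "of_real (x\<^sup>2) powr (- s) = exp (- s * of_real (2 * ln x))" if "x > 0" for x :: real
    using that by (simp add: powr_def Ln_of_real ln_realpow flip: of_real_power)
  have ls: "of_real l powr w = exp (w * of_real (ln l))" for w :: complex
    using l by (simp add: powr_def Ln_of_real)
  define \<psi> where "\<psi> = (\<lambda>w::complex. exp w + exp (- w) - 2 - w\<^sup>2)"
  have p2: "of_real (p\<^sup>2) powr (- s) = of_real l powr (- s) * exp (s * of_real d)"
    unfolding powr_sq[OF pq(1)] ls lnl by (simp add: d_def algebra_simps flip: exp_add)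
  have q2: "of_real (q\<^sup>2) powr (- s) = of_real l powr (- s) * exp (- (s * of_real d))"
    unfolding powr_sq[OF pq(2)] ls lnl by (simp add: d_def algebra_simps flip: exp_add)
  have l1: "of_real l powr (- s - 1) = of_real l powr (- s) * of_real (exp d + exp (- d) - 2)"
    unfolding ed using l by (simp add: powr_diff)
  have "pair_term l s - s\<^sup>2 * of_real l powr (- s - 1)
      = of_real l powr (- s) * (\<psi> (s * of_real d) - s\<^sup>2 * \<psi> (of_real d))"
    unfolding pair_term_def p_def[symmetric] q_def[symmetric] p2 q2 l1
    by (simp add: \<psi>_def exp_of_real algebra_simps power_mult_distrib flip: of_real_minus)
  also have "norm \<dots> = l powr (- Re s) * norm (\<psi> (s * of_real d) - s\<^sup>2 * \<psi> (of_real d))"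
    using l by (simp add: norm_mult norm_of_real_powr)
  also have "norm (\<psi> (s * of_real d) - s\<^sup>2 * \<psi> (of_real d))
      \<le> (norm s * d) ^ 4 * exp (norm s * d) + norm s ^ 2 * (d ^ 4 * exp d)"
    using cosh_taylor4[of "s * of_real d"] cosh_taylor4[of "of_real d"] d0
    by (intro order_trans[OF norm_triangle_ineq4] add_mono)
       (auto simp: \<psi>_def norm_mult norm_power intro!: mult_left_mono)
  also have "\<dots> = d ^ 4 * (norm s ^ 4 * exp (norm s * d) + norm s ^ 2 * exp d)"
    by (simp add: algebra_simps power_mult_distrib)
  also have "\<dots> \<le> (1 / l\<^sup>2) * (norm s ^ 4 * exp (norm s / sqrt l) + norm s ^ 2 * exp (1 / sqrt l))"
    using d4 dl d0 mult_left_mono[OF dl, of "norm s"] by (intro mult_mono add_mono mult_left_mono) auto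
  finally have "norm (pair_term l s - s\<^sup>2 * of_real l powr (- s - 1))
      \<le> l powr (- Re s) * ((1 / l\<^sup>2) * (norm s ^ 4 * exp (norm s / sqrt l) + norm s ^ 2 * exp (1 / sqrt l)))"
    using l by (simp add: mult_left_mono)
  moreover have "l powr (- Re s - 2) = l powr (- Re s) / l\<^sup>2"
    using l by (simp add: powr_diff powr_numeral)
  ultimately show ?thesis by (simp add: mult_ac)
qed

text \<open>
  The eigenvalues of the Laplacian on functions, see \<open>oscillator_herm\<close>.
\<close>

definition osc :: "real \<Rightarrow> nat \<Rightarrow> real" where
  "osc \<tau> k = \<tau> * (\<tau> + (2 * real k + 1))"

text \<open>
  The subtracted term is \<open>s\<^sup>2\<close> times the mean of \<open>x powr (- s - 1)\<close> over the interval of length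
  \<open>2 \<tau>\<close> with midpoint \<open>osc \<tau> k\<close>.  These intervals are adjacent and start at \<open>\<tau>\<^sup>2\<close>, so that the sum over
  \<open>k\<close> telescopes to \<open>s / (2 \<tau>)\<close> times \<open>\<tau>\<^sup>2 powr (- s)\<close>.
\<close>

definition remainder_term :: "real \<Rightarrow> nat \<Rightarrow> complex \<Rightarrow> complex" where
  "remainder_term \<tau> k s = pair_term (osc \<tau> k) s
     - s / of_real (2 * \<tau>) * (of_real (osc \<tau> k - \<tau>) powr (- s) - of_real (osc \<tau> k + \<tau>) powr (- s))"

lemma osc_pos: "\<tau> > 0 \<Longrightarrow> osc \<tau> k > \<tau>" "\<tau> > 0 \<Longrightarrow> osc \<tau> k > 0" "\<tau> > 0 \<Longrightarrow> \<tau>\<^sup>2 \<le> osc \<tau> k"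
  by (auto simp: osc_def power2_eq_square algebra_simps add_strict_increasing add_pos_nonneg)

text \<open>
  The error consists of that of the approximation by \<open>s\<^sup>2 \<lambda> powr (- s - 1)\<close> and that of the midpoint rule.
\<close>

lemma remainder_term_split:
  "remainder_term \<tau> k s = (pair_term (osc \<tau> k) s - s\<^sup>2 * of_real (osc \<tau> k) powr (- s - 1))
     + s * midpoint_defect (osc \<tau> k) \<tau> (s + 1)"
proof -
  have "- (s + 1) = - s - 1" "1 - (s + 1) = - s" by simp_all
  thus ?thesis
    by (simp only: remainder_term_def midpoint_defect_def) (simp add: algebra_simps power2_eq_square diff_divide_distrib)
qed

text \<open>
  The exponents leave room for all later uses: the sum over \<open>k\<close> needs one larger than 1, which is
  21/16, and the integral over \<open>\<tau>\<close> with the weight \<open>\<tau>\<close> needs one larger than 2, which is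
  7/4 + 7/16 = 35/16.  They come from distributing the 7/4 of the factor \<open>\<tau> + 2 k + 1\<close> as 7/16 on \<open>\<tau>\<close>
  and 21/16 on \<open>2 k + 1\<close>.
\<close>

lemma osc_powr_bound:
  assumes "\<tau> > 0"
  shows "osc \<tau> k powr (- 7/4) \<le> \<tau> powr (- 35/16) * (2 * real k + 1) powr (- 21/16)"
proof -
  have "osc \<tau> k powr (- 7/4) = \<tau> powr (- 7/4) * (\<tau> + (2 * real k + 1)) powr (- 7/16 + - 21/16)"
    using assms by (simp add: osc_def powr_mult)
  also have "\<dots> = \<tau> powr (- 7/4) * ((\<tau> + (2 * real k + 1)) powr (- 7/16) * (\<tau> + (2 * real k + 1)) powr (- 21/16))"
    by (simp only: powr_add)
  also have "\<dots> \<le> \<tau> powr (- 7/4) * (\<tau> powr (- 7/16) * (2 * real k + 1) powr (- 21/16))"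
    using assms by (intro mult_left_mono mult_mono powr_mono2') auto
  also have "\<tau> powr (- 7/4) * (\<tau> powr (- 7/16) * (2 * real k + 1) powr (- 21/16)) = \<tau> powr (- 7/4 + - 7/16) * (2 * real k + 1) powr (- 21/16)"
    by (simp only: powr_add mult_ac)
  finally show ?thesis by simp
qed

text \<open>
  For \<open>\<tau> \<ge> \<tau>0\<close> the left end \<open>osc \<tau> k - \<tau>\<close> of the interval is at least the fixed fraction
  \<open>\<tau>0 / (\<tau>0 + 1)\<close> of its midpoint, and the square of its half length is at most the midpoint.
\<close>

lemma midpoint_osc_bound:
  assumes "\<tau>0 > 0" "S \<ge> 0"
  shows "\<exists>C\<ge>0. \<forall>\<tau> k z. \<tau> \<ge> \<tau>0 \<longrightarrow> Re z \<ge> -1/4 \<longrightarrow> norm z \<le> S \<longrightarrow>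
     norm (midpoint_defect (osc \<tau> k) \<tau> z) \<le> C * osc \<tau> k powr (- Re z - 1)"
proof -
  define c where "c = \<tau>0 / (\<tau>0 + 1)"
  have c: "c > 0" "c \<le> 1" using assms by (auto simp: c_def)
  define C where "C = (S + 1) * S * (S + 1) / 2 * c powr (- S - 2)"
  have "norm (midpoint_defect (osc \<tau> k) \<tau> z) \<le> C * osc \<tau> k powr (- Re z - 1)"
    if t: "\<tau> \<ge> \<tau>0" and z: "Re z \<ge> -1/4" "norm z \<le> S" for \<tau> k z
  proof -
    define l where "l = osc \<tau> k"
    have t0: "\<tau> > 0" using t assms by simp
    have l: "l > 0" "l > \<tau>" "\<tau>\<^sup>2 \<le> l" using osc_pos[OF t0, of k] by (auto simp: l_def)
    have "\<tau> * (\<tau>0 + 1) \<le> l" unfolding l_def osc_def using t t0 by (intro mult_left_mono) auto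
    hence cl: "c * l \<le> l - \<tau>" using assms by (simp add: c_def field_simps)
    have Rz: "Re z \<le> S" using z complex_Re_le_cmod[of z] by simp
    have "norm (midpoint_defect l \<tau> z) \<le> norm ((z - 1) * z * (z + 1)) * \<tau>\<^sup>2 / 2 * (l - \<tau>) powr (- Re z - 2)"
      using t0 l z by (intro midpoint_defect_bound) auto
    also have "(l - \<tau>) powr (- Re z - 2) \<le> (c * l) powr (- Re z - 2)"
      using z l c cl by (intro powr_mono2') auto
    also have "(c * l) powr (- Re z - 2) = c powr (- Re z - 2) * l powr (- Re z - 2)"
      using c l by (simp add: powr_mult)
    also have "c powr (- Re z - 2) \<le> c powr (- S - 2)"
      using c Rz by (intro powr_mono') auto
    also have "norm ((z - 1) * z * (z + 1)) \<le> (S + 1) * S * (S + 1)"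
      unfolding norm_mult using z norm_triangle_ineq4[of z 1] norm_triangle_ineq[of z 1] assms
      by (intro mult_mono) auto
    also have "(S + 1) * S * (S + 1) * \<tau>\<^sup>2 / 2 * (c powr (- S - 2) * l powr (- Re z - 2)) \<le>
       (S + 1) * S * (S + 1) * l / 2 * (c powr (- S - 2) * l powr (- Re z - 2))"
      using l assms by (intro mult_right_mono divide_right_mono mult_left_mono) auto
    also have "\<dots> = C * (l * l powr (- Re z - 2))" by (simp add: C_def)
    also have "l * l powr (- Re z - 2) = l powr (- Re z - 1)"
    proof -
      have "l powr (- Re z - 1) = l powr (1 + (- Re z - 2))" by (rule arg_cong[where f = "\<lambda>x. l powr x"]) simp
      thus ?thesis using l by (simp only: powr_add) simp
    qed
    finally show ?thesis by (simp add: l_def mult_right_mono mult_left_mono)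
  qed
  moreover have "C \<ge> 0" using assms by (simp add: C_def)
  ultimately show ?thesis by blast
qed

text \<open>
  Both errors are of the order of \<open>osc \<tau> k powr (- Re s - 2)\<close>, which for \<open>Re s \<ge> - 1/4\<close> is at most
  of the order of \<open>osc \<tau> k powr (- 7/4)\<close>.
\<close>

lemma remainder_term_bound:
  assumes "\<tau>0 > 0" "S \<ge> 0"
  shows "\<exists>C\<ge>0. \<forall>\<tau> k s. \<tau> \<ge> \<tau>0 \<longrightarrow> Re s \<ge> -1/4 \<longrightarrow> norm s \<le> S \<longrightarrow>
     norm (remainder_term \<tau> k s) \<le> C * \<tau> powr (- 35/16) * (2 * real k + 1) powr (- 21/16)"
proof -
  obtain D where D: "D \<ge> 0" "\<And>\<tau> k z. \<tau> \<ge> \<tau>0 \<Longrightarrow> Re z \<ge> -1/4 \<Longrightarrow> norm z \<le> S + 1 \<Longrightarrow>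
     norm (midpoint_defect (osc \<tau> k) \<tau> z) \<le> D * osc \<tau> k powr (- Re z - 1)"
    using midpoint_osc_bound[of \<tau>0 "S + 1"] assms by auto
  \<comment> \<open>A lower bound for all \<open>osc \<tau> k\<close>; being at most 1, its powers decrease with the exponent.\<close>
  define m where "m = min 1 (\<tau>0\<^sup>2)"
  have m: "m > 0" "m \<le> 1" "m \<le> \<tau>0\<^sup>2" using assms by (auto simp: m_def)
  define E where "E = S ^ 4 * exp (S / \<tau>0) + S ^ 2 * exp (1 / \<tau>0)"
  define C where "C = (E + S * D) * m powr (- S - 1/4)"
  have E: "E \<ge> 0" using assms by (simp add: E_def)
  have "norm (remainder_term \<tau> k s) \<le> C * \<tau> powr (- 35/16) * (2 * real k + 1) powr (- 21/16)"
    if t: "\<tau> \<ge> \<tau>0" and s: "Re s \<ge> -1/4" "norm s \<le> S" for \<tau> k s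
  proof -
    define l where "l = osc \<tau> k"
    have t0: "\<tau> > 0" using t assms by simp
    have l: "l > 0" "\<tau>\<^sup>2 \<le> l" using osc_pos[OF t0, of k] by (auto simp: l_def)
    have "\<tau>0\<^sup>2 \<le> l" using l(2) power_mono[OF t, of 2] assms by simp
    hence lm: "m \<le> l" and sl: "\<tau>0 \<le> sqrt l" using m assms real_le_rsqrt by auto
    have Rs: "Re s \<le> S" using s complex_Re_le_cmod[of s] by simp
    have "norm (pair_term l s - s\<^sup>2 * of_real l powr (- s - 1))
        \<le> (norm s ^ 4 * exp (norm s / sqrt l) + norm s ^ 2 * exp (1 / sqrt l)) * l powr (- Re s - 2)"
      by (rule pair_term_bound[OF l(1)])
    also have "\<dots> \<le> E * l powr (- Re s - 2)"
      unfolding E_def using s sl assms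
      by (intro mult_right_mono add_mono mult_mono power_mono) (auto intro!: frac_le)
    finally have 1: "norm (pair_term l s - s\<^sup>2 * of_real l powr (- s - 1)) \<le> E * l powr (- Re s - 2)" .
    have "norm (s * midpoint_defect l \<tau> (s + 1)) \<le> S * (D * l powr (- Re (s + 1) - 1))"
      unfolding norm_mult l_def using s norm_triangle_ineq[of s 1] t assms
      by (intro mult_mono D(2)) auto
    moreover have "- Re (s + 1) - 1 = - Re s - 2" by simp
    ultimately have 2: "norm (s * midpoint_defect l \<tau> (s + 1)) \<le> S * D * l powr (- Re s - 2)"
      by (simp only: mult.assoc)
    have "norm (remainder_term \<tau> k s) \<le> (E + S * D) * l powr (- Re s - 2)"
      unfolding remainder_term_split l_def[symmetric]
      by (rule order_trans[OF norm_triangle_ineq]) (use 1 2 in \<open>simp add: algebra_simps\<close>)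
    also have "l powr (- Re s - 2) = l powr (- Re s - 1/4) * l powr (- 7/4)"
    proof -
      have "l powr (- Re s - 2) = l powr ((- Re s - 1/4) + (- 7/4))" by (rule arg_cong[where f = "\<lambda>x. l powr x"]) simp
      thus ?thesis by (simp only: powr_add)
    qed
    also have "\<dots> \<le> m powr (- S - 1/4) * l powr (- 7/4)"
    proof (intro mult_right_mono)
      have "l powr (- Re s - 1/4) \<le> m powr (- Re s - 1/4)" using lm m s by (intro powr_mono2') auto
      also have "\<dots> \<le> m powr (- S - 1/4)" using m Rs by (intro powr_mono') auto
      finally show "l powr (- Re s - 1/4) \<le> m powr (- S - 1/4)" .
    qed auto
    also have "l powr (- 7/4) \<le> \<tau> powr (- 35/16) * (2 * real k + 1) powr (- 21/16)"
      unfolding l_def by (rule osc_powr_bound[OF t0])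
    finally show ?thesis using E D(1) assms
      by (simp add: C_def mult_left_mono mult_right_mono mult.assoc)
  qed
  moreover have "C \<ge> 0" using assms E D by (simp add: C_def)
  ultimately show ?thesis by blast
qed

text \<open>
  The derivative of the pair term at 0 is \<open>2 ln l\<close> minus the sum of the logarithms of the two coexact
  eigenvalues, whose product is \<open>l\<^sup>2\<close>.  The subtracted term has a double zero.
\<close>

lemma remainder_term_derivative_0:
  assumes "\<tau> > 0"
  shows "(remainder_term \<tau> k has_field_derivative 0) (at 0)"
proof -
  define l where "l = osc \<tau> k"
  have l: "l > 0" "l - \<tau> > 0" using osc_pos[OF assms, of k] by (auto simp: l_def)
  define p q where "p = (sqrt (l + 1/4) - 1/2)\<^sup>2" and "q = (sqrt (l + 1/4) + 1/2)\<^sup>2"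
  have pq: "p > 0" "q > 0" using pair_roots[OF l(1)] by (auto simp: p_def q_def zero_less_power)
  have "p * q = l\<^sup>2" using pair_roots(2)[OF l(1)] by (simp add: p_def q_def flip: power_mult_distrib)
  hence "ln (p * q) = ln (l\<^sup>2)" by simp
  hence ln: "ln p + ln q = 2 * ln l" using pq l by (simp add: ln_mult_pos ln_realpow)
  hence ln': "of_real (ln p) + of_real (ln q) = (2 * of_real (ln l) :: complex)"
    by (metis of_real_add of_real_mult of_real_numeral)
  have eq: "remainder_term \<tau> k = (\<lambda>s. of_real p powr (- s) + of_real q powr (- s) - 2 * of_real l powr (- s)
     - s / of_real (2 * \<tau>) * (of_real (l - \<tau>) powr (- s) - of_real (l + \<tau>) powr (- s)))"
    by (simp add: fun_eq_iff remainder_term_def pair_term_def l_def p_def q_def)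
  have der: "((\<lambda>s. of_real x powr (- s)) has_field_derivative (- of_real (ln x) :: complex)) (at 0)"
    if "x > 0" for x :: real
  proof -
    have "(\<lambda>s. of_real x powr (- s)) = (\<lambda>s. exp (- s * of_real (ln x) :: complex))"
      using that by (simp add: powr_def Ln_of_real fun_eq_iff)
    thus ?thesis by (simp only:) (auto intro!: derivative_eq_intros)
  qed
  have gen: "((\<lambda>s. A s + B s - 2 * C s - s / t * (D s - E s)) has_field_derivative 0) (at 0)"
    if "(A has_field_derivative a) (at 0)" "(B has_field_derivative b) (at 0)"
      "(C has_field_derivative c) (at 0)" "(D has_field_derivative d) (at 0)"
      "(E has_field_derivative e) (at 0)" "D 0 = E 0" "a + b = 2 * c" "t \<noteq> 0"
    for A B C D E :: "complex \<Rightarrow> complex" and a b c d e t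
    using that by (auto intro!: derivative_eq_intros)
  have "l + \<tau> > 0" using l assms by simp
  moreover have "- of_real (ln p) + - of_real (ln q) = 2 * - (of_real (ln l) :: complex)"
    using arg_cong[OF ln', of uminus] by simp
  ultimately show ?thesis unfolding eq using l pq assms
    by (intro gen[OF der[OF pq(1)] der[OF pq(2)] der[OF l(1)] der[OF l(2)] der])
       (simp_all del: of_real_add of_real_diff)
qed

lemma remainder_term_holomorphic: "\<tau> > 0 \<Longrightarrow> remainder_term \<tau> k holomorphic_on A"
proof -
  assume t: "\<tau> > 0"
  define l where "l = osc \<tau> k"
  have l: "l > 0" "l - \<tau> > 0" using osc_pos[OF t, of k] by (auto simp: l_def)
  define p q where "p = (sqrt (l + 1/4) - 1/2)\<^sup>2" and "q = (sqrt (l + 1/4) + 1/2)\<^sup>2"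
  have pq: "p > 0" "q > 0" using pair_roots[OF l(1)] by (auto simp: p_def q_def zero_less_power)
  have eq: "remainder_term \<tau> k = (\<lambda>s. of_real p powr (- s) + of_real q powr (- s) - 2 * of_real l powr (- s)
     - s / of_real (2 * \<tau>) * (of_real (l - \<tau>) powr (- s) - of_real (l + \<tau>) powr (- s)))"
    by (simp add: fun_eq_iff remainder_term_def pair_term_def l_def p_def q_def)
  show ?thesis unfolding eq using l pq t
    by (auto intro!: holomorphic_intros simp del: of_real_add of_real_diff)
qed

section \<open>Zeta functions of arithmetic progressions\<close>

lemma summable_powr_Suc: "p < -1 \<Longrightarrow> summable (\<lambda>k. (real k + 1) powr p)"
  using summable_real_powr_iff[of p] by (subst (asm) summable_Suc_iff[symmetric]) (simp add: add.commute)

lemma powr_progression_tendsto_0: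
  assumes "b > 0" "r > 0" "Re w > 0"
  shows "(\<lambda>k. of_real (b + 2 * r * real k) powr (- w) :: complex) \<longlonglongrightarrow> 0"
proof (rule tendsto_norm_zero_cancel)
  have "filterlim (\<lambda>k. b + 2 * r * real k) at_top sequentially"
    using assms by real_asymp
  hence "(\<lambda>k. (b + 2 * r * real k) powr (- Re w)) \<longlonglongrightarrow> 0"
    using assms by (intro tendsto_neg_powr) auto
  moreover have "norm (of_real (b + 2 * r * real k) powr (- w) :: complex) = (b + 2 * r * real k) powr (- Re w)" for k
    using assms by (subst norm_of_real_powr) (auto intro: add_pos_nonneg)
  ultimately show "(\<lambda>k. norm (of_real (b + 2 * r * real k) powr (- w) :: complex)) \<longlonglongrightarrow> 0" by simp
qed

lemma powr_progression_telescope: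
  assumes "b > 0" "r > 0" "Re w > 0"
  shows "(\<lambda>k. of_real (b + 2 * r * real k) powr (- w) - of_real (b + 2 * r * real k + 2 * r) powr (- w) :: complex)
     sums (of_real b powr (- w))"
proof -
  have "(\<lambda>k. of_real (b + 2 * r * real k) powr (- w) - of_real (b + 2 * r * real (Suc k)) powr (- w) :: complex)
     sums (of_real (b + 2 * r * real 0) powr (- w) - 0)"
    by (rule telescope_sums'[OF powr_progression_tendsto_0[OF assms]])
  moreover have "b + 2 * r * real (Suc k) = b + 2 * r * real k + 2 * r" for k by (simp add: algebra_simps)
  ultimately show ?thesis by (simp only:) simp
qed

lemma progression_gt:
  fixes r a :: real
  assumes "0 < r" "r < a"
  shows "r < a + 2 * r * real k"
proof -
  have "0 \<le> 2 * r * real k" using assms by simp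
  thus ?thesis using assms by linarith
qed

definition progression_defect :: "real \<Rightarrow> real \<Rightarrow> complex \<Rightarrow> complex" where
  "progression_defect a r z = (\<Sum>k. midpoint_defect (a + 2 * r * real k) r z)"

text \<open>
  The zeta function of the progression \<open>a, a + 2 r, a + 4 r, ...\<close>, continued by the midpoint rule with
  adjacent intervals of length \<open>2 r\<close>.  For \<open>r = 1/2\<close> it is the Hurwitz zeta function of \<open>a\<close>.
\<close>

definition progression_zeta :: "real \<Rightarrow> real \<Rightarrow> complex \<Rightarrow> complex" where
  "progression_zeta a r z = (of_real (a - r) powr (1 - z) / of_real (2 * r) + progression_defect a r z) / (z - 1)"

lemma progression_defect_bound:
  assumes "0 < r" "r < a" "S \<ge> 0"
  shows "\<exists>C. \<forall>z k. Re z \<ge> - 1/2 \<longrightarrow> norm z \<le> S \<longrightarrow>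
    norm (midpoint_defect (a + 2 * r * real k) r z) \<le> C * (real k + 1) powr (- 3/2)"
proof -
  \<comment> \<open>Chosen so that \<open>m * (k + 1)\<close> bounds the left end of the interval number \<open>k\<close> from below.\<close>
  define m where "m = Min {1, a - r, 2 * r}"
  have m: "m > 0" "m \<le> 1" "m \<le> a - r" "m \<le> 2 * r" using assms by (auto simp: m_def)
  have "norm (midpoint_defect (a + 2 * r * real k) r z)
      \<le> ((S + 1) * S * (S + 1) * r\<^sup>2 / 2 * m powr (- S - 2)) * (real k + 1) powr (- 3/2)"
    if z: "Re z \<ge> - 1/2" "norm z \<le> S" for z k
  proof -
    define c where "c = a + 2 * r * real k"
    have "m * (real k + 1) \<le> a - r + 2 * r * real k"
      using m mult_right_mono[OF m(4), of "real k"] by (simp add: algebra_simps)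
    hence ck: "m * (real k + 1) \<le> c - r" by (simp add: c_def)
    have Rz: "Re z \<le> S" using z complex_Re_le_cmod[of z] by simp
    have "norm (midpoint_defect c r z) \<le> norm ((z - 1) * z * (z + 1)) * r\<^sup>2 / 2 * (c - r) powr (- Re z - 2)"
      using assms z by (intro midpoint_defect_bound) (auto simp: c_def progression_gt)
    also have "(c - r) powr (- Re z - 2) \<le> (m * (real k + 1)) powr (- Re z - 2)"
      using z m ck by (intro powr_mono2') auto
    also have "\<dots> = m powr (- Re z - 2) * (real k + 1) powr (- Re z - 2)" using m by (simp add: powr_mult)
    also have "\<dots> \<le> m powr (- S - 2) * (real k + 1) powr (- 3/2)"
    proof (rule mult_mono)
      show "m powr (- Re z - 2) \<le> m powr (- S - 2)" using m Rz by (intro powr_mono') auto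
      show "(real k + 1) powr (- Re z - 2) \<le> (real k + 1) powr (- 3/2)" proof (rule powr_mono)
        show "- Re z - 2 \<le> - 3/2" using z(1) by argo
      qed simp
    qed auto
    also have "norm ((z - 1) * z * (z + 1)) \<le> (S + 1) * S * (S + 1)"
      unfolding norm_mult using z norm_triangle_ineq4[of z 1] norm_triangle_ineq[of z 1] assms
      by (intro mult_mono) auto
    finally show ?thesis by (simp add: c_def mult_left_mono mult_right_mono divide_right_mono)
  qed
  thus ?thesis by blast
qed

lemma cball_in_halfplane:
  assumes "Re s0 > d"
  obtains r where "r > 0" "cball s0 r \<subseteq> {s. Re s > d}" "\<And>s. s \<in> cball s0 r \<Longrightarrow> norm s \<le> norm s0 + r"
proof -
  define r where "r = (Re s0 - d) / 2"
  have r: "r > 0" using assms by (simp add: r_def)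
  have "Re s > d" if "s \<in> cball s0 r" for s
  proof -
    have "\<bar>Re (s0 - s)\<bar> \<le> r" using that abs_Re_le_cmod[of "s0 - s"] by (simp add: dist_norm)
    thus ?thesis using assms by (simp add: r_def abs_if split: if_splits)
  qed
  moreover have "norm s \<le> norm s0 + r" if "s \<in> cball s0 r" for s
    using that norm_triangle_ineq2[of s s0] by (simp add: dist_norm norm_minus_commute)
  ultimately show ?thesis using that r by blast
qed

text \<open>
  The dominating function may depend on the size of \<open>s\<close>, as a closed disc about \<open>s\<close> inside the half plane is bounded.
\<close>

lemma integral_derivative_halfplane:
  fixes f :: "complex \<Rightarrow> 'a \<Rightarrow> complex"
  assumes s0: "Re s0 > d"
    and meas: "\<And>s. Re s > d \<Longrightarrow> f s \<in> borel_measurable M"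
    and hol: "\<And>x. x \<in> space M \<Longrightarrow> (\<lambda>s. f s x) holomorphic_on {s. Re s > d}"
    and dom: "\<And>S. S \<ge> 0 \<Longrightarrow> \<exists>w. integrable M w \<and> (\<forall>s x. Re s > d \<longrightarrow> norm s \<le> S \<longrightarrow> x \<in> space M \<longrightarrow> norm (f s x) \<le> w x)"
  shows "((\<lambda>s. \<integral>x. f s x \<partial>M) has_field_derivative (\<integral>x. deriv (\<lambda>s. f s x) s0 \<partial>M)) (at s0)"
    and "integrable M (f s0)"
proof -
  obtain r where r: "r > 0" "cball s0 r \<subseteq> {s. Re s > d}" "\<And>s. s \<in> cball s0 r \<Longrightarrow> norm s \<le> norm s0 + r"
    using cball_in_halfplane[OF s0] by blast
  obtain w where w: "integrable M w" "\<And>s x. Re s > d \<Longrightarrow> norm s \<le> norm s0 + r \<Longrightarrow> x \<in> space M \<Longrightarrow> norm (f s x) \<le> w x"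
    using dom[of "norm s0 + r"] r(1) by auto
  show "((\<lambda>s. \<integral>x. f s x \<partial>M) has_field_derivative (\<integral>x. deriv (\<lambda>s. f s x) s0 \<partial>M)) (at s0)"
  proof (rule has_field_derivative_integral_dominated[of _ "{s. Re s > d}" _ _ r w])
    show "open {s. Re s > d}" by (rule open_halfspace_Re_gt)
  qed (use assms r w in auto)
  show "integrable M (f s0)"
    using w(2)[OF s0] r(1) s0
    by (intro Bochner_Integration.integrable_bound[OF w(1) meas] AE_I2) (auto intro: order_trans[OF _ abs_ge_self])
qed

text \<open>
  The preceding lemma for the counting measure on the natural numbers.
\<close>

lemma suminf_derivative_halfplane:
  fixes f :: "complex \<Rightarrow> nat \<Rightarrow> complex"
  assumes s0: "Re s0 > d"
    and hol: "\<And>k. (\<lambda>s. f s k) holomorphic_on {s. Re s > d}"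
    and dom: "\<And>S. S \<ge> 0 \<Longrightarrow> \<exists>w. summable w \<and> (\<forall>s k. Re s > d \<longrightarrow> norm s \<le> S \<longrightarrow> norm (f s k) \<le> w k)"
  shows "summable (\<lambda>k. norm (f s0 k))"
    and "((\<lambda>s. \<Sum>k. f s k) has_field_derivative (\<integral>k. deriv (\<lambda>s. f s k) s0 \<partial>count_space UNIV)) (at s0)"
proof -
  have sm: "summable (\<lambda>k. norm (f s k))" if s: "Re s > d" for s
  proof -
    obtain w where "summable w" "\<And>k. norm (f s k) \<le> w k" using dom[of "norm s"] s by auto
    thus ?thesis by (intro summable_comparison_test[OF _ \<open>summable w\<close>]) auto
  qed
  show "summable (\<lambda>k. norm (f s0 k))" by (rule sm[OF s0])
  have dom': "\<exists>w. integrable (count_space UNIV) w \<and>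
      (\<forall>s k. Re s > d \<longrightarrow> norm s \<le> S \<longrightarrow> k \<in> space (count_space UNIV) \<longrightarrow> norm (f s k) \<le> w k)" if S: "S \<ge> 0" for S
  proof -
    obtain w where w: "summable w" "\<And>s k. Re s > d \<Longrightarrow> norm s \<le> S \<Longrightarrow> norm (f s k) \<le> w k"
      using dom[OF S] by auto
    define v where "v k = (if \<exists>s. Re s > d \<and> norm s \<le> S then w k else 0)" for k
    have "norm (v k) \<le> w k \<or> (\<forall>k. v k = 0)" for k
      using w(2)[of _ k] order_trans[OF norm_ge_zero w(2)] unfolding v_def by auto
    hence "summable (\<lambda>k. norm (v k))"
      by (cases "\<forall>k. v k = 0") (auto intro!: summable_comparison_test[OF _ w(1)])
    hence "integrable (count_space UNIV) v" by (simp add: integrable_count_space_nat_iff)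
    moreover have "norm (f s k) \<le> v k" if "Re s > d" "norm s \<le> S" for s k
      using w(2)[OF that] that by (auto simp: v_def)
    ultimately show ?thesis by blast
  qed
  have "((\<lambda>s. \<integral>k. f s k \<partial>count_space UNIV) has_field_derivative (\<integral>k. deriv (\<lambda>s. f s k) s0 \<partial>count_space UNIV)) (at s0)"
    by (rule integral_derivative_halfplane(1)[OF s0 _ hol dom']) auto
  moreover have "eventually (\<lambda>s. s \<in> {s. Re s > d}) (nhds s0)"
    using s0 by (intro eventually_nhds_in_open open_halfspace_Re_gt) auto
  hence "eventually (\<lambda>s. (\<Sum>k. f s k) = (\<integral>k. f s k \<partial>count_space UNIV)) (nhds s0)"
    by eventually_elim (simp add: integral_count_space_nat integrable_count_space_nat_iff sm)
  ultimately show "((\<lambda>s. \<Sum>k. f s k) has_field_derivative (\<integral>k. deriv (\<lambda>s. f s k) s0 \<partial>count_space UNIV)) (at s0)"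
    by (subst DERIV_cong_ev[OF refl _ refl]) auto
qed

lemma progression_defect_holomorphic:
  assumes "0 < r" "r < a"
  shows "progression_defect a r holomorphic_on {z. Re z > - 1/2}"
    and "Re z > - 1/2 \<Longrightarrow> summable (\<lambda>k. midpoint_defect (a + 2 * r * real k) r z)"
proof -
  have hol: "midpoint_defect (a + 2 * r * real k) r holomorphic_on A" for k A
    using assms by (intro midpoint_defect_holomorphic progression_gt)
  have dom: "\<exists>w. summable w \<and> (\<forall>s k. - 1/2 < Re s \<longrightarrow> norm s \<le> S \<longrightarrow> norm (midpoint_defect (a + 2 * r * real k) r s) \<le> w k)"
    if S: "S \<ge> 0" for S
  proof -
    obtain C where "\<And>z k. Re z \<ge> - 1/2 \<Longrightarrow> norm z \<le> S \<Longrightarrow>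
      norm (midpoint_defect (a + 2 * r * real k) r z) \<le> C * (real k + 1) powr (- 3/2)"
      using progression_defect_bound[OF assms S] by metis
    moreover have "summable (\<lambda>k. C * (real k + 1) powr (- 3/2))"
      by (intro summable_mult summable_powr_Suc) auto
    ultimately show ?thesis by (intro exI[of _ "\<lambda>k. C * (real k + 1) powr (- 3/2)"]) auto
  qed
  note * = suminf_derivative_halfplane[where f = "\<lambda>z k. midpoint_defect (a + 2 * r * real k) r z", OF _ hol dom]
  show "progression_defect a r holomorphic_on {z. Re z > - 1/2}"
  proof (rule holomorphic_onI, rule field_differentiable_at_within)
    fix z assume "z \<in> {z. Re z > - 1/2}"
    hence "Re z > - 1/2" by simp
    thus "progression_defect a r field_differentiable at z"
      using *(2)[of z] unfolding progression_defect_def field_differentiable_def by blast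
  qed
  show "summable (\<lambda>k. midpoint_defect (a + 2 * r * real k) r z)" if "Re z > - 1/2"
    using *(1)[OF that] by (rule summable_norm_cancel)
qed

lemma progression_zeta_sums:
  assumes r: "0 < r" "r < a" and z: "Re z > 1"
  shows "(\<lambda>k. of_real (a + 2 * r * real k) powr (- z)) sums progression_zeta a r z"
proof -
  have z1: "z \<noteq> 1" using z by auto
  have "(\<lambda>k. midpoint_defect (a + 2 * r * real k) r z) sums progression_defect a r z"
    unfolding progression_defect_def using progression_defect_holomorphic(2)[OF r, of z] z
    by (intro summable_sums) auto
  moreover have "(\<lambda>k. (of_real (a - r + 2 * r * real k) powr (- (z - 1)) - of_real (a - r + 2 * r * real k + 2 * r) powr (- (z - 1))) / of_real (2 * r))
     sums (of_real (a - r) powr (- (z - 1)) / of_real (2 * r) :: complex)"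
    using r z by (intro sums_divide powr_progression_telescope) auto
  ultimately have "(\<lambda>k. ((of_real (a - r + 2 * r * real k) powr (- (z - 1)) - of_real (a - r + 2 * r * real k + 2 * r) powr (- (z - 1))) / of_real (2 * r)
     + midpoint_defect (a + 2 * r * real k) r z) / (z - 1))
     sums ((of_real (a - r) powr (- (z - 1)) / of_real (2 * r) + progression_defect a r z) / (z - 1))"
    by (intro sums_divide[where c = "z - 1"] sums_add)
  moreover have "((of_real (a - r + 2 * r * real k) powr (- (z - 1)) - of_real (a - r + 2 * r * real k + 2 * r) powr (- (z - 1))) / of_real (2 * r)
     + midpoint_defect (a + 2 * r * real k) r z) / (z - 1) = of_real (a + 2 * r * real k) powr (- z)" for k
  proof -
    have e: "a + 2 * r * real k - r = a - r + 2 * r * real k" "a + 2 * r * real k + r = a - r + 2 * r * real k + 2 * r"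
      "1 - z = - (z - 1)" by simp_all
    show ?thesis using z1 unfolding midpoint_defect_def e by simp
  qed
  moreover have "- (z - 1) = 1 - z" by simp
  ultimately show ?thesis by (simp only: progression_zeta_def)
qed

lemma progression_zeta_analytic:
  assumes "0 < r" "r < a"
  shows "progression_zeta a r holomorphic_on {z. Re z > - 1/2} - {1}"
  unfolding progression_zeta_def using assms
  by (intro holomorphic_intros holomorphic_on_subset[OF progression_defect_holomorphic(1)[OF assms]])
     (auto simp del: of_real_diff)

lemma progression_zeta_0:
  assumes "0 < r" "r < a"
  shows "progression_zeta a r 0 = - of_real ((a - r) / (2 * r))"
proof -
  have "progression_defect a r 0 = 0" unfolding progression_defect_def
    using assms by (simp add: midpoint_defect_0 progression_gt)
  thus ?thesis using assms by (simp add: progression_zeta_def)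
qed

section \<open>The torsion zeta function of one representation\<close>

definition torsion_remainder :: "real \<Rightarrow> complex \<Rightarrow> complex" where
  "torsion_remainder \<tau> s = (\<Sum>k. remainder_term \<tau> k s)"

text \<open>
  The continuation of the torsion zeta function of the representation with parameter \<open>\<tau> = 2 \<pi> \<bar>h\<bar>\<close>,
  see \<open>torsion_zeta_eq\<close>: the telescoped main terms and the sum of the errors.
\<close>

definition torsion_cont :: "real \<Rightarrow> complex \<Rightarrow> complex" where
  "torsion_cont \<tau> s = s / 2 * of_real \<tau> powr (- 2 * s - 1) + torsion_remainder \<tau> s"

lemma torsion_remainder_bound:
  assumes "\<tau>0 > 0" "S \<ge> 0"
  shows "\<exists>C\<ge>0. \<forall>\<tau> s. \<tau> \<ge> \<tau>0 \<longrightarrow> Re s > -1/4 \<longrightarrow> norm s \<le> S \<longrightarrow>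
     summable (\<lambda>k. norm (remainder_term \<tau> k s)) \<and> norm (torsion_remainder \<tau> s) \<le> C * \<tau> powr (- 35/16)"
proof -
  obtain C where C: "C \<ge> 0" "\<forall>\<tau> k s. \<tau> \<ge> \<tau>0 \<longrightarrow> Re s \<ge> -1/4 \<longrightarrow> norm s \<le> S \<longrightarrow>
     norm (remainder_term \<tau> k s) \<le> C * \<tau> powr (- 35/16) * (2 * real k + 1) powr (- 21/16)"
    using remainder_term_bound[OF assms] by blast
  define A where "A = (\<Sum>k. (real k + 1) powr (- 21/16))"
  have sA: "summable (\<lambda>k. (real k + 1) powr (- 21/16))" by (rule summable_powr_Suc) simp
  have A0: "A \<ge> 0" unfolding A_def by (rule suminf_nonneg[OF sA]) simp
  have "summable (\<lambda>k. norm (remainder_term \<tau> k s)) \<and> norm (torsion_remainder \<tau> s) \<le> C * A * \<tau> powr (- 35/16)"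
    if t: "\<tau> \<ge> \<tau>0" "Re s > -1/4" "norm s \<le> S" for \<tau> s
  proof -
    have b: "norm (remainder_term \<tau> k s) \<le> C * \<tau> powr (- 35/16) * (real k + 1) powr (- 21/16)" for k
    proof -
      have "norm (remainder_term \<tau> k s) \<le> C * \<tau> powr (- 35/16) * (2 * real k + 1) powr (- 21/16)"
        using C(2) t by simp
      also have "\<dots> \<le> C * \<tau> powr (- 35/16) * (real k + 1) powr (- 21/16)"
        using C(1) by (intro mult_left_mono powr_mono2') auto
      finally show ?thesis .
    qed
    have sb: "summable (\<lambda>k. C * \<tau> powr (- 35/16) * (real k + 1) powr (- 21/16))"
      by (rule summable_mult[OF sA])
    have sn: "summable (\<lambda>k. norm (remainder_term \<tau> k s))"
      by (rule summable_comparison_test[OF _ sb]) (use b in auto)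
    have "norm (torsion_remainder \<tau> s) \<le> (\<Sum>k. norm (remainder_term \<tau> k s))"
      unfolding torsion_remainder_def by (rule summable_norm[OF sn])
    also have "\<dots> \<le> (\<Sum>k. C * \<tau> powr (- 35/16) * (real k + 1) powr (- 21/16))"
      by (rule suminf_le[OF b sn sb])
    also have "\<dots> = C * A * \<tau> powr (- 35/16)"
      unfolding A_def by (subst suminf_mult[OF sA]) (simp add: mult_ac)
    finally show ?thesis using sn by simp
  qed
  moreover have "C * A \<ge> 0" using C A0 by simp
  ultimately show ?thesis by blast
qed

text \<open>
  The bound on the terms is uniform on bounded parts of the half plane, so the series may be
  differentiated term by term, and every term has derivative zero at 0.
\<close>

lemma torsion_remainder_derivatives:
  assumes t: "\<tau> > 0"
  shows "torsion_remainder \<tau> holomorphic_on {s. Re s > -1/4}"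
    and "(torsion_remainder \<tau> has_field_derivative 0) (at 0)"
    and "Re s > -1/4 \<Longrightarrow> summable (\<lambda>k. norm (remainder_term \<tau> k s))"
proof -
  have hol: "remainder_term \<tau> k holomorphic_on A" for k A
    by (rule remainder_term_holomorphic[OF t])
  have dom: "\<exists>w. summable w \<and> (\<forall>s k. -1/4 < Re s \<longrightarrow> norm s \<le> S \<longrightarrow> norm (remainder_term \<tau> k s) \<le> w k)"
    if S: "S \<ge> 0" for S
  proof -
    obtain C where C: "C \<ge> 0" "\<forall>\<tau>' k s. \<tau>' \<ge> \<tau> \<longrightarrow> Re s \<ge> -1/4 \<longrightarrow> norm s \<le> S \<longrightarrow>
       norm (remainder_term \<tau>' k s) \<le> C * \<tau>' powr (- 35/16) * (2 * real k + 1) powr (- 21/16)"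
      using remainder_term_bound[OF t S] by blast
    have "norm (remainder_term \<tau> k s) \<le> C * \<tau> powr (- 35/16) * (real k + 1) powr (- 21/16)"
      if "Re s > -1/4" "norm s \<le> S" for k s
    proof -
      have "norm (remainder_term \<tau> k s) \<le> C * \<tau> powr (- 35/16) * (2 * real k + 1) powr (- 21/16)"
        using C(2) that by simp
      also have "\<dots> \<le> C * \<tau> powr (- 35/16) * (real k + 1) powr (- 21/16)"
        using C(1) by (intro mult_left_mono powr_mono2') auto
      finally show ?thesis .
    qed
    moreover have "summable (\<lambda>k. C * \<tau> powr (- 35/16) * (real k + 1) powr (- 21/16))"
      by (intro summable_mult summable_powr_Suc) simp
    ultimately show ?thesis by blast
  qed
  note * = suminf_derivative_halfplane[where f = "\<lambda>s k. remainder_term \<tau> k s", OF _ hol dom]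
  show "torsion_remainder \<tau> holomorphic_on {s. Re s > -1/4}"
  proof (rule holomorphic_onI, rule field_differentiable_at_within)
    fix s assume "s \<in> {s. Re s > -1/4}"
    hence "Re s > -1/4" by simp
    thus "torsion_remainder \<tau> field_differentiable at s"
      using *(2)[of s] unfolding torsion_remainder_def field_differentiable_def by blast
  qed
  have "deriv (\<lambda>s. remainder_term \<tau> k s) 0 = 0" for k
    by (rule DERIV_imp_deriv) (use remainder_term_derivative_0[OF t] in simp)
  thus "(torsion_remainder \<tau> has_field_derivative 0) (at 0)"
    using *(2)[of 0] unfolding torsion_remainder_def by simp
  show "summable (\<lambda>k. norm (remainder_term \<tau> k s))" if "Re s > -1/4"
    using *(1)[OF that] .
qed

lemma pair_term_sums:
  assumes t: "\<tau> > 0" and s: "Re s > 0"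
  shows "(\<lambda>k. pair_term (osc \<tau> k) s) sums torsion_cont \<tau> s"
proof -
  have "Re s > -1/4" using s by simp
  hence "summable (\<lambda>k. remainder_term \<tau> k s)"
    by (rule summable_norm_cancel[OF torsion_remainder_derivatives(3)[OF t]])
  hence 1: "(\<lambda>k. remainder_term \<tau> k s) sums torsion_remainder \<tau> s"
    unfolding torsion_remainder_def by (rule summable_sums)
  have "(\<lambda>k. of_real (\<tau>\<^sup>2 + 2 * \<tau> * real k) powr (- s) - of_real (\<tau>\<^sup>2 + 2 * \<tau> * real k + 2 * \<tau>) powr (- s) :: complex)
     sums (of_real (\<tau>\<^sup>2) powr (- s))"
    using t s by (intro powr_progression_telescope) auto
  moreover have "\<tau>\<^sup>2 + 2 * \<tau> * real k = osc \<tau> k - \<tau>" "\<tau>\<^sup>2 + 2 * \<tau> * real k + 2 * \<tau> = osc \<tau> k + \<tau>" for k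
    by (simp_all add: osc_def algebra_simps power2_eq_square)
  ultimately have "(\<lambda>k. of_real (osc \<tau> k - \<tau>) powr (- s) - of_real (osc \<tau> k + \<tau>) powr (- s) :: complex)
     sums (of_real (\<tau>\<^sup>2) powr (- s))" by (simp only:)
  from sums_add[OF 1 sums_mult[OF this, of "s / of_real (2 * \<tau>)"]]
  have "(\<lambda>k. pair_term (osc \<tau> k) s) sums (torsion_remainder \<tau> s + s / of_real (2 * \<tau>) * of_real (\<tau>\<^sup>2) powr (- s))"
    by (simp add: remainder_term_def del: of_real_add of_real_diff)
  also have "torsion_remainder \<tau> s + s / of_real (2 * \<tau>) * of_real (\<tau>\<^sup>2) powr (- s) = torsion_cont \<tau> s"
  proof -
    have "of_real (\<tau>\<^sup>2) powr (- s) = (of_real \<tau> powr (- 2 * s) :: complex)"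
      using t by (simp add: powr_def Ln_of_real ln_realpow mult_ac flip: of_real_power)
    moreover have "of_real \<tau> powr (- 2 * s - 1) = (of_real \<tau> powr (- 2 * s) / of_real \<tau> :: complex)"
      using t by (simp add: powr_diff)
    ultimately show ?thesis by (simp add: torsion_cont_def)
  qed
  finally show ?thesis .
qed

text \<open>
  Powers of positive reals are written by \<open>exp\<close> and \<open>ln\<close>, to which the measurability prover applies.
\<close>

lemma remainder_term_measurable:
  assumes [measurable]: "\<tau> \<in> borel_measurable M" and t: "\<And>x. x \<in> space M \<Longrightarrow> \<tau> x > 0"
  shows "(\<lambda>x. remainder_term (\<tau> x) k s) \<in> borel_measurable M"
proof -
  define E where "E y = exp (- s * of_real (ln y))" for y :: real
  define y where "y x = sqrt (osc (\<tau> x) k + 1/4)" for x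
  have E: "of_real r powr (- s) = E r" if "r > 0" for r
    using that by (simp add: E_def powr_def Ln_of_real)
  have [measurable]: "E \<in> borel_measurable borel" unfolding E_def by measurable
  have [measurable]: "(\<lambda>x. osc (\<tau> x) k) \<in> borel_measurable M" unfolding osc_def by measurable
  have [measurable]: "y \<in> borel_measurable M" unfolding y_def by measurable
  have "(\<lambda>x. E ((y x - 1/2)\<^sup>2) + E ((y x + 1/2)\<^sup>2) - 2 * E (osc (\<tau> x) k)
     - s / of_real (2 * \<tau> x) * (E (osc (\<tau> x) k - \<tau> x) - E (osc (\<tau> x) k + \<tau> x))) \<in> borel_measurable M"
    by measurable
  also have "?this \<longleftrightarrow> (\<lambda>x. remainder_term (\<tau> x) k s) \<in> borel_measurable M"
  proof (rule measurable_cong)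
    fix x assume x: "x \<in> space M"
    note pos = osc_pos[OF t[OF x], of k] pair_roots[OF osc_pos(2)[OF t[OF x], of k]]
    show "E ((y x - 1/2)\<^sup>2) + E ((y x + 1/2)\<^sup>2) - 2 * E (osc (\<tau> x) k)
     - s / of_real (2 * \<tau> x) * (E (osc (\<tau> x) k - \<tau> x) - E (osc (\<tau> x) k + \<tau> x)) = remainder_term (\<tau> x) k s"
      unfolding remainder_term_def pair_term_def y_def
      using pos t[OF x] by (subst (1 2 3 4 5) E) (auto simp: zero_less_power)
  qed
  finally show ?thesis .
qed

text \<open>
  This is why the remainder contributes to none of the three invariants.  Its decay in \<open>\<tau>\<close> lets one
  differentiate under the integral sign, and the derivative at 0 is zero for every single \<open>\<tau>\<close>.  The
  measure is that of an interval of representations for the relative torsion and counts the characters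
  \<open>n + \<alpha>\<close> for the other two invariants.
\<close>

lemma weighted_remainder:
  fixes c \<tau> :: "'a \<Rightarrow> real"
  assumes c[measurable]: "c \<in> borel_measurable M" and \<tau>[measurable]: "\<tau> \<in> borel_measurable M"
    and t0: "\<tau>0 > 0" "\<And>x. x \<in> space M \<Longrightarrow> \<tau> x \<ge> \<tau>0"
    and int: "integrable M (\<lambda>x. \<bar>c x\<bar> * \<tau> x powr (- 35/16))"
  shows "(\<lambda>s. \<integral>x. of_real (c x) * torsion_remainder (\<tau> x) s \<partial>M) holomorphic_on {s. Re s > -1/4}" (is ?A)
    and "((\<lambda>s. \<integral>x. of_real (c x) * torsion_remainder (\<tau> x) s \<partial>M) has_field_derivative 0) (at 0)" (is ?B)
    and "Re s > -1/4 \<Longrightarrow> integrable M (\<lambda>x. of_real (c x) * torsion_remainder (\<tau> x) s)" (is "_ \<Longrightarrow> ?C")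
proof -
  have tx: "\<tau> x > 0" if "x \<in> space M" for x using t0(1) t0(2)[OF that] by simp
  have meas: "(\<lambda>x. of_real (c x) * torsion_remainder (\<tau> x) s) \<in> borel_measurable M" for s
    unfolding torsion_remainder_def
    using remainder_term_measurable[OF \<tau> tx] by (intro borel_measurable_times borel_measurable_suminf) measurable
  have hol: "(\<lambda>s. of_real (c x) * torsion_remainder (\<tau> x) s) holomorphic_on {s. Re s > -1/4}" if "x \<in> space M" for x
    by (intro holomorphic_intros torsion_remainder_derivatives(1) tx that)
  have dom: "\<exists>w. integrable M w \<and> (\<forall>s x. -1/4 < Re s \<longrightarrow> norm s \<le> S \<longrightarrow> x \<in> space M \<longrightarrow>
      norm (of_real (c x) * torsion_remainder (\<tau> x) s) \<le> w x)" if S: "S \<ge> 0" for S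
  proof -
    obtain C where C: "C \<ge> 0" "\<forall>\<tau> s. \<tau> \<ge> \<tau>0 \<longrightarrow> Re s > -1/4 \<longrightarrow> norm s \<le> S \<longrightarrow>
       summable (\<lambda>k. norm (remainder_term \<tau> k s)) \<and> norm (torsion_remainder \<tau> s) \<le> C * \<tau> powr (- 35/16)"
      using torsion_remainder_bound[OF t0(1) S] by blast
    have "norm (of_real (c x) * torsion_remainder (\<tau> x) s) \<le> C * (\<bar>c x\<bar> * \<tau> x powr (- 35/16))"
      if "Re s > -1/4" "norm s \<le> S" "x \<in> space M" for s x
    proof -
      have "norm (torsion_remainder (\<tau> x) s) \<le> C * \<tau> x powr (- 35/16)"
        using C(2) t0(2)[OF that(3)] that(1,2) by simp
      from mult_left_mono[OF this, of "\<bar>c x\<bar>"] show ?thesis by (simp add: norm_mult mult_ac)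
    qed
    moreover have "integrable M (\<lambda>x. C * (\<bar>c x\<bar> * \<tau> x powr (- 35/16)))" using int by simp
    ultimately show ?thesis by blast
  qed
  note * = integral_derivative_halfplane[where f = "\<lambda>s x. of_real (c x) * torsion_remainder (\<tau> x) s", OF _ meas hol dom]
  show ?A
  proof (rule holomorphic_onI, rule field_differentiable_at_within)
    fix s assume "s \<in> {s. Re s > -1/4}"
    hence "Re s > -1/4" by simp
    thus "(\<lambda>s. \<integral>x. of_real (c x) * torsion_remainder (\<tau> x) s \<partial>M) field_differentiable at s"
      using *(1)[of s] unfolding field_differentiable_def by blast
  qed
  have "deriv (\<lambda>s. of_real (c x) * torsion_remainder (\<tau> x) s) 0 = 0" if "x \<in> space M" for x
    by (rule DERIV_imp_deriv) (use DERIV_cmult[OF torsion_remainder_derivatives(2)[OF tx[OF that]]] in simp)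
  hence "(\<integral>x. deriv (\<lambda>s. of_real (c x) * torsion_remainder (\<tau> x) s) 0 \<partial>M) = (\<integral>x. 0 \<partial>M)"
    by (intro Bochner_Integration.integral_cong) auto
  thus ?B using *(1)[of 0] by simp
  show ?C if "Re s > -1/4" using *(2)[OF that] .
qed

lemma powr_difference_bound:
  fixes x y m :: real
  assumes m: "0 < m" "m \<le> x" "m \<le> y" and z: "Re z \<ge> -1"
  shows "norm (of_real x powr (- z) - of_real y powr (- z) :: complex) \<le> norm z * m powr (- Re z - 1) * \<bar>x - y\<bar>"
proof -
  define S where "S = closed_segment (of_real x) (of_real y :: complex)"
  have S: "w \<in> of_real ` {m..}" if "w \<in> S" for w
    using that m unfolding S_def closed_segment_of_real
    by (auto simp: closed_segment_eq_real_ivl split: if_splits)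
  have "norm ((of_real x :: complex) powr (- z) - of_real y powr (- z)) \<le> norm z * m powr (- Re z - 1) * norm (of_real x - of_real y :: complex)"
  proof (rule field_differentiable_bound[of S _ "\<lambda>w. - z * w powr (- z - 1)"])
    fix w assume "w \<in> S"
    from S[OF this] obtain u where u: "w = of_real u" "u \<ge> m" by auto
    have "w \<notin> \<real>\<^sub>\<le>\<^sub>0" using u m by (auto simp: complex_nonpos_Reals_iff)
    thus "((\<lambda>w. w powr - z) has_field_derivative - z * w powr (- z - 1)) (at w within S)"
      by (auto intro!: derivative_eq_intros)
    have "norm (- z * w powr (- z - 1)) = norm z * u powr (- Re z - 1)"
      using u m by (simp add: norm_mult norm_of_real_powr)
    also have "\<dots> \<le> norm z * m powr (- Re z - 1)"
      using u m z by (intro mult_left_mono powr_mono2') auto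
    finally show "norm (- z * w powr (- z - 1)) \<le> norm z * m powr (- Re z - 1)" .
  qed (auto simp: S_def)
  thus ?thesis by (simp flip: of_real_diff)
qed

text \<open>
  The difference of the Hurwitz zeta functions of \<open>\<alpha>\<close> and \<open>1 - \<alpha>\<close>.  Summing differences makes the
  series converge at \<open>z = 1\<close>, where the two poles cancel.
\<close>

definition asymmetry_series :: "real \<Rightarrow> complex \<Rightarrow> complex" where
  "asymmetry_series \<alpha> z = (\<Sum>k. of_real (real k + \<alpha>) powr (- z) - of_real (real k + (1 - \<alpha>)) powr (- z))"

lemma asymmetry_series_holomorphic:
  assumes a: "0 < \<alpha>" "\<alpha> < 1"
  shows "asymmetry_series \<alpha> holomorphic_on {z. Re z > 1/2}"
    and "Re z > 1/2 \<Longrightarrow> summable (\<lambda>k. of_real (real k + \<alpha>) powr (- z) - of_real (real k + (1 - \<alpha>)) powr (- z))"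
proof -
  define f where "f k z = (of_real (real k + \<alpha>) powr (- z) - of_real (real k + (1 - \<alpha>)) powr (- z) :: complex)" for k z
  have hol: "f k holomorphic_on A" for k A
    unfolding f_def using a by (intro holomorphic_intros) (auto simp del: of_real_add)
  have dom: "\<exists>w. summable w \<and> (\<forall>s k. 1/2 < Re s \<longrightarrow> norm s \<le> S \<longrightarrow> norm (f k s) \<le> w k)"
    if S: "S \<ge> 0" for S
  proof -
    define m where "m = min \<alpha> (1 - \<alpha>)"
    have m: "m > 0" "m \<le> 1" "m \<le> \<alpha>" "m \<le> 1 - \<alpha>" using a by (auto simp: m_def)
    have "norm (f k s) \<le> S * m powr (- S - 1) * (real k + 1) powr (- 3/2)" if s: "1/2 < Re s" "norm s \<le> S" for k s
    proof -
      have Rs: "Re s \<le> S" using s complex_Re_le_cmod[of s] by simp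
      have mk: "m * (real k + 1) \<le> real k + \<alpha>" "m * (real k + 1) \<le> real k + (1 - \<alpha>)"
        using m mult_right_mono[OF m(2), of "real k"] by (auto simp: algebra_simps)
      have "norm (f k s) \<le> norm s * (m * (real k + 1)) powr (- Re s - 1) * \<bar>(real k + \<alpha>) - (real k + (1 - \<alpha>))\<bar>"
        unfolding f_def using m mk s by (intro powr_difference_bound) auto
      also have "\<dots> \<le> S * (m * (real k + 1)) powr (- Re s - 1) * 1"
        using a s S by (intro mult_mono) auto
      also have "(m * (real k + 1)) powr (- Re s - 1) = m powr (- Re s - 1) * (real k + 1) powr (- Re s - 1)"
        using m by (simp add: powr_mult)
      also have "\<dots> \<le> m powr (- S - 1) * (real k + 1) powr (- 3/2)"
      proof (rule mult_mono)
        show "m powr (- Re s - 1) \<le> m powr (- S - 1)" using m Rs by (intro powr_mono') auto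
        have "- Re s - 1 \<le> - 3/2" using s(1) by argo
        thus "(real k + 1) powr (- Re s - 1) \<le> (real k + 1) powr (- 3/2)" by (intro powr_mono) auto
      qed auto
      finally show ?thesis using S by (simp add: mult_left_mono mult.assoc)
    qed
    moreover have "summable (\<lambda>k. S * m powr (- S - 1) * (real k + 1) powr (- 3/2))"
      by (intro summable_mult summable_powr_Suc) simp
    ultimately show ?thesis by blast
  qed
  note * = suminf_derivative_halfplane[where f = "\<lambda>s k. f k s", OF _ hol dom]
  show "asymmetry_series \<alpha> holomorphic_on {z. Re z > 1/2}"
  proof (rule holomorphic_onI, rule field_differentiable_at_within)
    fix s assume "s \<in> {s. Re s > 1/2}"
    hence "Re s > 1/2" by simp
    thus "asymmetry_series \<alpha> field_differentiable at s"
      using *(2)[of s] unfolding asymmetry_series_def f_def field_differentiable_def by blast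
  qed
  show "summable (\<lambda>k. of_real (real k + \<alpha>) powr (- z) - of_real (real k + (1 - \<alpha>)) powr (- z))" if "Re z > 1/2"
    using *(1)[OF that] unfolding f_def by (rule summable_norm_cancel)
qed

section \<open>Schwartz functions in the representation\<close>

abbreviation vderiv :: "(real \<Rightarrow> complex) \<Rightarrow> real \<Rightarrow> complex" where
  "vderiv g \<equiv> \<lambda>x. vector_derivative g (at x)"

text \<open>
  A class of rapidly decreasing functions that is closed under differentiation consists of Schwartz
  functions.  For sums, multiples, products with \<open>x\<close> and Gaussians such a class is easily named, while a
  formula for all higher derivatives is not.
\<close>

lemma schwartz_coinduct:
  assumes "f \<in> C"
    and step: "\<And>g. g \<in> C \<Longrightarrow> (\<forall>x. g differentiable (at x)) \<and> vderiv g \<in> C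
        \<and> (\<forall>j. bounded (range (\<lambda>x. of_real (x ^ j) * g x)))"
  shows "f \<in> schwartz"
proof -
  have "((\<lambda>g x. vector_derivative g (at x)) ^^ k) f \<in> C" for k
    by (induction k) (use assms in auto)
  thus ?thesis unfolding schwartz_def Let_def using step by blast
qed

lemma schwartz_differentiable: "f \<in> schwartz \<Longrightarrow> f differentiable (at x)"
  unfolding schwartz_def Let_def by (auto dest: spec[of _ 0])

lemma schwartz_bounded: "f \<in> schwartz \<Longrightarrow> bounded (range (\<lambda>x. of_real (x ^ j) * f x))"
  unfolding schwartz_def Let_def 
proof -
  assume "f \<in> {f. (\<forall>k x. ((\<lambda>g x. vector_derivative g (at x)) ^^ k) f differentiable (at x)) \<and>
     (\<forall>j k. bounded (range (\<lambda>x. of_real (x ^ j) * ((\<lambda>g x. vector_derivative g (at x)) ^^ k) f x)))}"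
  hence "bounded (range (\<lambda>x. of_real (x ^ j) * ((\<lambda>g x. vector_derivative g (at x)) ^^ 0) f x))" by blast
  thus ?thesis by simp
qed

lemma schwartz_vderiv: "f \<in> schwartz \<Longrightarrow> vderiv f \<in> schwartz"
proof -
  assume f: "f \<in> schwartz"
  have "((\<lambda>g x. vector_derivative g (at x)) ^^ k) (vderiv f) = ((\<lambda>g x. vector_derivative g (at x)) ^^ Suc k) f" for k
    by (induction k) auto
  thus ?thesis using f unfolding schwartz_def Let_def by (simp del: funpow.simps)
qed

lemma schwartz_has_vderiv: "f \<in> schwartz \<Longrightarrow> (f has_vector_derivative vderiv f x) (at x)"
  using vector_derivative_works[of f "at x"] schwartz_differentiable[of f x] by simp

lemma bounded_range_add:
  fixes f g :: "real \<Rightarrow> complex"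
  assumes "bounded (range f)" "bounded (range g)"
  shows "bounded (range (\<lambda>x. f x + g x))"
  by (rule bounded_subset[OF bounded_plus[OF assms]]) auto

lemma schwartz_add [intro]:
  assumes "f \<in> schwartz" "g \<in> schwartz"
  shows "(\<lambda>x. f x + g x) \<in> schwartz"
proof (rule schwartz_coinduct[of _ "{\<lambda>x. f x + g x |f g. f \<in> schwartz \<and> g \<in> schwartz}"])
  fix u assume "u \<in> {\<lambda>x. f x + g x |f g. f \<in> schwartz \<and> g \<in> schwartz}"
  then obtain f g where fg: "f \<in> schwartz" "g \<in> schwartz" "u = (\<lambda>x. f x + g x)" by blast
  have "(u has_vector_derivative vderiv f x + vderiv g x) (at x)" for x
    unfolding fg(3) using fg by (intro has_vector_derivative_add schwartz_has_vderiv)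
  hence d: "vderiv u = (\<lambda>x. vderiv f x + vderiv g x)" "\<forall>x. u differentiable (at x)"
    by (auto simp: vector_derivative_at intro: differentiableI_vector)
  have b: "bounded (range (\<lambda>x. of_real (x ^ j) * u x))" for j
    using bounded_range_add[OF schwartz_bounded[OF fg(1)] schwartz_bounded[OF fg(2)]]
    by (simp add: fg(3) distrib_left)
  show "(\<forall>x. u differentiable (at x)) \<and> vderiv u \<in> {\<lambda>x. f x + g x |f g. f \<in> schwartz \<and> g \<in> schwartz}
        \<and> (\<forall>j. bounded (range (\<lambda>x. of_real (x ^ j) * u x)))"
  proof (intro conjI allI)
    show "u differentiable (at x)" for x using d(2) by blast
    show "vderiv u \<in> {\<lambda>x. f x + g x |f g. f \<in> schwartz \<and> g \<in> schwartz}"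
      unfolding d(1)
      by (intro CollectI exI[of _ "vderiv f"] exI[of _ "vderiv g"] conjI refl schwartz_vderiv fg)
    show "bounded (range (\<lambda>x. of_real (x ^ j) * u x))" for j by (rule b)
  qed
qed (intro CollectI exI[of _ f] exI[of _ g] conjI refl assms)

lemma schwartz_cmult [intro]:
  assumes "f \<in> schwartz"
  shows "(\<lambda>x. c * f x) \<in> schwartz"
proof (rule schwartz_coinduct[of _ "{\<lambda>x. c * f x |f. f \<in> schwartz}"])
  fix u assume "u \<in> {\<lambda>x. c * f x |f. f \<in> schwartz}"
  then obtain f where f: "f \<in> schwartz" "u = (\<lambda>x. c * f x)" by blast
  have "(u has_vector_derivative c * vderiv f x) (at x)" for x
    unfolding f(2) using schwartz_has_vderiv[OF f(1)] by (rule has_vector_derivative_mult_right)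
  hence d: "vderiv u = (\<lambda>x. c * vderiv f x)" "\<forall>x. u differentiable (at x)"
    by (auto simp: vector_derivative_at intro: differentiableI_vector)
  have b: "bounded (range (\<lambda>x. of_real (x ^ j) * u x))" for j
    using bounded_linear_image[OF schwartz_bounded[OF f(1), of j] bounded_linear_mult_right[of c]]
    by (simp add: f(2) image_image mult_ac)
  show "(\<forall>x. u differentiable (at x)) \<and> vderiv u \<in> {\<lambda>x. c * f x |f. f \<in> schwartz}
        \<and> (\<forall>j. bounded (range (\<lambda>x. of_real (x ^ j) * u x)))"
  proof (intro conjI allI)
    show "u differentiable (at x)" for x using d(2) by blast
    show "vderiv u \<in> {\<lambda>x. c * f x |f. f \<in> schwartz}"
      unfolding d(1)
      by (intro CollectI exI[of _ "vderiv f"] conjI refl schwartz_vderiv f)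
    show "bounded (range (\<lambda>x. of_real (x ^ j) * u x))" for j by (rule b)
  qed
qed (intro CollectI exI[of _ f] conjI refl assms)

lemma schwartz_uminus [intro]: "f \<in> schwartz \<Longrightarrow> (\<lambda>x. - f x) \<in> schwartz"
  using schwartz_cmult[of f "-1"] by simp

lemma schwartz_diff [intro]: "f \<in> schwartz \<Longrightarrow> g \<in> schwartz \<Longrightarrow> (\<lambda>x. f x - g x) \<in> schwartz"
  using schwartz_add[OF _ schwartz_uminus, of f g] by simp

lemma schwartz_x [intro]:
  assumes "f \<in> schwartz"
  shows "(\<lambda>x. of_real x * f x) \<in> schwartz"
proof (rule schwartz_coinduct[of _ "{\<lambda>x. of_real x * f x + g x |f g. f \<in> schwartz \<and> g \<in> schwartz}"])
  fix u assume "u \<in> {\<lambda>x. of_real x * f x + g x |f g. f \<in> schwartz \<and> g \<in> schwartz}"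
  then obtain f g where fg: "f \<in> schwartz" "g \<in> schwartz" "u = (\<lambda>x. of_real x * f x + g x)" by blast
  have "(u has_vector_derivative (of_real x * vderiv f x + of_real 1 * f x) + vderiv g x) (at x)" for x
    unfolding fg(3) using fg
    by (intro has_vector_derivative_add has_vector_derivative_mult has_vector_derivative_of_real DERIV_ident schwartz_has_vderiv)
  hence d: "vderiv u = (\<lambda>x. of_real x * vderiv f x + (f x + vderiv g x))" "\<forall>x. u differentiable (at x)"
    by (auto simp: vector_derivative_at add_ac intro: differentiableI_vector)
  have w: "(\<lambda>x. f x + vderiv g x) \<in> schwartz" by (intro schwartz_add schwartz_vderiv fg)
  have b: "bounded (range (\<lambda>x. of_real (x ^ j) * u x))" for j
    using bounded_range_add[OF schwartz_bounded[OF fg(1), of "Suc j"] schwartz_bounded[OF fg(2), of j]]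
    by (simp add: fg(3) distrib_left mult_ac)
  show "(\<forall>x. u differentiable (at x)) \<and> vderiv u \<in> {\<lambda>x. of_real x * f x + g x |f g. f \<in> schwartz \<and> g \<in> schwartz}
        \<and> (\<forall>j. bounded (range (\<lambda>x. of_real (x ^ j) * u x)))"
  proof (intro conjI allI)
    show "u differentiable (at x)" for x using d(2) by blast
    show "vderiv u \<in> {\<lambda>x. of_real x * f x + g x |f g. f \<in> schwartz \<and> g \<in> schwartz}"
      unfolding d(1)
      by (intro CollectI exI[of _ "vderiv f"] exI[of _ "\<lambda>x. f x + vderiv g x"] conjI refl schwartz_vderiv fg w)
    show "bounded (range (\<lambda>x. of_real (x ^ j) * u x))" for j by (rule b)
  qed
next
  have "(\<lambda>x. 0 * f x) \<in> schwartz" using assms by (rule schwartz_cmult)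
  thus "(\<lambda>x. of_real x * f x) \<in> {\<lambda>x. of_real x * f x + g x |f g. f \<in> schwartz \<and> g \<in> schwartz}"
    using assms by (intro CollectI exI[of _ f] exI[of _ "\<lambda>x. 0 * f x"] conjI) simp_all
qed

lemma schwartz_0 [simp]: "(\<lambda>_. 0) \<in> schwartz"
  by (rule schwartz_coinduct[of _ "{\<lambda>_. 0}"]) auto

lemma power_le_fact_exp:
  assumes "(y::real) \<ge> 0"
  shows "y ^ n \<le> fact n * exp y"
proof -
  have "(\<Sum>k\<in>{n}. y ^ k /\<^sub>R fact k) \<le> (\<Sum>k. y ^ k /\<^sub>R fact k)"
    using assms by (intro sum_le_suminf summable_exp_generic) auto
  hence "y ^ n / fact n \<le> exp y" by (simp add: exp_def scaleR_conv_of_real field_simps)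
  thus ?thesis by (simp add: field_simps)
qed

lemma power_gauss_bounded:
  assumes "a > 0"
  shows "bounded (range (\<lambda>x::real. of_real (x ^ j) * (of_real (exp (- a * x\<^sup>2)) :: complex)))"
proof (rule boundedI)
  fix y assume "y \<in> range (\<lambda>x::real. of_real (x ^ j) * (of_real (exp (- a * x\<^sup>2)) :: complex))"
  then obtain x where y: "y = of_real (x ^ j) * of_real (exp (- a * x\<^sup>2))" by blast
  have "\<bar>x\<bar> ^ j \<le> 1 + (x\<^sup>2) ^ j"
  proof (cases "\<bar>x\<bar> \<le> 1")
    case True
    hence "\<bar>x\<bar> ^ j \<le> 1" by (simp add: power_le_one)
    thus ?thesis by (simp add: add_increasing2)
  next
    case False
    hence "\<bar>x\<bar> ^ j \<le> \<bar>x\<bar> ^ (2 * j)" by (intro power_increasing) auto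
    thus ?thesis by (simp add: power_mult)
  qed
  also have "(x\<^sup>2) ^ j = (a * x\<^sup>2) ^ j / a ^ j" using assms by (simp add: power_mult_distrib)
  also have "\<dots> \<le> fact j * exp (a * x\<^sup>2) / a ^ j"
    using assms by (intro divide_right_mono power_le_fact_exp) auto
  also have "1 + \<dots> \<le> exp (a * x\<^sup>2) + fact j * exp (a * x\<^sup>2) / a ^ j" using assms by simp
  also have "\<dots> = (1 + fact j / a ^ j) * exp (a * x\<^sup>2)" by (simp add: distrib_right)
  finally have "\<bar>x\<bar> ^ j * exp (- a * x\<^sup>2) \<le> (1 + fact j / a ^ j) * exp (a * x\<^sup>2) * exp (- a * x\<^sup>2)"
    by (intro mult_right_mono) auto
  also have "\<dots> = 1 + fact j / a ^ j" by (simp add: exp_minus)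
  finally show "norm y \<le> 1 + fact j / a ^ j" by (simp add: y norm_mult norm_power)
qed

text \<open>
  The products of polynomials with the Gaussian are closed under differentiation.
\<close>

lemma gauss_schwartz:
  assumes a: "a > 0"
  shows "(\<lambda>x. of_real (exp (- a * x\<^sup>2))) \<in> schwartz"
proof (rule schwartz_coinduct[of _ "{\<lambda>x. poly p (of_real x) * of_real (exp (- a * x\<^sup>2)) |p. True}"])
  fix u :: "real \<Rightarrow> complex" assume "u \<in> {\<lambda>x. poly p (of_real x) * of_real (exp (- a * x\<^sup>2)) |p. True}"
  then obtain p where u: "u = (\<lambda>x. poly p (of_real x) * of_real (exp (- a * x\<^sup>2)))" by blast
  define p' where "p' = pderiv p - smult (2 * of_real a) (pCons 0 p)"
  have der: "(u has_vector_derivative poly p' (of_real x) * of_real (exp (- a * x\<^sup>2))) (at x)" for x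
  proof -
    have "((\<lambda>z. poly p z * exp (- of_real a * z\<^sup>2)) has_field_derivative
        poly p' (of_real x) * exp (- of_real a * (of_real x)\<^sup>2)) (at (of_real x))"
      by (auto intro!: derivative_eq_intros simp: p'_def algebra_simps)
    from has_vector_derivative_real_field[OF this] show ?thesis
      by (simp add: u exp_of_real[symmetric])
  qed
  have bd: "bounded (range (\<lambda>x. of_real (x ^ j) * (poly p (of_real x) * of_real (exp (- a * x\<^sup>2)))))" for j
  proof (induction p arbitrary: j)
    case (pCons c p)
    have 1: "bounded (range (\<lambda>x. c * (of_real (x ^ j) * of_real (exp (- a * x\<^sup>2)))))"
      using bounded_linear_image[OF power_gauss_bounded[OF a, of j] bounded_linear_mult_right[of c]]
      by (simp add: image_image)
    show ?case using bounded_range_add[OF 1 pCons.IH[of "Suc j"]] by (simp add: algebra_simps)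
  qed simp
  show "(\<forall>x. u differentiable (at x)) \<and> vderiv u \<in> {\<lambda>x. poly p (of_real x) * of_real (exp (- a * x\<^sup>2)) |p. True}
        \<and> (\<forall>j. bounded (range (\<lambda>x. of_real (x ^ j) * u x)))"
  proof (intro conjI allI)
    show "u differentiable (at x)" for x using der by (rule differentiableI_vector)
    have "vderiv u = (\<lambda>x. poly p' (of_real x) * of_real (exp (- a * x\<^sup>2)))"
      using der by (auto simp: vector_derivative_at)
    thus "vderiv u \<in> {\<lambda>x. poly p (of_real x) * of_real (exp (- a * x\<^sup>2)) |p. True}" by blast
    show "bounded (range (\<lambda>x. of_real (x ^ j) * u x))" for j using bd unfolding u .
  qed
qed (auto intro!: exI[of _ 1])

lemma drho_X_schwartz: "f \<in> schwartz \<Longrightarrow> drho h (Suc 0) f = (\<lambda>x. of_real h * vderiv f x)"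
  using drho_X[OF schwartz_differentiable] by (auto simp: fun_eq_iff)

lemma drho_schwartz [intro]: "f \<in> schwartz \<Longrightarrow> i \<in> {1, 2, 3} \<Longrightarrow> drho h i f \<in> schwartz"
proof -
  assume f: "f \<in> schwartz" "i \<in> {1, 2, 3}"
  have "drho h 1 f \<in> schwartz" using f schwartz_vderiv by (auto simp: drho_X_schwartz)
  moreover have "drho h 2 f = (\<lambda>x. (2 * of_real pi * \<i>) * (of_real x * f x))" by (simp add: fun_eq_iff drho_Y)
  hence "drho h 2 f \<in> schwartz" using f by auto
  moreover have "drho h 3 f = (\<lambda>x. (2 * of_real pi * \<i> * of_real h) * f x)" by (simp add: fun_eq_iff drho_T)
  hence "drho h 3 f \<in> schwartz" using f by auto
  ultimately show ?thesis using f(2) by auto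
qed

lemma drho_add:
  assumes "f \<in> schwartz" "g \<in> schwartz" "i \<in> {1, 2, 3}"
  shows "drho h i (\<lambda>x. f x + g x) = (\<lambda>x. drho h i f x + drho h i g x)"
proof -
  have "vderiv (\<lambda>x. f x + g x) x = vderiv f x + vderiv g x" for x
    using assms by (intro vector_derivative_at has_vector_derivative_add schwartz_has_vderiv)
  hence "drho h 1 (\<lambda>x. f x + g x) = (\<lambda>x. drho h 1 f x + drho h 1 g x)"
    using assms by (auto simp: drho_X_schwartz schwartz_add distrib_left)
  thus ?thesis using assms(3) by (auto simp: drho_Y drho_T distrib_left fun_eq_iff)
qed

lemma drho_cmult:
  assumes "f \<in> schwartz" "i \<in> {1, 2, 3}"
  shows "drho h i (\<lambda>x. c * f x) = (\<lambda>x. c * drho h i f x)"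
proof -
  have "vderiv (\<lambda>x. c * f x) x = c * vderiv f x" for x
    using assms by (intro vector_derivative_at has_vector_derivative_mult_right schwartz_has_vderiv)
  hence "drho h 1 (\<lambda>x. c * f x) = (\<lambda>x. c * drho h 1 f x)"
    using assms by (auto simp: drho_X_schwartz schwartz_cmult)
  thus ?thesis using assms(2) by (auto simp: drho_Y drho_T fun_eq_iff)
qed

lemma drho_uminus:
  "f \<in> schwartz \<Longrightarrow> i \<in> {1, 2, 3} \<Longrightarrow> drho h i (\<lambda>x. - f x) = (\<lambda>x. - drho h i f x)"
  using drho_cmult[of f i h "-1"] by simp

lemma drho_diff:
  assumes "f \<in> schwartz" "g \<in> schwartz" "i \<in> {1, 2, 3}"
  shows "drho h i (\<lambda>x. f x - g x) = (\<lambda>x. drho h i f x - drho h i g x)"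
  using drho_add[of f "\<lambda>x. - g x" i h] assms by (simp add: schwartz_uminus drho_uminus)

lemma drho_T_central:
  assumes "f \<in> schwartz" "i \<in> {1, 2, 3}"
  shows "drho h i (drho h 3 f) = drho h 3 (drho h i f)"
proof -
  have "drho h 3 f = (\<lambda>x. (2 * of_real pi * \<i> * of_real h) * f x)" for f by (simp add: fun_eq_iff drho_T)
  thus ?thesis using drho_cmult[OF assms] by simp
qed

lemma drho_commutator:
  assumes "f \<in> schwartz"
  shows "drho h 1 (drho h 2 f) = (\<lambda>x. drho h 2 (drho h 1 f) x + drho h 3 f x)"
proof -
  have "((\<lambda>x. of_real x * f x) has_vector_derivative (of_real x * vderiv f x + of_real 1 * f x)) (at x)" for x
    using assms by (intro has_vector_derivative_mult has_vector_derivative_of_real DERIV_ident schwartz_has_vderiv)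
  hence "vderiv (\<lambda>x. of_real x * f x) x = of_real x * vderiv f x + f x" for x
    by (simp add: vector_derivative_at)
  hence "drho h 1 (\<lambda>x. of_real x * f x) = (\<lambda>x. of_real h * (of_real x * vderiv f x + f x))"
    using assms by (simp add: drho_X_schwartz schwartz_x)
  moreover have "drho h 2 f = (\<lambda>x. (2 * of_real pi * \<i>) * (of_real x * f x))" by (simp add: fun_eq_iff drho_Y)
  ultimately have "drho h 1 (drho h 2 f) = (\<lambda>x. (2 * of_real pi * \<i>) * (of_real h * (of_real x * vderiv f x + f x)))"
    using drho_cmult[OF schwartz_x[OF assms], of 1 h "2 * of_real pi * \<i>"] by simp
  thus ?thesis using assms by (simp add: fun_eq_iff drho_Y drho_T drho_X_schwartz algebra_simps)
qed

definition l2 :: "(real \<Rightarrow> complex) set" where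
  "l2 = {f. f \<in> borel_measurable lborel \<and> integrable lborel (\<lambda>x. (cmod (f x))\<^sup>2)}"

definition ip1 :: "(real \<Rightarrow> complex) \<Rightarrow> (real \<Rightarrow> complex) \<Rightarrow> complex" where
  "ip1 f g = (LBINT x. f x * cnj (g x))"

lemma l2_measurable: "f \<in> l2 \<Longrightarrow> f \<in> borel_measurable borel"
  by (simp add: l2_def)

lemma l2_integrable: "f \<in> l2 \<Longrightarrow> integrable lborel (\<lambda>x. (cmod (f x))\<^sup>2)"
  by (simp add: l2_def)

lemma cnj_measurable [measurable]: "cnj \<in> borel_measurable borel"
  by (intro borel_measurable_continuous_onI continuous_intros)

lemma l2_product_integrable:
  assumes "f \<in> l2" "g \<in> l2"
  shows "integrable lborel (\<lambda>x. f x * cnj (g x))"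
proof (rule Bochner_Integration.integrable_bound)
  show "integrable lborel (\<lambda>x. (cmod (f x))\<^sup>2 + (cmod (g x))\<^sup>2)"
    using assms by (auto simp: l2_def)
  show "(\<lambda>x. f x * cnj (g x)) \<in> borel_measurable lborel"
    using assms[THEN l2_measurable] by measurable
  show "AE x in lborel. norm (f x * cnj (g x)) \<le> norm ((cmod (f x))\<^sup>2 + (cmod (g x))\<^sup>2)"
  proof (intro AE_I2)
    fix x show "norm (f x * cnj (g x)) \<le> norm ((cmod (f x))\<^sup>2 + (cmod (g x))\<^sup>2)"
    proof -
      have "0 \<le> cmod (f x) * cmod (g x)" by simp
      hence "cmod (f x) * cmod (g x) \<le> (cmod (f x))\<^sup>2 + (cmod (g x))\<^sup>2"
        using sum_squares_bound[of "cmod (f x)" "cmod (g x)"] by linarith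
      thus ?thesis by (simp add: norm_mult)
    qed
  qed
qed

lemma l2_add:
  assumes "f \<in> l2" "g \<in> l2"
  shows "(\<lambda>x. f x + g x) \<in> l2"
proof -
  have "integrable lborel (\<lambda>x. (cmod (f x + g x))\<^sup>2)"
  proof (rule Bochner_Integration.integrable_bound)
    show "integrable lborel (\<lambda>x. 2 * (cmod (f x))\<^sup>2 + 2 * (cmod (g x))\<^sup>2)"
      using assms by (auto simp: l2_def)
    show "(\<lambda>x. (cmod (f x + g x))\<^sup>2) \<in> borel_measurable lborel"
      using assms[THEN l2_measurable] by measurable
    show "AE x in lborel. norm ((cmod (f x + g x))\<^sup>2) \<le> norm (2 * (cmod (f x))\<^sup>2 + 2 * (cmod (g x))\<^sup>2)"
    proof (intro AE_I2)
      fix x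
      have "(cmod (f x + g x))\<^sup>2 \<le> (cmod (f x) + cmod (g x))\<^sup>2" by (intro power_mono norm_triangle_ineq) auto
      also have "\<dots> \<le> 2 * (cmod (f x))\<^sup>2 + 2 * (cmod (g x))\<^sup>2"
        using sum_squares_bound[of "cmod (f x)" "cmod (g x)"] by (simp add: power2_sum)
      finally show "norm ((cmod (f x + g x))\<^sup>2) \<le> norm (2 * (cmod (f x))\<^sup>2 + 2 * (cmod (g x))\<^sup>2)" by simp
    qed
  qed
  thus ?thesis using assms[THEN l2_measurable] by (auto simp: l2_def)
qed

lemma l2_cmult: "f \<in> l2 \<Longrightarrow> (\<lambda>x. c * f x) \<in> l2"
  by (auto simp: l2_def norm_mult power_mult_distrib)

lemma l2_uminus: "f \<in> l2 \<Longrightarrow> (\<lambda>x. - f x) \<in> l2"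
  by (auto simp: l2_def)

lemma l2_diff: "f \<in> l2 \<Longrightarrow> g \<in> l2 \<Longrightarrow> (\<lambda>x. f x - g x) \<in> l2"
  using l2_add[OF _ l2_uminus, of f g] by simp

lemma schwartz_continuous: "f \<in> schwartz \<Longrightarrow> continuous_on A f"
  by (intro continuous_at_imp_continuous_on ballI differentiable_imp_continuous_within schwartz_differentiable)

lemma inverse_quadratic_integrable: "integrable lborel (\<lambda>x::real. 1 / (1 + x\<^sup>2))"
  using integrable_inverse_1_plus_square
  by (simp add: interval_lebesgue_integrable_def set_integrable_def einterval_eq inverse_eq_divide)

lemma schwartz_decay:
  assumes "f \<in> schwartz"
  obtains C where "C \<ge> 0" "\<And>x. cmod (f x) \<le> C / (1 + x\<^sup>2)"
proof -
  obtain A where A: "\<And>x. cmod (f x) \<le> A"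
    using schwartz_bounded[OF assms, of 0] by (auto simp: bounded_iff)
  obtain B where B: "\<And>x. cmod (of_real (x\<^sup>2) * f x) \<le> B"
    using schwartz_bounded[OF assms, of 2] by (auto simp: bounded_iff)
  have "cmod (f x) \<le> (A + B) / (1 + x\<^sup>2)" for x
  proof -
    have "(1 + x\<^sup>2) * cmod (f x) \<le> A + B"
      using A[of x] B[of x] by (simp add: norm_mult norm_power distrib_right)
    moreover have "1 + x\<^sup>2 > 0" by (simp add: add_pos_nonneg)
    ultimately show ?thesis by (simp add: field_simps)
  qed
  moreover have "A + B \<ge> 0" using order_trans[OF norm_ge_zero A[of 0]] order_trans[OF norm_ge_zero B[of 0]] by simp
  ultimately show ?thesis using that by blast
qed

lemma schwartz_l2:
  assumes f: "f \<in> schwartz"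
  shows "f \<in> l2"
proof -
  obtain C where C: "C \<ge> 0" "\<And>x. cmod (f x) \<le> C / (1 + x\<^sup>2)" using schwartz_decay[OF f] by blast
  have m: "f \<in> borel_measurable borel"
    by (intro borel_measurable_continuous_onI schwartz_continuous f)
  have "integrable lborel (\<lambda>x. (cmod (f x))\<^sup>2)"
  proof (rule Bochner_Integration.integrable_bound)
    show "integrable lborel (\<lambda>x::real. C\<^sup>2 * (1 / (1 + x\<^sup>2)))"
      by (intro integrable_mult_right inverse_quadratic_integrable)
    show "AE x in lborel. norm ((cmod (f x))\<^sup>2) \<le> norm (C\<^sup>2 * (1 / (1 + x\<^sup>2)))"
    proof (intro AE_I2)
      fix x :: real
      have "(cmod (f x))\<^sup>2 \<le> (C / (1 + x\<^sup>2))\<^sup>2" by (intro power_mono C) auto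
      also have "\<dots> = C\<^sup>2 * (1 / (1 + x\<^sup>2)) * (1 / (1 + x\<^sup>2))" by (simp add: power2_eq_square)
      also have "\<dots> \<le> C\<^sup>2 * (1 / (1 + x\<^sup>2)) * 1"
        by (intro mult_left_mono) (auto simp: divide_le_eq add_pos_nonneg)
      finally show "norm ((cmod (f x))\<^sup>2) \<le> norm (C\<^sup>2 * (1 / (1 + x\<^sup>2)))" by simp
    qed
  qed (use m in measurable)
  thus ?thesis using m by (simp add: l2_def)
qed

lemma schwartz_tendsto_0:
  assumes "f \<in> schwartz"
  shows "(f \<longlongrightarrow> 0) at_top" "(f \<longlongrightarrow> 0) at_bot"
proof -
  obtain C where C: "C \<ge> 0" "\<And>x. cmod (f x) \<le> C / (1 + x\<^sup>2)" using schwartz_decay[OF assms] by blast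
  have "((\<lambda>x::real. C / (1 + x\<^sup>2)) \<longlongrightarrow> 0) at_top" by real_asymp
  thus "(f \<longlongrightarrow> 0) at_top" by (rule Lim_null_comparison[rotated]) (simp add: C(2))
  have "((\<lambda>x::real. C / (1 + x\<^sup>2)) \<longlongrightarrow> 0) at_bot" by real_asymp
  thus "(f \<longlongrightarrow> 0) at_bot" by (rule Lim_null_comparison[rotated]) (simp add: C(2))
qed

text \<open>
  The boundary terms vanish because Schwartz functions tend to zero.
\<close>

lemma integral_by_parts:
  assumes f: "f \<in> schwartz" and g: "g \<in> schwartz"
  shows "ip1 (vderiv f) g = - ip1 f (vderiv g)"
proof -
  define F where "F x = f x * cnj (g x)" for x
  define F' where "F' x = f x * cnj (vderiv g x) + vderiv f x * cnj (g x)" for x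
  have i: "integrable lborel (\<lambda>x. f x * cnj (vderiv g x))" "integrable lborel (\<lambda>x. vderiv f x * cnj (g x))"
    by (intro l2_product_integrable schwartz_l2 schwartz_vderiv f g)+
  have e: "einterval (-\<infinity>) \<infinity> = (UNIV :: real set)" by (auto simp: einterval_def)
  have "(LBINT x=-\<infinity>..\<infinity>. F' x) = 0 - 0"
  proof (rule interval_integral_FTC_integrable[where F = F])
    show "(F has_vector_derivative F' x) (at x)" for x
      unfolding F_def F'_def
      using has_vector_derivative_mult[OF schwartz_has_vderiv[OF f] has_vector_derivative_cnj[OF schwartz_has_vderiv[OF g]]] .
    show "isCont F' x" for x
      unfolding F'_def
      using f g schwartz_vderiv[OF f] schwartz_vderiv[OF g]
      by (intro continuous_intros differentiable_imp_continuous_within schwartz_differentiable)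
    show "set_integrable lborel (einterval (-\<infinity>) \<infinity>) F'"
      unfolding e set_integrable_def F'_def using i by simp
    have "((\<lambda>x. f x * cnj (g x)) \<longlongrightarrow> 0 * cnj 0) at_bot" "((\<lambda>x. f x * cnj (g x)) \<longlongrightarrow> 0 * cnj 0) at_top"
      by (intro tendsto_intros schwartz_tendsto_0 f g)+
    thus "((F \<circ> real_of_ereal) \<longlongrightarrow> 0) (at_right (-\<infinity>))" "((F \<circ> real_of_ereal) \<longlongrightarrow> 0) (at_left \<infinity>)"
      by (simp_all add: ereal_tendsto_simps F_def[abs_def])
  qed auto
  hence "(LBINT x. F' x) = 0"
    by (simp add: interval_lebesgue_integral_def e set_lebesgue_integral_def)
  thus ?thesis using i by (simp add: F'_def ip1_def eq_neg_iff_add_eq_0 add.commute)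
qed

text \<open>
  The infinitesimal form of the unitarity of \<open>rho h\<close>.
\<close>

lemma drho_skew:
  assumes f: "f \<in> schwartz" and g: "g \<in> schwartz" and i: "i \<in> {1, 2, 3}"
  shows "ip1 (drho h i f) g = - ip1 f (drho h i g)"
proof -
  have "ip1 (\<lambda>x. of_real h * vderiv f x) g = of_real h * ip1 (vderiv f) g" by (simp add: ip1_def mult.assoc)
  also have "\<dots> = - (of_real h * ip1 f (vderiv g))" by (simp add: integral_by_parts[OF f g])
  also have "of_real h * ip1 f (vderiv g) = ip1 f (\<lambda>x. of_real h * vderiv g x)"
    unfolding ip1_def by (subst integral_mult_right_zero[symmetric]) (simp add: mult_ac)
  finally have "ip1 (drho h 1 f) g = - ip1 f (drho h 1 g)" using f g by (simp add: drho_X_schwartz)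
  moreover have "ip1 (drho h 2 f) g = - ip1 f (drho h 2 g)" "ip1 (drho h 3 f) g = - ip1 f (drho h 3 g)"
    unfolding ip1_def by (subst integral_minus[symmetric], rule Bochner_Integration.integral_cong; simp add: drho_Y drho_T)+
  ultimately show ?thesis using i by auto
qed

lemma ip1_add_left: "f \<in> l2 \<Longrightarrow> g \<in> l2 \<Longrightarrow> k \<in> l2 \<Longrightarrow> ip1 (\<lambda>x. f x + g x) k = ip1 f k + ip1 g k"
  unfolding ip1_def by (simp add: distrib_right l2_product_integrable)

lemma ip1_diff_left: "f \<in> l2 \<Longrightarrow> g \<in> l2 \<Longrightarrow> k \<in> l2 \<Longrightarrow> ip1 (\<lambda>x. f x - g x) k = ip1 f k - ip1 g k"
  unfolding ip1_def by (simp add: left_diff_distrib l2_product_integrable)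

lemma ip1_cmult_left: "ip1 (\<lambda>x. c * f x) k = c * ip1 f k"
  unfolding ip1_def by (simp add: mult.assoc)

lemma ip1_add_right: "f \<in> l2 \<Longrightarrow> g \<in> l2 \<Longrightarrow> k \<in> l2 \<Longrightarrow> ip1 k (\<lambda>x. f x + g x) = ip1 k f + ip1 k g"
  unfolding ip1_def by (simp add: distrib_left l2_product_integrable)

lemma ip1_diff_right: "f \<in> l2 \<Longrightarrow> g \<in> l2 \<Longrightarrow> k \<in> l2 \<Longrightarrow> ip1 k (\<lambda>x. f x - g x) = ip1 k f - ip1 k g"
  unfolding ip1_def by (simp add: right_diff_distrib l2_product_integrable)

lemma ip1_cmult_right: "ip1 k (\<lambda>x. c * f x) = cnj c * ip1 k f"
  unfolding ip1_def by (subst integral_mult_right_zero[symmetric]) (simp add: mult_ac)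

lemma ip1_uminus_right: "ip1 k (\<lambda>x. - f x) = - ip1 k f"
  using ip1_cmult_right[of k "-1" f] by simp

lemma ip1_uminus_left: "ip1 (\<lambda>x. - f x) k = - ip1 f k"
  using ip1_cmult_left[of "-1" f k] by simp

section \<open>The Laplacian in components\<close>

lemma ext_d_table:
  fixes E :: "nat \<Rightarrow> ('p \<Rightarrow> complex) \<Rightarrow> 'p \<Rightarrow> complex"
  shows "ext_d E u {} = (\<lambda>x. 0)"
    "ext_d E u {1} = (\<lambda>x. E 1 (u {}) x)"
    "ext_d E u {2} = (\<lambda>x. E 2 (u {}) x)"
    "ext_d E u {3} = (\<lambda>x. E 3 (u {}) x)"
    "ext_d E u {1, 2} = (\<lambda>x. E 1 (u {2}) x - E 2 (u {1}) x - u {3} x)"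
    "ext_d E u {1, 3} = (\<lambda>x. E 1 (u {3}) x - E 3 (u {1}) x)"
    "ext_d E u {2, 3} = (\<lambda>x. E 2 (u {3}) x - E 3 (u {2}) x)"
    "ext_d E u {1, 2, 3} = (\<lambda>x. E 1 (u {2, 3}) x - E 2 (u {1, 3}) x + E 3 (u {1, 2}) x)"
proof -
  have c: "{j \<in> {1::nat, 2}. j < 1} = {}" "{j \<in> {1::nat, 2}. j < 2} = {1}"
    "{j \<in> {1::nat, 3}. j < 1} = {}" "{j \<in> {1::nat, 3}. j < 3} = {1}"
    "{j \<in> {2::nat, 3}. j < 2} = {}" "{j \<in> {2::nat, 3}. j < 3} = {2}"
    "{j \<in> {1::nat, 2, 3}. j < 1} = {}" "{j \<in> {1::nat, 2, 3}. j < 2} = {1}" "{j \<in> {1::nat, 2, 3}. j < 3} = {1, 2}"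
    "{j \<in> {1::nat}. j < 1} = {}" "{j \<in> {2::nat}. j < 2} = {}" "{j \<in> {3::nat}. j < 3} = {}"
    by auto
  have m: "{1::nat, 2} - {1} = {2}" "{1::nat, 2} - {2} = {1}" "{1::nat, 3} - {1} = {3}" "{1::nat, 3} - {3} = {1}"
    "{2::nat, 3} - {2} = {3}" "{2::nat, 3} - {3} = {2}"
    "{1::nat, 2, 3} - {1} = {2, 3}" "{1::nat, 2, 3} - {2} = {1, 3}" "{1::nat, 2, 3} - {3} = {1, 2}"
    by auto
  have s1: "sum f {i} = f i" for f :: "nat \<Rightarrow> complex" and i by simp
  have s2: "sum f {i, j} = f i + f j" if "i \<noteq> j" for f :: "nat \<Rightarrow> complex" and i j using that by simp
  have s3: "sum f {i, j, k} = f i + f j + f k" if "i \<noteq> j" "i \<noteq> k" "j \<noteq> k" for f :: "nat \<Rightarrow> complex" and i j k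
    using that by simp
  have ne: "{1::nat, 3} \<noteq> {1, 2}" "{2::nat, 3} \<noteq> {1, 2}" "{1::nat, 2, 3} \<noteq> {1, 2}" "{1::nat} \<noteq> {1, 2}" "{2::nat} \<noteq> {1, 2}" "{3::nat} \<noteq> {1, 2}"
    by auto
  have sub: "{1} \<subseteq> {1, 2, 3::nat}" "{2} \<subseteq> {1, 2, 3::nat}" "{3} \<subseteq> {1, 2, 3::nat}" "{1, 2} \<subseteq> {1, 2, 3::nat}"
    "{1, 3} \<subseteq> {1, 2, 3::nat}" "{2, 3} \<subseteq> {1, 2, 3::nat}" "{1, 2, 3} \<subseteq> {1, 2, 3::nat}" by auto
  show "ext_d E u {} = (\<lambda>x. 0)" by (simp add: ext_d_def fun_eq_iff)
  show "ext_d E u {1} = (\<lambda>x. E 1 (u {}) x)" "ext_d E u {2} = (\<lambda>x. E 2 (u {}) x)" "ext_d E u {3} = (\<lambda>x. E 3 (u {}) x)"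
    unfolding ext_d_def fun_eq_iff by (simp_all only: sub ne if_True if_False s1 c) simp_all
  show "ext_d E u {1, 2} = (\<lambda>x. E 1 (u {2}) x - E 2 (u {1}) x - u {3} x)"
    by (simp only: ext_d_def fun_eq_iff sub if_True) (subst s2, simp, simp only: c m, simp)
  show "ext_d E u {1, 3} = (\<lambda>x. E 1 (u {3}) x - E 3 (u {1}) x)"
    by (simp only: ext_d_def fun_eq_iff sub if_True ne if_False) (subst s2, simp, simp only: c m, simp)
  show "ext_d E u {2, 3} = (\<lambda>x. E 2 (u {3}) x - E 3 (u {2}) x)"
    by (simp only: ext_d_def fun_eq_iff sub if_True ne if_False) (subst s2, simp, simp only: c m, simp)
  show "ext_d E u {1, 2, 3} = (\<lambda>x. E 1 (u {2, 3}) x - E 2 (u {1, 3}) x + E 3 (u {1, 2}) x)"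
    by (simp only: ext_d_def fun_eq_iff sub if_True ne if_False) (subst s3, simp, simp, simp, simp only: c m, simp)
qed

lemma hodge_star_table:
  "hodge_star u {} = (\<lambda>x. u {1, 2, 3} x)"
  "hodge_star u {1} = (\<lambda>x. u {2, 3} x)"
  "hodge_star u {2} = (\<lambda>x. - u {1, 3} x)"
  "hodge_star u {3} = (\<lambda>x. u {1, 2} x)"
  "hodge_star u {1, 2} = (\<lambda>x. u {3} x)"
  "hodge_star u {1, 3} = (\<lambda>x. - u {2} x)"
  "hodge_star u {2, 3} = (\<lambda>x. u {1} x)"
  "hodge_star u {1, 2, 3} = (\<lambda>x. u {} x)"
proof -
  have c: "{(i, j). i \<in> {1, 2, 3} - {} \<and> j \<in> {} \<and> j < (i::nat)} = {}"
    "{(i, j). i \<in> {1, 2, 3} - {1} \<and> j \<in> {1} \<and> j < (i::nat)} = {(2, 1), (3, 1)}"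
    "{(i, j). i \<in> {1, 2, 3} - {2} \<and> j \<in> {2} \<and> j < (i::nat)} = {(3, 2)}"
    "{(i, j). i \<in> {1, 2, 3} - {3} \<and> j \<in> {3} \<and> j < (i::nat)} = {}"
    "{(i, j). i \<in> {1, 2, 3} - {1, 2} \<and> j \<in> {1, 2} \<and> j < (i::nat)} = {(3, 1), (3, 2)}"
    "{(i, j). i \<in> {1, 2, 3} - {1, 3} \<and> j \<in> {1, 3} \<and> j < (i::nat)} = {(2, 1)}"
    "{(i, j). i \<in> {1, 2, 3} - {2, 3} \<and> j \<in> {2, 3} \<and> j < (i::nat)} = {}"
    "{(i, j). i \<in> {1, 2, 3} - {1, 2, 3} \<and> j \<in> {1, 2, 3} \<and> j < (i::nat)} = {}"
    by auto
  have m: "{1, 2, 3} - {} = {1, 2, 3::nat}" "{1, 2, 3} - {1} = {2, 3::nat}" "{1, 2, 3} - {2} = {1, 3::nat}"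
    "{1, 2, 3} - {3} = {1, 2::nat}" "{1, 2, 3} - {1, 2} = {3::nat}" "{1, 2, 3} - {1, 3} = {2::nat}"
    "{1, 2, 3} - {2, 3} = {1::nat}" "{1, 2, 3} - {1, 2, 3} = ({} :: nat set)" by auto
  have sub: "{} \<subseteq> {1, 2, 3::nat}" "{1} \<subseteq> {1, 2, 3::nat}" "{2} \<subseteq> {1, 2, 3::nat}" "{3} \<subseteq> {1, 2, 3::nat}" "{1, 2} \<subseteq> {1, 2, 3::nat}"
    "{1, 3} \<subseteq> {1, 2, 3::nat}" "{2, 3} \<subseteq> {1, 2, 3::nat}" "{1, 2, 3} \<subseteq> {1, 2, 3::nat}" by auto
  show "hodge_star u {} = (\<lambda>x. u {1, 2, 3} x)"
  "hodge_star u {1} = (\<lambda>x. u {2, 3} x)"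
  "hodge_star u {2} = (\<lambda>x. - u {1, 3} x)"
  "hodge_star u {3} = (\<lambda>x. u {1, 2} x)"
  "hodge_star u {1, 2} = (\<lambda>x. u {3} x)"
  "hodge_star u {1, 3} = (\<lambda>x. - u {2} x)"
  "hodge_star u {2, 3} = (\<lambda>x. u {1} x)"
  "hodge_star u {1, 2, 3} = (\<lambda>x. u {} x)"
    unfolding hodge_star_def fun_eq_iff by (simp_all only: sub if_True c) (simp_all only: m, simp_all)
qed

lemma codiff_table:
  fixes E :: "nat \<Rightarrow> ('p \<Rightarrow> complex) \<Rightarrow> 'p \<Rightarrow> complex"
  shows "codiff E u {} = (\<lambda>x. - (E 1 (\<lambda>x. u {1} x) x - E 2 (\<lambda>x. - u {2} x) x + E 3 (\<lambda>x. u {3} x) x))"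
    "codiff E u {1} = (\<lambda>x. E 2 (\<lambda>x. u {1, 2} x) x - E 3 (\<lambda>x. - u {1, 3} x) x)"
    "codiff E u {2} = (\<lambda>x. - (E 1 (\<lambda>x. u {1, 2} x) x - E 3 (\<lambda>x. u {2, 3} x) x))"
    "codiff E u {3} = (\<lambda>x. E 1 (\<lambda>x. - u {1, 3} x) x - E 2 (\<lambda>x. u {2, 3} x) x - u {1, 2} x)"
    "codiff E u {1, 2} = (\<lambda>x. - E 3 (\<lambda>x. u {1, 2, 3} x) x)"
    "codiff E u {1, 3} = (\<lambda>x. E 2 (\<lambda>x. u {1, 2, 3} x) x)"
    "codiff E u {2, 3} = (\<lambda>x. - E 1 (\<lambda>x. u {1, 2, 3} x) x)"
    "codiff E u {1, 2, 3} = (\<lambda>x. 0)"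
proof -
  have card: "card {1::nat, 2} = 2" "card {1::nat, 3} = 2" "card {2::nat, 3} = 2" "card {1::nat, 2, 3} = 3"
    "card {1::nat} = 1" "card {2::nat} = 1" "card {3::nat} = 1" "card ({}::nat set) = 0" by auto
  show "codiff E u {} = (\<lambda>x. - (E 1 (\<lambda>x. u {1} x) x - E 2 (\<lambda>x. - u {2} x) x + E 3 (\<lambda>x. u {3} x) x))"
    "codiff E u {1} = (\<lambda>x. E 2 (\<lambda>x. u {1, 2} x) x - E 3 (\<lambda>x. - u {1, 3} x) x)"
    "codiff E u {2} = (\<lambda>x. - (E 1 (\<lambda>x. u {1, 2} x) x - E 3 (\<lambda>x. u {2, 3} x) x))"
    "codiff E u {3} = (\<lambda>x. E 1 (\<lambda>x. - u {1, 3} x) x - E 2 (\<lambda>x. u {2, 3} x) x - u {1, 2} x)"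
    "codiff E u {1, 2} = (\<lambda>x. - E 3 (\<lambda>x. u {1, 2, 3} x) x)"
    "codiff E u {1, 3} = (\<lambda>x. E 2 (\<lambda>x. u {1, 2, 3} x) x)"
    "codiff E u {2, 3} = (\<lambda>x. - E 1 (\<lambda>x. u {1, 2, 3} x) x)"
    "codiff E u {1, 2, 3} = (\<lambda>x. 0)"
    unfolding codiff_def fun_eq_iff
    by (simp_all only: hodge_star_table ext_d_table card) simp_all
qed

text \<open>
  The operator \<open>- (X\<^sup>2 + Y\<^sup>2 + T\<^sup>2)\<close>, which for \<open>rho h\<close> is a harmonic oscillator plus the constant
  \<open>(2 \<pi> h)\<^sup>2\<close>.
\<close>

definition oscillator :: "real \<Rightarrow> (real \<Rightarrow> complex) \<Rightarrow> real \<Rightarrow> complex" where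
  "oscillator h f = (\<lambda>x. - (drho h 1 (drho h 1 f) x + drho h 2 (drho h 2 f) x + drho h 3 (drho h 3 f) x))"

text \<open>
  In components the Laplacian is the oscillator plus terms of lower order.  The mixed second order terms
  combine into commutators, so that only \<open>[X, Y] = T\<close> and the centrality of \<open>T\<close> enter.
\<close>

lemma hodge_laplacian_table:
  assumes u: "\<And>J. u J \<in> schwartz"
  shows "hodge_laplacian (drho h) u {} = oscillator h (u {})"
    "hodge_laplacian (drho h) u {1} = (\<lambda>x. oscillator h (u {1}) x - drho h 3 (u {2}) x - drho h 2 (u {3}) x)"
    "hodge_laplacian (drho h) u {2} = (\<lambda>x. oscillator h (u {2}) x + drho h 3 (u {1}) x + drho h 1 (u {3}) x)"
    "hodge_laplacian (drho h) u {3} = (\<lambda>x. oscillator h (u {3}) x - drho h 1 (u {2}) x + drho h 2 (u {1}) x + u {3} x)"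
    "hodge_laplacian (drho h) u {2, 3} = (\<lambda>x. oscillator h (u {2, 3}) x + drho h 3 (u {1, 3}) x - drho h 2 (u {1, 2}) x)"
    "hodge_laplacian (drho h) u {1, 3} = (\<lambda>x. oscillator h (u {1, 3}) x - drho h 3 (u {2, 3}) x - drho h 1 (u {1, 2}) x)"
    "hodge_laplacian (drho h) u {1, 2} = (\<lambda>x. oscillator h (u {1, 2}) x + drho h 1 (u {1, 3}) x + drho h 2 (u {2, 3}) x + u {1, 2} x)"
    "hodge_laplacian (drho h) u {1, 2, 3} = oscillator h (u {1, 2, 3})"
proof -
  define X Y T where "X = drho h 1" and "Y = drho h 2" and "T = drho h 3"
  have cl: "X f \<in> schwartz" "Y f \<in> schwartz" "T f \<in> schwartz" if "f \<in> schwartz" for f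
    using drho_schwartz[OF that] by (auto simp: X_def Y_def T_def)
  note ar = schwartz_add schwartz_diff schwartz_uminus cl u
  have add: "X (\<lambda>x. f x + g x) = (\<lambda>x. X f x + X g x)" "Y (\<lambda>x. f x + g x) = (\<lambda>x. Y f x + Y g x)" "T (\<lambda>x. f x + g x) = (\<lambda>x. T f x + T g x)"
    if "f \<in> schwartz" "g \<in> schwartz" for f g
    using drho_add[OF that] by (auto simp: X_def Y_def T_def)
  have diff: "X (\<lambda>x. f x - g x) = (\<lambda>x. X f x - X g x)" "Y (\<lambda>x. f x - g x) = (\<lambda>x. Y f x - Y g x)" "T (\<lambda>x. f x - g x) = (\<lambda>x. T f x - T g x)"
    if "f \<in> schwartz" "g \<in> schwartz" for f g
    using drho_diff[OF that] by (auto simp: X_def Y_def T_def)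
  have um: "X (\<lambda>x. - f x) = (\<lambda>x. - X f x)" "Y (\<lambda>x. - f x) = (\<lambda>x. - Y f x)" "T (\<lambda>x. - f x) = (\<lambda>x. - T f x)"
    if "f \<in> schwartz" for f
    using drho_uminus[OF that] by (auto simp: X_def Y_def T_def)
  have XT: "X (T f) = T (X f)" "Y (T f) = T (Y f)" "X (Y f) = (\<lambda>x. Y (X f) x + T f x)" if "f \<in> schwartz" for f
    using drho_T_central[OF that, of 1 h] drho_T_central[OF that, of 2 h] drho_commutator[OF that, of h] by (auto simp: X_def Y_def T_def)
  have z: "X (\<lambda>x. 0) = (\<lambda>x. 0)" "Y (\<lambda>x. 0) = (\<lambda>x. 0)" "T (\<lambda>x. 0) = (\<lambda>x. 0)"
    using drho_cmult[OF schwartz_0, of _ h 0] by (auto simp: X_def Y_def T_def)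
  note tab = hodge_laplacian_def fun_eq_iff[of "hodge_laplacian (drho h) u _"] ext_d_table codiff_table
    X_def[symmetric] Y_def[symmetric] T_def[symmetric]
  note rew = add diff um XT z ar oscillator_def X_def[symmetric] Y_def[symmetric] T_def[symmetric]
  show "hodge_laplacian (drho h) u {} = oscillator h (u {})"
    by (simp only: tab) (simp add: rew del: One_nat_def)
  show "hodge_laplacian (drho h) u {1} = (\<lambda>x. oscillator h (u {1}) x - drho h 3 (u {2}) x - drho h 2 (u {3}) x)"
    by (simp only: tab) (simp add: rew del: One_nat_def)
  show "hodge_laplacian (drho h) u {2} = (\<lambda>x. oscillator h (u {2}) x + drho h 3 (u {1}) x + drho h 1 (u {3}) x)"
    by (simp only: tab) (simp add: rew del: One_nat_def)
  show "hodge_laplacian (drho h) u {3} = (\<lambda>x. oscillator h (u {3}) x - drho h 1 (u {2}) x + drho h 2 (u {1}) x + u {3} x)"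
    by (simp only: tab) (simp add: rew del: One_nat_def)
  show "hodge_laplacian (drho h) u {2, 3} = (\<lambda>x. oscillator h (u {2, 3}) x + drho h 3 (u {1, 3}) x - drho h 2 (u {1, 2}) x)"
    by (simp only: tab) (simp add: rew del: One_nat_def)
  show "hodge_laplacian (drho h) u {1, 3} = (\<lambda>x. oscillator h (u {1, 3}) x - drho h 3 (u {2, 3}) x - drho h 1 (u {1, 2}) x)"
    by (simp only: tab) (simp add: rew del: One_nat_def)
  show "hodge_laplacian (drho h) u {1, 2} = (\<lambda>x. oscillator h (u {1, 2}) x + drho h 1 (u {1, 3}) x + drho h 2 (u {2, 3}) x + u {1, 2} x)"
    by (simp only: tab) (simp add: rew del: One_nat_def)
  show "hodge_laplacian (drho h) u {1, 2, 3} = oscillator h (u {1, 2, 3})"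
    by (simp only: tab) (simp add: rew del: One_nat_def)
qed

section \<open>Hermite functions and their completeness\<close>

text \<open>
  For \<open>h < 0\<close> the operators \<open>X + i Y\<close> and \<open>X - i Y\<close> change their roles.  The sign of \<open>h\<close> in the
  definition makes \<open>raise h\<close> the creation operator in both cases.
\<close>

definition raise :: "real \<Rightarrow> (real \<Rightarrow> complex) \<Rightarrow> real \<Rightarrow> complex" where
  "raise h f = (\<lambda>x. drho h 1 f x + \<i> * of_real (sgn h) * drho h 2 f x)"

definition lower :: "real \<Rightarrow> (real \<Rightarrow> complex) \<Rightarrow> real \<Rightarrow> complex" where
  "lower h f = (\<lambda>x. drho h 1 f x - \<i> * of_real (sgn h) * drho h 2 f x)"

definition tau :: "real \<Rightarrow> real" where "tau h = 2 * pi * \<bar>h\<bar>"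

text \<open>
  Without normalising factors all recurrences have polynomial coefficients.
\<close>

primrec herm :: "real \<Rightarrow> nat \<Rightarrow> real \<Rightarrow> complex" where
  "herm h 0 = (\<lambda>x. of_real (exp (- (pi / \<bar>h\<bar>) * x\<^sup>2)))"
| "herm h (Suc n) = raise h (herm h n)"

lemma raise_schwartz [intro]: "f \<in> schwartz \<Longrightarrow> raise h f \<in> schwartz"
  unfolding raise_def by (intro schwartz_add schwartz_cmult drho_schwartz) auto

lemma lower_schwartz [intro]: "f \<in> schwartz \<Longrightarrow> lower h f \<in> schwartz"
  unfolding lower_def by (intro schwartz_diff schwartz_cmult drho_schwartz) auto

lemma herm_schwartz: "h \<noteq> 0 \<Longrightarrow> herm h n \<in> schwartz"
proof (induction n)
  case 0
  thus ?case unfolding herm.simps by (intro gauss_schwartz) simp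
qed auto

lemma sgn_sq: "h \<noteq> 0 \<Longrightarrow> of_real (sgn h) * of_real (sgn h) = (1 :: complex)"
  by (simp add: sgn_if)

lemma tau_pos: "h \<noteq> 0 \<Longrightarrow> tau h > 0" by (simp add: tau_def)

lemma drho_T_tau: "drho h 3 f x = \<i> * of_real (sgn h) * of_real (tau h) * f x"
  by (simp add: drho_T tau_def sgn_if)

lemma raise_cmult: "f \<in> schwartz \<Longrightarrow> raise h (\<lambda>x. c * f x) = (\<lambda>x. c * raise h f x)"
  by (simp add: raise_def drho_cmult algebra_simps fun_eq_iff)

lemma lower_raise:
  assumes h: "h \<noteq> 0" and f: "f \<in> schwartz"
  shows "lower h (raise h f) = (\<lambda>x. drho h 1 (drho h 1 f) x + drho h 2 (drho h 2 f) x - of_real (tau h) * f x)"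
    and "raise h (lower h f) = (\<lambda>x. drho h 1 (drho h 1 f) x + drho h 2 (drho h 2 f) x + of_real (tau h) * f x)"
proof -
  define e where "e = \<i> * of_real (sgn h)"
  have e: "e * e = -1" using h by (simp add: e_def sgn_if)
  have s: "drho h 1 f \<in> schwartz" "drho h 2 f \<in> schwartz" using drho_schwartz[OF f] by auto
  have es: "(\<lambda>x. e * drho h 2 f x) \<in> schwartz" using s by auto
  have XY: "drho h 1 (drho h 2 f) x = drho h 2 (drho h 1 f) x + e * of_real (tau h) * f x" for x
    using drho_commutator[OF f, of h] by (simp add: e_def drho_T_tau)
  have "drho h i (raise h f) = (\<lambda>x. drho h i (drho h 1 f) x + e * drho h i (drho h 2 f) x)" if "i \<in> {1, 2}" for i
    unfolding raise_def e_def[symmetric] using that s es by (subst drho_add) (auto simp: drho_cmult)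
  hence "lower h (raise h f) x = drho h 1 (drho h 1 f) x + e * drho h 1 (drho h 2 f) x - e * drho h 2 (drho h 1 f) x - (e * e) * drho h 2 (drho h 2 f) x" for x
    unfolding lower_def e_def[symmetric] by (simp add: algebra_simps)
  moreover have "A + e * (B + e * z) - e * B - (e * e) * D = A + D - z" for A B D z
    by (simp only: distrib_left mult.assoc[symmetric] e) simp
  ultimately show "lower h (raise h f) = (\<lambda>x. drho h 1 (drho h 1 f) x + drho h 2 (drho h 2 f) x - of_real (tau h) * f x)"
    unfolding XY mult.assoc[of e "of_real (tau h)"] by (intro ext) (simp only:)
  have "drho h i (lower h f) = (\<lambda>x. drho h i (drho h 1 f) x - e * drho h i (drho h 2 f) x)" if "i \<in> {1, 2}" for i
    unfolding lower_def e_def[symmetric] using that s es by (subst drho_diff) (auto simp: drho_cmult)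
  hence "raise h (lower h f) x = drho h 1 (drho h 1 f) x - e * drho h 1 (drho h 2 f) x + e * drho h 2 (drho h 1 f) x - (e * e) * drho h 2 (drho h 2 f) x" for x
    unfolding raise_def e_def[symmetric] by (simp add: algebra_simps)
  moreover have "A - e * (B + e * z) + e * B - (e * e) * D = A + D + z" for A B D z
    by (simp only: distrib_left mult.assoc[symmetric] e) simp
  ultimately show "raise h (lower h f) = (\<lambda>x. drho h 1 (drho h 1 f) x + drho h 2 (drho h 2 f) x + of_real (tau h) * f x)"
    unfolding XY mult.assoc[of e "of_real (tau h)"] by (intro ext) (simp only:)
qed

text \<open>
  The operator \<open>lower h\<close> annihilates the Gaussian, and moving it past each of the \<open>n\<close> factors
  \<open>raise h\<close> yields a commutator \<open>- 2 \<tau>\<close>.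
\<close>

lemma lower_herm:
  assumes h: "h \<noteq> 0"
  shows "lower h (herm h n) = (\<lambda>x. - of_real (2 * real n * tau h) * herm h (n - 1) x)"
proof (induction n)
  case 0
  define a where "a = pi / \<bar>h\<bar>"
  have "((\<lambda>z. exp (- of_real a * z\<^sup>2)) has_field_derivative
      (- 2 * of_real a * of_real x) * exp (- of_real a * (of_real x)\<^sup>2)) (at (of_real x :: complex))" for x
    by (auto intro!: derivative_eq_intros)
  from has_vector_derivative_real_field[OF this]
  have "(herm h 0 has_vector_derivative (- 2 * of_real a * of_real x) * herm h 0 x) (at x)" for x
    by (simp add: a_def exp_of_real[symmetric])
  hence "vderiv (herm h 0) x = (- 2 * of_real a * of_real x) * herm h 0 x" for x
    by (rule vector_derivative_at)
  moreover have "of_real h * of_real a = (of_real (sgn h * pi) :: complex)"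
  proof -
    have "h * a = sgn h * pi" using h by (simp add: a_def sgn_if abs_if)
    thus ?thesis by (simp only: flip: of_real_mult)
  qed
  ultimately have "drho h 1 (herm h 0) x = - 2 * of_real (sgn h * pi) * of_real x * herm h 0 x" for x
    using drho_X_schwartz[OF herm_schwartz[OF h, of 0], of h] by (simp del: herm.simps add: algebra_simps)
  moreover have "drho h 2 (herm h 0) x = 2 * of_real pi * \<i> * of_real x * herm h 0 x" for x
    by (rule drho_Y)
  ultimately show ?case
    by (simp add: lower_def fun_eq_iff algebra_simps del: herm.simps)
next
  case (Suc n)
  note S = herm_schwartz[OF h]
  have "lower h (herm h (Suc n)) = (\<lambda>x. raise h (lower h (herm h n)) x - 2 * of_real (tau h) * herm h n x)"
    using lower_raise[OF h S[of n]] by (simp add: fun_eq_iff)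
  also have "raise h (lower h (herm h n)) = (\<lambda>x. - of_real (2 * real n * tau h) * herm h n x)"
  proof (cases n)
    case 0
    have "lower h (herm h n) = (\<lambda>x. 0 * herm h 0 x)" unfolding Suc.IH by (simp add: 0)
    thus ?thesis using raise_cmult[OF S[of 0], of h 0] by (simp add: 0 del: herm.simps)
  next
    case (Suc m)
    have "raise h (lower h (herm h n)) = (\<lambda>x. - of_real (2 * real n * tau h) * raise h (herm h (n - 1)) x)"
      unfolding Suc.IH by (rule raise_cmult[OF S])
    thus ?thesis by (simp add: Suc)
  qed
  finally have E: "lower h (herm h (Suc n)) = (\<lambda>x. - of_real (2 * real n * tau h) * herm h n x - 2 * of_real (tau h) * herm h n x)" .
  show ?case unfolding E by (rule ext) (simp add: algebra_simps del: herm.simps)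
qed

lemma oscillator_herm:
  assumes h: "h \<noteq> 0"
  shows "oscillator h (herm h n) = (\<lambda>x. of_real (osc (tau h) n) * herm h n x)"
proof
  fix x
  define e where "e = \<i> * of_real (sgn h)"
  have e: "e * e = -1" using h by (simp add: e_def sgn_if)
  note S = herm_schwartz[OF h]
  have 1: "drho h 1 (drho h 1 (herm h n)) x + drho h 2 (drho h 2 (herm h n)) x - of_real (tau h) * herm h n x
     = - of_real (2 * real (Suc n) * tau h) * herm h n x"
    using lower_raise(1)[OF h S[of n]] lower_herm[OF h, of "Suc n"] by (simp add: fun_eq_iff del: of_nat_Suc)
  have 2: "drho h 3 (drho h 3 (herm h n)) x = - (of_real (tau h) * of_real (tau h)) * herm h n x"
  proof -
    have "drho h 3 (drho h 3 (herm h n)) x = (e * e) * (of_real (tau h) * of_real (tau h) * herm h n x)"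
      by (simp add: drho_T_tau e_def)
    thus ?thesis using e by simp
  qed
  have "oscillator h (herm h n) x = - ((drho h 1 (drho h 1 (herm h n)) x + drho h 2 (drho h 2 (herm h n)) x - of_real (tau h) * herm h n x)
     + of_real (tau h) * herm h n x + drho h 3 (drho h 3 (herm h n)) x)"
    by (simp add: oscillator_def)
  also have "\<dots> = of_real (osc (tau h) n) * herm h n x"
    unfolding 1 2 by (simp add: osc_def algebra_simps)
  finally show "oscillator h (herm h n) x = of_real (osc (tau h) n) * herm h n x" .
qed

lemma drho_Y_ladder: "h \<noteq> 0 \<Longrightarrow> drho h 2 f x = \<i> * of_real (sgn h) * (lower h f x - raise h f x) / 2"
  by (simp add: raise_def lower_def algebra_simps sgn_if)

lemma raise_adjoint:
  assumes f: "f \<in> schwartz" and g: "g \<in> schwartz"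
  shows "ip1 (raise h f) g = - ip1 f (lower h g)" "ip1 (lower h f) g = - ip1 f (raise h g)"
proof -
  define e where "e = \<i> * of_real (sgn h)"
  have ce: "cnj e = - e" by (simp add: e_def)
  have F: "drho h 1 f \<in> l2" "drho h 2 f \<in> l2" "f \<in> l2" using f by (auto intro!: schwartz_l2 drho_schwartz)
  have G: "drho h 1 g \<in> l2" "drho h 2 g \<in> l2" "g \<in> l2" using g by (auto intro!: schwartz_l2 drho_schwartz)
  show "ip1 (raise h f) g = - ip1 f (lower h g)" "ip1 (lower h f) g = - ip1 f (raise h g)"
    unfolding raise_def lower_def e_def[symmetric] using F G
    by (simp_all add: ip1_add_left ip1_diff_left ip1_add_right ip1_diff_right l2_cmult ip1_cmult_left ip1_cmult_right
        drho_skew[OF f g] ce del: One_nat_def)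
qed

lemma oscillator_schwartz: "f \<in> schwartz \<Longrightarrow> oscillator h f \<in> schwartz"
  unfolding oscillator_def by (intro schwartz_uminus schwartz_add drho_schwartz) auto

lemma oscillator_symmetric:
  assumes f: "f \<in> schwartz" and g: "g \<in> schwartz"
  shows "ip1 (oscillator h f) g = ip1 f (oscillator h g)"
proof -
  have S: "drho h i k \<in> schwartz" "drho h i (drho h i k) \<in> l2" if "k \<in> schwartz" "i \<in> {1, 2, 3}" for i k
    using that by (auto intro!: schwartz_l2 drho_schwartz)
  have D: "ip1 (drho h i (drho h i f)) g = ip1 f (drho h i (drho h i g))" if "i \<in> {1, 2, 3}" for i
    using drho_skew[OF S(1)[OF f that] g that] drho_skew[OF f S(1)[OF g that] that] by simp
  have L: "f \<in> l2" "g \<in> l2" using f g schwartz_l2 by auto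
  have l: "drho h 1 (drho h 1 k) \<in> l2" "drho h 2 (drho h 2 k) \<in> l2" "drho h 3 (drho h 3 k) \<in> l2"
    if "k \<in> schwartz" for k using S(2)[OF that] by blast+
  have d: "ip1 (drho h 1 (drho h 1 f)) g = ip1 f (drho h 1 (drho h 1 g))"
    "ip1 (drho h 2 (drho h 2 f)) g = ip1 f (drho h 2 (drho h 2 g))"
    "ip1 (drho h 3 (drho h 3 f)) g = ip1 f (drho h 3 (drho h 3 g))" using D by blast+
  show ?thesis unfolding oscillator_def
    by (simp only: ip1_uminus_left ip1_uminus_right ip1_add_left ip1_add_right l2_add l[OF f] l[OF g] L d)
qed

lemma osc_inj: "\<tau> > 0 \<Longrightarrow> inj (osc \<tau>)"
  by (simp add: inj_def osc_def)

text \<open>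
  Eigenfunctions of a symmetric operator for different eigenvalues.
\<close>

lemma herm_orthogonal:
  assumes h: "h \<noteq> 0" and nm: "n \<noteq> m"
  shows "ip1 (herm h n) (herm h m) = 0"
proof -
  have "of_real (osc (tau h) n) * ip1 (herm h n) (herm h m) = of_real (osc (tau h) m) * ip1 (herm h n) (herm h m)"
    using oscillator_symmetric[OF herm_schwartz[OF h] herm_schwartz[OF h], of h n m]
    unfolding oscillator_herm[OF h] by (simp only: ip1_cmult_left ip1_cmult_right complex_cnj_complex_of_real)
  moreover have "osc (tau h) n \<noteq> osc (tau h) m" using osc_inj[OF tau_pos[OF h]] nm by (simp add: inj_eq)
  ultimately show ?thesis by simp
qed

text \<open>
  By adjointness of the ladder operators the squared norm of \<open>herm h (Suc n)\<close> is a positive multiple of that of \<open>herm h n\<close>.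
\<close>

lemma herm_norm:
  assumes h: "h \<noteq> 0"
  shows "ip1 (herm h n) (herm h n) \<noteq> 0"
proof (induction n)
  case 0
  define g where "g x = (exp (- (pi / \<bar>h\<bar>) * x\<^sup>2))\<^sup>2" for x
  have i: "integrable lborel g"
    using l2_integrable[OF schwartz_l2[OF herm_schwartz[OF h, of 0]]] by (simp add: g_def[abs_def])
  have "ip1 (herm h 0) (herm h 0) = (LBINT x. of_real (g x))"
    unfolding ip1_def by (rule Bochner_Integration.integral_cong) (simp_all add: g_def power2_eq_square)
  also have "\<dots> = of_real (LBINT x. g x)" by simp
  finally have eq: "ip1 (herm h 0) (herm h 0) = of_real (LBINT x. g x)" .
  show ?case
  proof
    assume "ip1 (herm h 0) (herm h 0) = 0"
    hence "(LBINT x. g x) = 0" using eq by simp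
    moreover have "AE x in lborel. 0 \<le> g x" by (simp add: g_def)
    ultimately have "AE x in lborel. g x = 0"
      using integral_nonneg_eq_0_iff_AE[OF i] by blast
    hence "AE x in (lborel :: real measure). False" by (simp add: g_def)
    thus False by (subst (asm) AE_iff_measurable[of UNIV]) auto
  qed
next
  case (Suc n)
  have "ip1 (herm h (Suc n)) (herm h (Suc n)) = - ip1 (herm h n) (lower h (herm h (Suc n)))"
    using raise_adjoint(1)[OF herm_schwartz[OF h] herm_schwartz[OF h], of h n "Suc n"] by simp
  also have "\<dots> = of_real (2 * real (Suc n) * tau h) * ip1 (herm h n) (herm h n)"
    unfolding lower_herm[OF h] by (simp only: ip1_cmult_right) simp
  finally show ?case using Suc tau_pos[OF h] by (simp del: herm.simps of_nat_Suc)
qed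

text \<open>
  Under the exponential bound the Fourier transform of \<open>w\<close> is the sum of its Taylor series, whose
  coefficients are the moments, so it vanishes.  The positive and the negative part of \<open>w\<close>, divided
  by their common integral, are then densities of two probability measures with the same characteristic
  function, and these coincide by Levy's uniqueness theorem.
\<close>

lemma zero_moments_imp_zero:
  fixes w :: "real \<Rightarrow> real"
  assumes w[measurable]: "w \<in> borel_measurable borel"
    and int: "\<And>t. integrable lborel (\<lambda>x. \<bar>w x\<bar> * exp (\<bar>t * x\<bar>))"
    and mom: "\<And>n. (LBINT x. w x * x ^ n) = 0"
  shows "AE x in lborel. w x = 0"
proof -
  have iw: "integrable lborel w"
    using int[of 0] by (simp add: integrable_abs_iff)
  have iwn: "integrable lborel (\<lambda>x. w x * x ^ n)" for n
  proof (rule Bochner_Integration.integrable_bound[OF integrable_mult_right[OF int[of 1], of "fact n"]])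
    show "AE x in lborel. norm (w x * x ^ n) \<le> norm (fact n * (\<bar>w x\<bar> * exp \<bar>1 * x\<bar>))"
    proof (intro AE_I2)
      fix x :: real
      have "\<bar>x\<bar> ^ n \<le> fact n * exp \<bar>x\<bar>" by (rule power_le_fact_exp) simp
      from mult_left_mono[OF this, of "\<bar>w x\<bar>"]
      show "norm (w x * x ^ n) \<le> norm (fact n * (\<bar>w x\<bar> * exp \<bar>1 * x\<bar>))"
        by (simp add: abs_mult power_abs mult_ac)
    qed
  qed simp
  \<comment> \<open>Integrate the exponential series term by term.\<close>
  have four: "(LBINT x. of_real (w x) * exp (\<i> * of_real (t * x))) = 0" for t
  proof -
    define s where "s N x = (\<Sum>n<N. of_real (w x) * ((\<i> * of_real (t * x)) ^ n / fact n))" for N x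
    have sm: "s N \<in> borel_measurable lborel" for N unfolding s_def by measurable
    have "(\<lambda>N. LBINT x. s N x) \<longlonglongrightarrow> (LBINT x. of_real (w x) * exp (\<i> * of_real (t * x)))"
    proof (rule integral_dominated_convergence[OF _ sm int[of t]])
      show "AE x in lborel. (\<lambda>N. s N x) \<longlonglongrightarrow> of_real (w x) * exp (\<i> * of_real (t * x))"
      proof (intro AE_I2)
        fix x
        have "(\<lambda>n. (\<i> * of_real (t * x)) ^ n / fact n) sums exp (\<i> * of_real (t * x))"
          using exp_converges[of "\<i> * of_real (t * x)"] by (simp add: scaleR_conv_of_real field_simps)
        from sums_mult[OF this, of "of_real (w x)"]
        show "(\<lambda>N. s N x) \<longlonglongrightarrow> of_real (w x) * exp (\<i> * of_real (t * x))"
          unfolding s_def sums_def .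
      qed
      show "AE x in lborel. norm (s N x) \<le> \<bar>w x\<bar> * exp \<bar>t * x\<bar>" for N
      proof (intro AE_I2)
        fix x
        have "norm (s N x) \<le> (\<Sum>n<N. \<bar>w x\<bar> * (\<bar>t * x\<bar> ^ n / fact n))"
          unfolding s_def by (rule order_trans[OF norm_sum]) (simp add: norm_mult norm_divide norm_power abs_mult)
        also have "\<dots> = \<bar>w x\<bar> * (\<Sum>n<N. \<bar>t * x\<bar> ^ n / fact n)" by (simp add: sum_distrib_left)
        also have "(\<Sum>n<N. \<bar>t * x\<bar> ^ n / fact n) \<le> exp \<bar>t * x\<bar>"
        proof -
          have "(\<Sum>n<N. \<bar>t * x\<bar> ^ n /\<^sub>R fact n) \<le> (\<Sum>n. \<bar>t * x\<bar> ^ n /\<^sub>R fact n)"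
            by (intro sum_le_suminf summable_exp_generic) auto
          thus ?thesis by (simp add: exp_def scaleR_conv_of_real field_simps)
        qed
        finally show "norm (s N x) \<le> \<bar>w x\<bar> * exp \<bar>t * x\<bar>" by (simp add: mult_left_mono)
      qed
    qed measurable
    moreover have "(LBINT x. s N x) = 0" for N
    proof -
      have "s N x = (\<Sum>n<N. ((\<i> * of_real t) ^ n / fact n) * of_real (w x * x ^ n))" for x
        unfolding s_def by (intro sum.cong refl) (simp add: power_mult_distrib)
      hence "(LBINT x. s N x) = (\<Sum>n<N. ((\<i> * of_real t) ^ n / fact n) * (LBINT x. of_real (w x * x ^ n)))"
        using iwn by (simp del: of_real_mult of_real_power)
      also have "\<dots> = 0" using mom by (simp del: of_real_mult of_real_power)
      finally show ?thesis .
    qed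
    ultimately show ?thesis by (simp add: LIMSEQ_const_iff)
  qed
  define m where "m = (LBINT x. max 0 (w x))"
  have ip: "integrable lborel (\<lambda>x. max 0 (w x))" "integrable lborel (\<lambda>x. max 0 (- w x))"
    using iw by (intro integrable_max; simp)+
  have "(LBINT x. w x) = (LBINT x. max 0 (w x) - max 0 (- w x))"
    by (rule Bochner_Integration.integral_cong) auto
  hence m': "(LBINT x. max 0 (- w x)) = m" using mom[of 0] ip by (simp add: m_def)
  show ?thesis
  proof (cases "m = 0")
    case True
    have "AE x in lborel. max 0 (w x) = 0" "AE x in lborel. max 0 (- w x) = 0"
      using integral_nonneg_eq_0_iff_AE[OF ip(1)] integral_nonneg_eq_0_iff_AE[OF ip(2)] True m' by (simp_all add: m_def)
    thus ?thesis by eventually_elim auto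
  next
    case False
    have mpos: "m > 0"
    proof -
      have "m \<ge> 0" unfolding m_def by (rule Bochner_Integration.integral_nonneg) simp
      thus ?thesis using False by simp
    qed
    define M where "M v = density lborel (\<lambda>x. ennreal (max 0 (v x) / m))" for v :: "real \<Rightarrow> real"
    have rd: "real_distribution (M v)"
      if [measurable]: "v \<in> borel_measurable borel" and "integrable lborel (\<lambda>x. max 0 (v x))" "(LBINT x. max 0 (v x)) = m" for v
    proof -
      have "emeasure (M v) (space (M v)) = (\<integral>\<^sup>+x. ennreal (max 0 (v x) / m) \<partial>lborel)"
        unfolding M_def by (subst emeasure_density) auto
      also have "\<dots> = ennreal (LBINT x. max 0 (v x) / m)"
        using that mpos by (intro nn_integral_eq_integral) auto
      also have "(LBINT x. max 0 (v x) / m) = 1" using that mpos by simp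
      finally have "prob_space (M v)" by (intro prob_spaceI) simp
      thus ?thesis unfolding real_distribution_def real_distribution_axioms_def by (simp add: M_def)
    qed
    have ch: "char (M v) t = (LBINT x. of_real (max 0 (v x)) * exp (\<i> * of_real (t * x))) / of_real m"
      if [measurable]: "v \<in> borel_measurable borel" for v t
    proof -
      have "char (M v) t = (LBINT x. (max 0 (v x) / m) *\<^sub>R exp (\<i> * of_real (t * x)))"
        unfolding char_def M_def using mpos by (subst integral_density) auto
      also have "\<dots> = (LBINT x. of_real (max 0 (v x)) * exp (\<i> * of_real (t * x)) / of_real m)"
        by (rule Bochner_Integration.integral_cong) (simp_all add: scaleR_conv_of_real)
      finally show ?thesis by simp
    qed
    have "char (M w) t = char (M (\<lambda>x. - w x)) t" for t
    proof -
      have i: "integrable lborel (\<lambda>x. of_real (max 0 (v x)) * exp (\<i> * of_real (t * x)))"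
        if "integrable lborel (\<lambda>x. max 0 (v x))" "v \<in> borel_measurable borel" for v
        by (rule Bochner_Integration.integrable_bound[OF that(1)]) (use that(2) in \<open>auto simp: norm_mult\<close>)
      have "(LBINT x. of_real (max 0 (w x)) * exp (\<i> * of_real (t * x))) - (LBINT x. of_real (max 0 (- w x)) * exp (\<i> * of_real (t * x)))
         = (LBINT x. of_real (max 0 (w x)) * exp (\<i> * of_real (t * x)) - of_real (max 0 (- w x)) * exp (\<i> * of_real (t * x)))"
        using i[OF ip(1)] i[OF ip(2)] by (subst Bochner_Integration.integral_diff) auto
      also have "\<dots> = (LBINT x. of_real (w x) * exp (\<i> * of_real (t * x)))"
      proof (rule Bochner_Integration.integral_cong[OF refl])
        fix x
        have "max 0 (w x) - max 0 (- w x) = w x" by auto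
        thus "of_real (max 0 (w x)) * exp (\<i> * of_real (t * x)) - of_real (max 0 (- w x)) * exp (\<i> * of_real (t * x)) = of_real (w x) * exp (\<i> * of_real (t * x))"
          by (metis left_diff_distrib of_real_diff)
      qed
      finally have eq: "(LBINT x. of_real (max 0 (w x)) * exp (\<i> * of_real (t * x))) = (LBINT x. of_real (max 0 (- w x)) * exp (\<i> * of_real (t * x)))"
        unfolding four right_minus_eq .
      have "(\<lambda>x. - w x) \<in> borel_measurable borel" by measurable
      from ch[OF w] ch[OF this] show ?thesis by (simp only: eq)
    qed
    hence "M w = M (\<lambda>x. - w x)"
      by (intro Levy_uniqueness rd ext) (use ip m' in \<open>auto simp: m_def\<close>)
    hence "AE x in lborel. ennreal (max 0 (w x) / m) = ennreal (max 0 (- w x) / m)"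
      unfolding M_def by (subst (asm) sigma_finite_measure.density_unique_iff[OF sigma_finite_lborel]) auto
    thus ?thesis
    proof eventually_elim
      case (elim x)
      hence "max 0 (w x) / m = max 0 (- w x) / m" using mpos by (subst (asm) ennreal_inj) auto
      thus ?case using mpos by (auto simp: max_def split: if_splits)
    qed
  qed
qed

text \<open>
  Multiplication by \<open>x\<close> is a combination of \<open>raise h\<close> and \<open>lower h\<close>, so it maps the span of the
  Hermite functions into itself.  A function orthogonal to all of them is therefore orthogonal to all
  products of powers of \<open>x\<close> with the Gaussian: the product of \<open>f\<close> with the Gaussian has vanishing
  moments.
\<close>

lemma herm_complete:
  assumes h: "h \<noteq> 0" and f: "f \<in> l2" and orth: "\<And>n. ip1 f (herm h n) = 0"
  shows "(LBINT x. (cmod (f x))\<^sup>2) = 0"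
proof -
  define a where "a = pi / \<bar>h\<bar>"
  have a: "a > 0" using h by (simp add: a_def)
  define G where "G x = exp (- a * x\<^sup>2)" for x :: real
  have G: "herm h 0 x = of_real (G x)" for x by (simp add: G_def a_def)
  note S = herm_schwartz[OF h]
  have Sx: "(\<lambda>x. of_real x ^ j * g x) \<in> schwartz" if "g \<in> schwartz" for j g
  proof (induction j)
    case (Suc j)
    from schwartz_x[OF this] show ?case by (simp add: mult.assoc)
  qed (use that in simp)
  have mom: "ip1 f (\<lambda>x. of_real x ^ j * herm h n x) = 0" for j n
  proof (induction j arbitrary: n)
    case 0 thus ?case using orth by simp
  next
    case (Suc j)
    define e where "e = \<i> * of_real (sgn h)"
    have x: "of_real x * herm h n x = (e / (4 * of_real pi * \<i>)) * (- of_real (2 * real n * tau h) * herm h (n - 1) x - herm h (Suc n) x)" for x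
    proof -
      have "2 * of_real pi * \<i> * of_real x * herm h n x = e * (lower h (herm h n) x - raise h (herm h n) x) / 2"
        using drho_Y_ladder[OF h, of "herm h n" x] unfolding e_def drho_Y .
      thus ?thesis unfolding lower_herm[OF h] herm.simps(2)[symmetric] by (simp add: field_simps del: herm.simps)
    qed
    have eq: "(\<lambda>x. of_real x ^ Suc j * herm h n x) = (\<lambda>x. (e / (4 * of_real pi * \<i>)) *
       (- of_real (2 * real n * tau h) * (of_real x ^ j * herm h (n - 1) x) - of_real x ^ j * herm h (Suc n) x))"
    proof
      fix x
      have "of_real x ^ Suc j * herm h n x = of_real x ^ j * (of_real x * herm h n x)" by simp
      also have "\<dots> = (e / (4 * of_real pi * \<i>)) * (- of_real (2 * real n * tau h) * (of_real x ^ j * herm h (n - 1) x) - of_real x ^ j * herm h (Suc n) x)"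
        unfolding x by (simp only: right_diff_distrib mult_ac)
      finally show "of_real x ^ Suc j * herm h n x = (e / (4 * of_real pi * \<i>)) * (- of_real (2 * real n * tau h) * (of_real x ^ j * herm h (n - 1) x) - of_real x ^ j * herm h (Suc n) x)" .
    qed
    have l: "(\<lambda>x. of_real x ^ j * herm h k x) \<in> l2" for k by (intro schwartz_l2 Sx S)
    show ?case unfolding eq ip1_cmult_right
      by (subst ip1_diff_right[OF l2_cmult[OF l] l f]) (simp only: ip1_cmult_right Suc.IH, simp)
  qed
  have fm[measurable]: "f \<in> borel_measurable borel" by (rule l2_measurable[OF f])
  \<comment> \<open>Half of the Gaussian exponent absorbs \<open>\<bar>t * x\<bar>\<close>; the other half is square integrable.\<close>
  have bd: "integrable lborel (\<lambda>x. cmod (f x) * G x * exp \<bar>t * x\<bar>)" for t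
  proof (rule Bochner_Integration.integrable_bound)
    define g where "g x = (of_real (exp (- (a / 2) * x\<^sup>2)) :: complex)" for x
    have "g \<in> l2" unfolding g_def using gauss_schwartz[of "a/2"] a by (intro schwartz_l2) simp
    from integrable_norm[OF l2_product_integrable[OF f this]]
    show "integrable lborel (\<lambda>x. exp (t\<^sup>2 / (2 * a)) * norm (f x * cnj (g x)))" by simp
    show "AE x in lborel. norm (cmod (f x) * G x * exp \<bar>t * x\<bar>) \<le> norm (exp (t\<^sup>2 / (2 * a)) * norm (f x * cnj (g x)))"
    proof (intro AE_I2)
      fix x
      have "2 * a * \<bar>t * x\<bar> \<le> a * (a * x\<^sup>2) + t\<^sup>2"
        using sum_squares_bound[of "a * \<bar>x\<bar>" "\<bar>t\<bar>"] by (simp add: power_mult_distrib abs_mult power2_eq_square mult_ac)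
      hence "\<bar>t * x\<bar> \<le> (a / 2) * x\<^sup>2 + t\<^sup>2 / (2 * a)" using a by (simp add: field_simps power2_eq_square)
      hence "- a * x\<^sup>2 + \<bar>t * x\<bar> \<le> t\<^sup>2 / (2 * a) + - (a / 2) * x\<^sup>2" by simp
      hence "exp (- a * x\<^sup>2 + \<bar>t * x\<bar>) \<le> exp (t\<^sup>2 / (2 * a) + - (a / 2) * x\<^sup>2)" by (simp only: exp_le_cancel_iff)
      hence "G x * exp \<bar>t * x\<bar> \<le> exp (t\<^sup>2 / (2 * a)) * exp (- (a / 2) * x\<^sup>2)" by (simp only: exp_add G_def)
      from mult_left_mono[OF this norm_ge_zero[of "f x"]]
      show "norm (cmod (f x) * G x * exp \<bar>t * x\<bar>) \<le> norm (exp (t\<^sup>2 / (2 * a)) * norm (f x * cnj (g x)))"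
        by (simp add: g_def norm_mult G_def mult_ac)
    qed
  qed (simp add: G_def)
  have intj: "integrable lborel (\<lambda>x. f x * of_real (x ^ j * G x))" for j
    using l2_product_integrable[OF f schwartz_l2[OF Sx[OF S, of j 0]]] by (simp add: G del: herm.simps)
  have zero: "(LBINT x. f x * of_real (x ^ j * G x)) = 0" for j
    using mom[of j 0] by (simp add: ip1_def G del: herm.simps)
  \<comment> \<open>Applied to the real and the imaginary part, since the moment criterion is for real functions.\<close>
  have part: "AE x in lborel. p (f x) * G x = 0"
    if p: "bounded_linear p" "\<And>z. \<bar>p z\<bar> \<le> cmod z" for p :: "complex \<Rightarrow> real"
  proof (rule zero_moments_imp_zero)
    have [measurable]: "p \<in> borel_measurable borel"
      using p(1) by (intro borel_measurable_continuous_onI linear_continuous_on)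
    show "(\<lambda>x. p (f x) * G x) \<in> borel_measurable borel" unfolding G_def by measurable
    show "integrable lborel (\<lambda>x. \<bar>p (f x) * G x\<bar> * exp \<bar>t * x\<bar>)" for t
      by (rule Bochner_Integration.integrable_bound[OF bd[of t]])
         (use p(2) in \<open>auto simp: G_def abs_mult intro!: mult_right_mono\<close>)
    show "(LBINT x. p (f x) * G x * x ^ n) = 0" for n
    proof -
      have "p (f x * of_real (x ^ n * G x)) = p (f x) * G x * x ^ n" for x
        using linear_scale[OF bounded_linear.linear[OF p(1)], of "x ^ n * G x" "f x"]
        by (simp add: scaleR_conv_of_real mult_ac)
      hence "(LBINT x. p (f x) * G x * x ^ n) = (LBINT x. p (f x * of_real (x ^ n * G x)))" by (simp del: of_real_mult)
      also have "\<dots> = p (LBINT x. f x * of_real (x ^ n * G x))"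
        by (rule integral_bounded_linear[OF p(1) intj])
      finally show ?thesis using zero linear_0[OF bounded_linear.linear[OF p(1)]] by simp
    qed
  qed
  have "AE x in lborel. Re (f x) * G x = 0" "AE x in lborel. Im (f x) * G x = 0"
    by (intro part bounded_linear_Re bounded_linear_Im abs_Re_le_cmod abs_Im_le_cmod)+
  hence "AE x in lborel. (cmod (f x))\<^sup>2 = 0"
    by eventually_elim (auto simp: G_def complex_eq_iff)
  thus ?thesis by (rule integral_eq_zero_AE)
qed

section \<open>Spectra from complete systems of eigenforms\<close>

definition ip :: "real form \<Rightarrow> real form \<Rightarrow> complex" where
  "ip u v = (\<Sum>J\<in>Pow {1, 2, 3}. ip1 (u J) (v J))"

lemma l2_forms_l2: "u \<in> l2_forms q \<Longrightarrow> u J \<in> l2"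
  by (cases "J \<subseteq> {1, 2, 3} \<and> card J = q") (auto simp: l2_forms_def l2_def dest!: spec[of _ J])

lemma schwartz_forms_schwartz: "u \<in> schwartz_forms q \<Longrightarrow> u J \<in> schwartz"
  by (cases "J \<subseteq> {1, 2, 3} \<and> card J = q") (auto simp: schwartz_forms_def dest!: spec[of _ J])

lemma schwartz_forms_l2: "u \<in> schwartz_forms q \<Longrightarrow> u \<in> l2_forms q"
  using schwartz_l2 by (auto simp: schwartz_forms_def l2_forms_def l2_def)

lemma ip_self: "ip u u = of_real ((l2_norm u)\<^sup>2)"
proof -
  have "ip1 (u J) (u J) = of_real (LBINT x. (cmod (u J x))\<^sup>2)" for J
    unfolding ip1_def complex_norm_square[symmetric] by (simp flip: of_real_power)
  hence "ip u u = of_real (\<Sum>J\<in>Pow {1, 2, 3}. LBINT x. (cmod (u J x))\<^sup>2)" unfolding ip_def by simp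
  thus ?thesis unfolding l2_norm_def by (simp add: sum_nonneg)
qed

lemma ip_eq_0_iff: "ip u u = 0 \<longleftrightarrow> l2_norm u = 0"
  by (simp add: ip_self)

lemma l2_forms_scale: "u \<in> l2_forms q \<Longrightarrow> (\<lambda>J x. c * u J x) \<in> l2_forms q"
proof -
  assume u: "u \<in> l2_forms q"
  have "(\<lambda>x. c * u J x) \<in> l2" for J by (rule l2_cmult[OF l2_forms_l2[OF u]])
  thus ?thesis using u unfolding l2_forms_def l2_def by auto
qed

lemma l2_forms_sum:
  assumes "\<And>i. i < (k::nat) \<Longrightarrow> b i \<in> l2_forms q"
  shows "(\<lambda>J x. \<Sum>i<k. c i * b i J x) \<in> l2_forms q"
  using assms
proof (induction k)
  case 0 thus ?case by (auto simp: l2_forms_def)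
next
  case (Suc k)
  define v where "v = (\<lambda>J x. \<Sum>i<k. c i * b i J x)"
  have v: "v \<in> l2_forms q" using Suc unfolding v_def by simp
  have b: "b k \<in> l2_forms q" using Suc by simp
  have "(\<lambda>J x. v J x + c k * b k J x) \<in> l2_forms q"
  proof -
    have "(\<lambda>x. v J x + c k * b k J x) \<in> l2" for J
      by (intro l2_add l2_cmult l2_forms_l2[OF v] l2_forms_l2[OF b])
    thus ?thesis using v b unfolding l2_forms_def by (auto simp: l2_def)
  qed
  thus ?case by (simp add: v_def)
qed

lemma ip_sum_left:
  assumes "\<And>i. i < (k::nat) \<Longrightarrow> b i \<in> l2_forms q" "v \<in> l2_forms q"
  shows "ip (\<lambda>J x. \<Sum>i<k. c i * b i J x) v = (\<Sum>i<k. c i * ip (b i) v)"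
proof -
  have "ip1 (\<lambda>x. \<Sum>i<k. c i * b i J x) (v J) = (\<Sum>i<k. c i * ip1 (b i J) (v J))" for J
  proof -
    have "integrable lborel (\<lambda>x. c i * b i J x * cnj (v J x))" if "i < k" for i
      using l2_product_integrable[OF l2_cmult[OF l2_forms_l2[OF assms(1)[OF that], of J], of "c i"] l2_forms_l2[OF assms(2), of J]] .
    thus ?thesis unfolding ip1_def by (simp add: sum_distrib_right mult.assoc)
  qed
  thus ?thesis unfolding ip_def by (simp add: sum_distrib_left) (rule sum.swap)
qed

lemma ip_diff_left:
  assumes "\<And>J. u J \<in> l2" "\<And>J. v J \<in> l2" "\<And>J. w J \<in> l2"
  shows "ip (\<lambda>J x. u J x - v J x) w = ip u w - ip v w"
  using assms by (simp add: ip_def ip1_diff_left sum_subtractf)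

lemma ip_scale_left: "ip (\<lambda>J x. c * u J x) w = c * ip u w"
  by (simp add: ip_def ip1_cmult_left sum_distrib_left)

lemma ip1_bound:
  assumes f: "f \<in> l2" and g: "g \<in> l2" and e: "e > 0"
  shows "cmod (ip1 f g) \<le> (LBINT x. (cmod (f x))\<^sup>2) / e + e * (LBINT x. (cmod (g x))\<^sup>2)"
proof -
  have "cmod (ip1 f g) \<le> (LBINT x. norm (f x * cnj (g x)))"
    unfolding ip1_def by (rule integral_norm_bound)
  also have "\<dots> \<le> (LBINT x. (cmod (f x))\<^sup>2 / e + e * (cmod (g x))\<^sup>2)"
  proof (rule integral_mono)
    show "integrable lborel (\<lambda>x. norm (f x * cnj (g x)))" using l2_product_integrable[OF f g] by simp
    show "integrable lborel (\<lambda>x. (cmod (f x))\<^sup>2 / e + e * (cmod (g x))\<^sup>2)"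
      using l2_integrable[OF f] l2_integrable[OF g] by simp
    fix x
    have "2 * (cmod (f x) / sqrt e) * (sqrt e * cmod (g x)) \<le> (cmod (f x) / sqrt e)\<^sup>2 + (sqrt e * cmod (g x))\<^sup>2"
      by (rule sum_squares_bound)
    hence "2 * (cmod (f x) * cmod (g x)) \<le> (cmod (f x))\<^sup>2 / e + e * (cmod (g x))\<^sup>2"
      using e by (simp add: power_divide power_mult_distrib)
    moreover have "0 \<le> cmod (f x) * cmod (g x)" by simp
    ultimately have "cmod (f x) * cmod (g x) \<le> (cmod (f x))\<^sup>2 / e + e * (cmod (g x))\<^sup>2" by linarith
    thus "norm (f x * cnj (g x)) \<le> (cmod (f x))\<^sup>2 / e + e * (cmod (g x))\<^sup>2" by (simp add: norm_mult)
  qed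
  also have "\<dots> = (LBINT x. (cmod (f x))\<^sup>2) / e + e * (LBINT x. (cmod (g x))\<^sup>2)"
    using l2_integrable[OF f] l2_integrable[OF g] by simp
  finally show ?thesis .
qed

text \<open>
  The Cauchy--Schwarz inequality in additive form, with a free parameter \<open>e\<close> instead of a square root.
\<close>

lemma ip_bound:
  assumes u: "\<And>J. u J \<in> l2" and v: "\<And>J. v J \<in> l2" and e: "e > 0"
  shows "cmod (ip u v) \<le> (l2_norm u)\<^sup>2 / e + e * (l2_norm v)\<^sup>2"
proof -
  have "cmod (ip u v) \<le> (\<Sum>J\<in>Pow {1, 2, 3}. (LBINT x. (cmod (u J x))\<^sup>2) / e + e * (LBINT x. (cmod (v J x))\<^sup>2))"
    unfolding ip_def by (rule order_trans[OF norm_sum]) (intro sum_mono ip1_bound u v e)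
  also have "\<dots> = (l2_norm u)\<^sup>2 / e + e * (l2_norm v)\<^sup>2"
    unfolding l2_norm_def by (simp add: sum.distrib sum_divide_distrib sum_distrib_left sum_nonneg)
  finally show ?thesis .
qed

lemma ip_tendsto:
  assumes u: "\<And>k J. \<phi> k J \<in> l2" "\<And>J. u J \<in> l2" and v: "\<And>J. v J \<in> l2"
    and lim: "(\<lambda>k. l2_norm (\<lambda>J x. \<phi> k J x - u J x)) \<longlonglongrightarrow> 0"
  shows "(\<lambda>k. ip (\<phi> k) v) \<longlonglongrightarrow> ip u v"
proof -
  define n where "n k = l2_norm (\<lambda>J x. \<phi> k J x - u J x)" for k
  \<comment> \<open>The second summand keeps the parameter of \<open>ip_bound\<close> positive where the distance is zero.\<close>
  define e where "e k = n k + 1 / real (Suc k)" for k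
  have n0: "n k \<ge> 0" for k unfolding n_def l2_norm_def by (simp add: sum_nonneg)
  have e0: "e k > 0" for k unfolding e_def using n0[of k] by (intro add_nonneg_pos) auto
  have "norm (ip (\<phi> k) v - ip u v) \<le> n k + e k * (l2_norm v)\<^sup>2" for k
  proof -
    have "ip (\<phi> k) v - ip u v = ip (\<lambda>J x. \<phi> k J x - u J x) v"
      using ip_diff_left[of "\<phi> k" u v] u v by simp
    also have "cmod \<dots> \<le> (n k)\<^sup>2 / e k + e k * (l2_norm v)\<^sup>2"
      unfolding n_def using u v e0 by (intro ip_bound l2_diff) auto
    also have "(n k)\<^sup>2 / e k \<le> n k"
    proof -
      have "n k * n k \<le> n k * e k" using n0[of k] by (intro mult_left_mono) (auto simp: e_def)
      thus ?thesis using e0[of k] by (simp add: divide_le_eq power2_eq_square)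
    qed
    finally show ?thesis by simp
  qed
  moreover have "(\<lambda>k. n k + e k * (l2_norm v)\<^sup>2) \<longlonglongrightarrow> 0 + (0 + 0) * (l2_norm v)\<^sup>2"
    unfolding e_def n_def by (intro tendsto_intros lim LIMSEQ_inverse_real_of_nat[unfolded inverse_eq_divide])
  ultimately have "(\<lambda>k. ip (\<phi> k) v - ip u v) \<longlonglongrightarrow> 0"
    by (intro Lim_null_comparison[of "\<lambda>k. ip (\<phi> k) v - ip u v"] always_eventually allI) auto
  thus ?thesis by (simp add: LIM_zero_cancel)
qed

text \<open>
  A complete system of Schwartz eigenforms, indexed by \<open>I\<close>, that determines the spectrum of the closure
  of the Laplacian.  Orthogonality is asked for only within an eigenspace; between different eigenspaces
  it follows from the last clause, the symmetry of the Laplacian against the system.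
\<close>

definition eigensystem :: "real \<Rightarrow> nat \<Rightarrow> 'i set \<Rightarrow> ('i \<Rightarrow> real form) \<Rightarrow> ('i \<Rightarrow> real) \<Rightarrow> bool" where
  "eigensystem h q I e \<nu> \<longleftrightarrow>
     (\<forall>i\<in>I. e i \<in> schwartz_forms q \<and> hodge_laplacian (drho h) (e i) = (\<lambda>J x. of_real (\<nu> i) * e i J x)
        \<and> l2_norm (e i) \<noteq> 0 \<and> \<nu> i > 0)
     \<and> (\<forall>i\<in>I. \<forall>j\<in>I. i \<noteq> j \<longrightarrow> \<nu> i = \<nu> j \<longrightarrow> ip (e i) (e j) = 0)
     \<and> (\<forall>u\<in>l2_forms q. (\<forall>i\<in>I. ip u (e i) = 0) \<longrightarrow> l2_norm u = 0)
     \<and> (\<forall>l. finite {i \<in> I. \<nu> i = l})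
     \<and> (\<forall>\<phi>\<in>schwartz_forms q. hodge_laplacian (drho h) \<phi> \<in> l2_forms q \<and>
          (\<forall>i\<in>I. ip (hodge_laplacian (drho h) \<phi>) (e i) = of_real (\<nu> i) * ip \<phi> (e i)))"

lemma eigensystemD:
  assumes "eigensystem h q I e \<nu>"
  shows "i \<in> I \<Longrightarrow> e i \<in> schwartz_forms q"
    and "i \<in> I \<Longrightarrow> hodge_laplacian (drho h) (e i) = (\<lambda>J x. of_real (\<nu> i) * e i J x)"
    and "i \<in> I \<Longrightarrow> l2_norm (e i) \<noteq> 0"
    and "i \<in> I \<Longrightarrow> \<nu> i > 0"
    and "i \<in> I \<Longrightarrow> j \<in> I \<Longrightarrow> i \<noteq> j \<Longrightarrow> \<nu> i = \<nu> j \<Longrightarrow> ip (e i) (e j) = 0"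
    and "u \<in> l2_forms q \<Longrightarrow> (\<And>i. i \<in> I \<Longrightarrow> ip u (e i) = 0) \<Longrightarrow> l2_norm u = 0"
    and "finite {i \<in> I. \<nu> i = l}"
    and "\<phi> \<in> schwartz_forms q \<Longrightarrow> hodge_laplacian (drho h) \<phi> \<in> l2_forms q"
    and "\<phi> \<in> schwartz_forms q \<Longrightarrow> i \<in> I \<Longrightarrow> ip (hodge_laplacian (drho h) \<phi>) (e i) = of_real (\<nu> i) * ip \<phi> (e i)"
  using assms unfolding eigensystem_def by simp_all

lemma eigenspaceD:
  assumes "u \<in> eigenspace h q l"
  shows "u \<in> l2_forms q"
  using assms by (simp add: eigenspace_def rep_laplacian_def)

text \<open>
  Fewer homogeneous linear equations than unknowns have a nontrivial solution.  The induction eliminates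
  the equation \<open>b\<close> with the unknown \<open>p\<close>, which is first exchanged with the last one.
\<close>

lemma nontrivial_kernel:
  fixes a :: "nat \<Rightarrow> 'j \<Rightarrow> complex"
  assumes "finite B" "card B < k"
  shows "\<exists>c. (\<exists>i<k. c i \<noteq> 0) \<and> (\<forall>j\<in>B. (\<Sum>i<k. c i * a i j) = 0)"
  using assms
proof (induction B arbitrary: k a rule: finite_induct)
  case empty
  thus ?case by (intro exI[of _ "\<lambda>_. 1"]) auto
next
  case (insert b B)
  show ?case
  proof (cases "\<exists>p<k. a p b \<noteq> 0")
    case False
    have "card B < k" using insert by simp
    from insert.IH[OF this, of a] obtain c where c: "\<exists>i<k. c i \<noteq> 0" "\<forall>j\<in>B. (\<Sum>i<k. c i * a i j) = 0" by blast
    have "(\<Sum>i<k. c i * a i b) = 0" using False by (intro sum.neutral) auto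
    thus ?thesis using c by blast
  next
    case True
    then obtain p where p: "p < k" "a p b \<noteq> 0" by blast
    \<comment> \<open>The transposition that moves the pivot \<open>p\<close> to the last place.\<close>
    define s where "s = (\<lambda>i. if i = p then k - 1 else if i = k - 1 then p else i)"
    have s: "bij_betw s {..<k} {..<k}"
      by (rule bij_betwI[of _ _ _ s]) (use p in \<open>auto simp: s_def\<close>)
    have sp: "s (k - 1) = p" by (auto simp: s_def)
    define k' where "k' = k - 1"
    have k: "k = Suc k'" using p by (simp add: k'_def)
    define a' where "a' i j = a (s i) j - a (s i) b / a p b * a p j" for i j
    have "card B < k'" using insert k by simp
    from insert.IH[OF this, of a'] obtain c where c: "\<exists>i<k'. c i \<noteq> 0" "\<forall>j\<in>B. (\<Sum>i<k'. c i * a' i j) = 0" by blast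
    define d where "d i = (if i < k' then c i else - (\<Sum>i<k'. c i * a (s i) b) / a p b)" for i
    have sum: "(\<Sum>i<k. d (s i) * a i j) = (\<Sum>i<k'. c i * a' i j)" for j
    proof -
      have ss: "s (s i) = i" for i by (auto simp: s_def)
      have "(\<Sum>i<k. d (s i) * a i j) = (\<Sum>i<k. d (s (s i)) * a (s i) j)"
        by (rule sum.reindex_bij_betw[OF s, symmetric])
      also have "\<dots> = (\<Sum>i<k. d i * a (s i) j)" by (simp add: ss)
      also have "\<dots> = (\<Sum>i<k'. c i * a (s i) j) + d k' * a p j"
        using sp by (simp add: k k'_def[symmetric] d_def)
      also have "d k' * a p j = - (\<Sum>i<k'. c i * (a (s i) b / a p b * a p j))"
        by (simp add: d_def sum_distrib_right sum_divide_distrib mult.assoc)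
      also have "(\<Sum>i<k'. c i * a (s i) j) + - (\<Sum>i<k'. c i * (a (s i) b / a p b * a p j)) = (\<Sum>i<k'. c i * a' i j)"
        by (simp add: a'_def right_diff_distrib sum_subtractf)
      finally show ?thesis .
    qed
    have "a' i b = 0" for i using p by (simp add: a'_def)
    hence "(\<Sum>i<k. d (s i) * a i j) = 0" if "j \<in> insert b B" for j
      using that c(2) unfolding sum by auto
    moreover obtain i where "i < k'" "c i \<noteq> 0" using c(1) by blast
    hence "s i < k" "d (s (s i)) \<noteq> 0"
      using bij_betw_apply[OF s, of i] k by (auto simp: d_def s_def)
    ultimately show ?thesis by (intro exI[of _ "\<lambda>i. d (s i)"]) blast
  qed
qed

text \<open>
  Symmetry against the Schwartz form \<open>e i\<close> passes to the closure of the Laplacian, since pairing with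
  \<open>e i\<close> is continuous.
\<close>

lemma eigensystem_pairing:
  assumes E: "eigensystem h q I e \<nu>" and u: "u \<in> eigenspace h q l" and i: "i \<in> I" "\<nu> i \<noteq> l"
  shows "ip u (e i) = 0"
proof -
  define v where "v = (\<lambda>J x. of_real l * u J x)"
  obtain \<phi> where \<phi>: "\<forall>k::nat. \<phi> k \<in> schwartz_forms q" "(\<lambda>k. l2_norm (\<lambda>J x. \<phi> k J x - u J x)) \<longlonglongrightarrow> 0"
    "(\<lambda>k. l2_norm (\<lambda>J x. hodge_laplacian (drho h) (\<phi> k) J x - v J x)) \<longlonglongrightarrow> 0" and uv: "u \<in> l2_forms q" "v \<in> l2_forms q"
    using u unfolding eigenspace_def rep_laplacian_def v_def mem_Collect_eq case_prod_conv by blast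
  have ei: "e i \<in> l2_forms q" by (rule schwartz_forms_l2[OF eigensystemD(1)[OF E i(1)]])
  have L: "hodge_laplacian (drho h) (\<phi> k) \<in> l2_forms q"
    "ip (hodge_laplacian (drho h) (\<phi> k)) (e i) = of_real (\<nu> i) * ip (\<phi> k) (e i)" for k
    by (rule eigensystemD(8)[OF E \<phi>(1)[rule_format]], rule eigensystemD(9)[OF E \<phi>(1)[rule_format] i(1)])
  note l2 = l2_forms_l2[OF schwartz_forms_l2[OF \<phi>(1)[rule_format]]] l2_forms_l2[OF uv(1)] l2_forms_l2[OF uv(2)] l2_forms_l2[OF ei] l2_forms_l2[OF L(1)]
  have "(\<lambda>k. ip (\<phi> k) (e i)) \<longlonglongrightarrow> ip u (e i)" by (rule ip_tendsto[OF _ _ _ \<phi>(2)]) (rule l2)+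
  hence "(\<lambda>k. of_real (\<nu> i) * ip (\<phi> k) (e i)) \<longlonglongrightarrow> of_real (\<nu> i) * ip u (e i)" by (intro tendsto_intros)
  moreover have "(\<lambda>k. ip (hodge_laplacian (drho h) (\<phi> k)) (e i)) \<longlonglongrightarrow> ip v (e i)"
    by (rule ip_tendsto[OF _ _ _ \<phi>(3)]) (rule l2)+
  ultimately have "of_real (\<nu> i) * ip u (e i) = ip v (e i)"
    unfolding L(2) using LIMSEQ_unique by blast
  hence "of_real (\<nu> i) * ip u (e i) = of_real l * ip u (e i)" by (simp add: v_def ip_scale_left)
  thus ?thesis using i(2) by simp
qed

lemma eigensystem_eigenspace:
  assumes E: "eigensystem h q I e \<nu>" and i: "i \<in> I"
  shows "e i \<in> eigenspace h q (\<nu> i)"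
proof -
  note S = eigensystemD(1,2)[OF E i]
  show ?thesis unfolding eigenspace_def rep_laplacian_def
    unfolding mem_Collect_eq case_prod_conv
    using S schwartz_forms_l2[OF S(1)] l2_forms_scale[OF schwartz_forms_l2[OF S(1)], of "of_real (\<nu> i)"]
    by (intro conjI exI[of _ "\<lambda>_. e i"] allI) (simp_all add: l2_norm_def)
qed

text \<open>
  By completeness an eigenform of nonzero norm pairs with some \<open>e i\<close> nontrivially, and then its eigenvalue is \<open>\<nu> i\<close>.
\<close>

lemma eigensystem_spectrum:
  assumes E: "eigensystem h q I e \<nu>"
  shows "positive_spectrum h q = \<nu> ` I"
proof
  show "\<nu> ` I \<subseteq> positive_spectrum h q"
    using eigensystem_eigenspace[OF E] eigensystemD(3,4)[OF E] unfolding positive_spectrum_def by auto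
  show "positive_spectrum h q \<subseteq> \<nu> ` I"
  proof
    fix l assume "l \<in> positive_spectrum h q"
    then obtain u where u: "u \<in> eigenspace h q l" "l2_norm u \<noteq> 0" unfolding positive_spectrum_def by blast
    have "\<exists>i\<in>I. ip u (e i) \<noteq> 0" using eigensystemD(6)[OF E eigenspaceD[OF u(1)]] u(2) by auto
    thus "l \<in> \<nu> ` I" using eigensystem_pairing[OF E u(1)] by blast
  qed
qed

text \<open>
  The upper bound holds because an eigenform for \<open>l\<close> is determined, up to null functions, by its pairings
  with the members of the system for \<open>l\<close>: more than that many eigenforms have a combination of norm zero.
  The lower bound is the independence of these members.
\<close>

lemma eigensystem_multiplicity:
  assumes E: "eigensystem h q I e \<nu>"
  shows "multiplicity_of h q l = card {i \<in> I. \<nu> i = l}"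
proof -
  define B where "B = {i \<in> I. \<nu> i = l}"
  have B: "finite B" unfolding B_def by (rule eigensystemD(7)[OF E])
  define K where "K = {k. \<exists>b :: nat \<Rightarrow> real form. (\<forall>i<k. b i \<in> eigenspace h q l) \<and>
     (\<forall>c :: nat \<Rightarrow> complex. l2_norm (\<lambda>J x. \<Sum>i<k. c i * b i J x) = 0 \<longrightarrow> (\<forall>i<k. c i = 0))}"
  have le: "k \<le> card B" if k: "k \<in> K" for k
  proof (rule ccontr)
    assume "\<not> k \<le> card B"
    hence kB: "card B < k" by simp
    obtain b where b': "\<forall>i<k. b i \<in> eigenspace h q l"
      "\<forall>c :: nat \<Rightarrow> complex. l2_norm (\<lambda>J x. \<Sum>i<k. c i * b i J x) = 0 \<longrightarrow> (\<forall>i<k. c i = 0)"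
      using k unfolding K_def mem_Collect_eq by blast
    note b = b'[rule_format]
    have bl: "b i \<in> l2_forms q" if "i < k" for i by (rule eigenspaceD[OF b(1)[OF that]])
    obtain c where c: "\<exists>i<k. c i \<noteq> 0" "\<forall>j\<in>B. (\<Sum>i<k. c i * ip (b i) (e j)) = 0"
      using nontrivial_kernel[OF B kB, of "\<lambda>i j. ip (b i) (e j)"] by blast
    have "ip (\<lambda>J x. \<Sum>i<k. c i * b i J x) (e j) = 0" if j: "j \<in> I" for j
    proof -
      have "e j \<in> l2_forms q" by (rule schwartz_forms_l2[OF eigensystemD(1)[OF E j]])
      hence "ip (\<lambda>J x. \<Sum>i<k. c i * b i J x) (e j) = (\<Sum>i<k. c i * ip (b i) (e j))"
        using bl by (intro ip_sum_left) auto
      also have "\<dots> = 0"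
      proof (cases "j \<in> B")
        case False
        hence "ip (b i) (e j) = 0" if "i < k" for i
          using eigensystem_pairing[OF E b(1)[OF that] j] j by (auto simp: B_def)
        thus ?thesis by simp
      qed (use c in auto)
      finally show ?thesis .
    qed
    moreover have "(\<lambda>J x. \<Sum>i<k. c i * b i J x) \<in> l2_forms q" by (rule l2_forms_sum[OF bl])
    ultimately have "l2_norm (\<lambda>J x. \<Sum>i<k. c i * b i J x) = 0" by (intro eigensystemD(6)[OF E])
    thus False using b'(2) c(1) by blast
  qed
  have "card B \<in> K"
  proof -
    obtain g where g: "bij_betw g {..<card B} B" using ex_bij_betw_nat_finite[OF B] by (auto simp: atLeast0LessThan)
    have gB: "g i \<in> B" if "i < card B" for i using bij_betw_apply[OF g] that by auto
    have gl: "e (g i) \<in> l2_forms q" if "i < card B" for i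
      using gB[OF that] by (intro schwartz_forms_l2 eigensystemD(1)[OF E]) (simp add: B_def)
    have "\<forall>i<card B. c i = 0" if c: "l2_norm (\<lambda>J x. \<Sum>i<card B. c i * e (g i) J x) = 0" for c :: "nat \<Rightarrow> complex"
    proof (intro allI impI)
      fix j assume j: "j < card B"
      define w where "w = (\<lambda>J x. \<Sum>i<card B. c i * e (g i) J x)"
      have wl: "w \<in> l2_forms q" unfolding w_def by (rule l2_forms_sum[OF gl])
      have "ip w (e (g j)) = (\<Sum>i<card B. c i * ip (e (g i)) (e (g j)))"
        unfolding w_def using gl j by (intro ip_sum_left) auto
      also have "\<dots> = (\<Sum>i<card B. if i = j then c j * ip (e (g j)) (e (g j)) else 0)"
      proof (intro sum.cong refl)
        fix i assume i: "i \<in> {..<card B}"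
        have "ip (e (g i)) (e (g j)) = 0" if "i \<noteq> j"
        proof -
          have "g i \<noteq> g j" using g i j that unfolding bij_betw_def inj_on_def by auto
          thus ?thesis using gB[of i] gB[OF j] i by (intro eigensystemD(5)[OF E]) (auto simp: B_def)
        qed
        thus "c i * ip (e (g i)) (e (g j)) = (if i = j then c j * ip (e (g j)) (e (g j)) else 0)" by auto
      qed
      also have "\<dots> = c j * ip (e (g j)) (e (g j))" using j by simp
      finally have 1: "ip w (e (g j)) = c j * ip (e (g j)) (e (g j))" .
      have "cmod (ip w (e (g j))) \<le> 0"
      proof (rule field_le_epsilon)
        fix d :: real assume d: "d > 0"
        define n where "n = (l2_norm (e (g j)))\<^sup>2"
        have n: "n \<ge> 0" by (simp add: n_def)
        have "cmod (ip w (e (g j))) \<le> (l2_norm w)\<^sup>2 / (d / (n + 1)) + (d / (n + 1)) * (l2_norm (e (g j)))\<^sup>2"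
          using d n by (intro ip_bound l2_forms_l2[OF wl] l2_forms_l2[OF gl[OF j]]) auto
        also have "\<dots> = d * (n / (n + 1))" using c by (simp add: w_def n_def)
        also have "\<dots> \<le> d * 1" using d n by (intro mult_left_mono) auto
        finally show "cmod (ip w (e (g j))) \<le> 0 + d" by simp
      qed
      hence "c j * ip (e (g j)) (e (g j)) = 0" using 1 by simp
      moreover have "ip (e (g j)) (e (g j)) \<noteq> 0" using eigensystemD(3)[OF E] gB[OF j] unfolding B_def ip_eq_0_iff by auto
      ultimately show "c j = 0" by simp
    qed
    moreover have "\<forall>i<card B. e (g i) \<in> eigenspace h q l"
      using eigensystem_eigenspace[OF E] gB by (auto simp: B_def)
    ultimately show ?thesis unfolding K_def mem_Collect_eq by (intro exI[of _ "\<lambda>i. e (g i)"] conjI allI impI) simp_all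
  qed
  hence "Sup K = card B" using le by (intro cSup_eq_maximum) auto
  thus ?thesis unfolding multiplicity_of_def K_def B_def .
qed

text \<open>
  The sum over the system, grouped by eigenvalues.
\<close>

lemma eigensystem_zeta:
  fixes \<nu> :: "'a \<Rightarrow> real" and s :: complex
  assumes E: "eigensystem h q I e \<nu>" and s: "((\<lambda>i. of_real (\<nu> i) powr (- s)) has_sum S) I"
  shows "(\<Sum>\<^sub>\<infinity>l\<in>positive_spectrum h q. of_nat (multiplicity_of h q l) * of_real l powr (- s)) = S"
proof -
  have fin: "finite {i \<in> I. \<nu> i = l}" for l by (rule eigensystemD(7)[OF E])
  have "bij_betw (\<lambda>i. (\<nu> i, i)) I (SIGMA l:\<nu> ` I. {i \<in> I. \<nu> i = l})"
    by (rule bij_betwI[of _ _ _ snd]) auto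
  moreover define g where "g = (\<lambda>p :: real \<times> 'a. of_real (fst p) powr (- s) :: complex)"
  ultimately have "(g has_sum S) (SIGMA l:\<nu> ` I. {i \<in> I. \<nu> i = l})"
    using s has_sum_reindex_bij_betw[of "\<lambda>i. (\<nu> i, i)" I _ g S] by simp
  moreover have "((\<lambda>i. g (l, i)) has_sum (of_nat (card {i \<in> I. \<nu> i = l}) * of_real l powr (- s))) {i \<in> I. \<nu> i = l}" for l
    using has_sum_finite[OF fin[of l], of "\<lambda>_. of_real l powr (- s) :: complex"] by (simp add: g_def)
  ultimately have "((\<lambda>l. of_nat (card {i \<in> I. \<nu> i = l}) * of_real l powr (- s)) has_sum S) (\<nu> ` I)"
    by (rule has_sum_SigmaD)
  from infsumI[OF this] show ?thesis
    unfolding eigensystem_spectrum[OF E] eigensystem_multiplicity[OF E] .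
qed

section \<open>Functions and one-forms\<close>

lemma subset_cases:
  assumes "J \<subseteq> {1, 2, 3 :: nat}"
  shows "J = {} \<or> J = {1} \<or> J = {2} \<or> J = {3} \<or> J = {1, 2} \<or> J = {1, 3} \<or> J = {2, 3} \<or> J = {1, 2, 3}"
proof -
  have "J \<in> Pow {1, 2, 3}" using assms by simp
  also have "Pow {1, 2, 3 :: nat} = {{}, {1}, {2}, {3}, {1, 2}, {1, 3}, {2, 3}, {1, 2, 3}}"
    by (auto simp: Pow_insert)
  finally show ?thesis by simp
qed

lemma sum_Pow3:
  fixes f :: "nat set \<Rightarrow> complex"
  shows "(\<Sum>J\<in>Pow {1, 2, 3}. f J) = f {} + f {1} + f {2} + f {3} + f {1, 2} + f {1, 3} + f {2, 3} + f {1, 2, 3}"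
proof -
  have "{2, 3 :: nat} \<noteq> {Suc 0, 2, 3}"
  proof
    assume eq: "{2, 3 :: nat} = {Suc 0, 2, 3}"
    have "Suc 0 \<in> {Suc 0, 2, 3}" by simp
    thus False unfolding eq[symmetric] by simp
  qed
  hence "distinct [{}, {1}, {2}, {3}, {1, 2}, {1, 3}, {2, 3}, {1, 2, 3 :: nat}]" by auto
  moreover have "Pow {1, 2, 3 :: nat} = set [{}, {1}, {2}, {3}, {1, 2}, {1, 3}, {2, 3}, {1, 2, 3 :: nat}]"
    by (auto simp: Pow_insert)
  ultimately have "(\<Sum>J\<in>Pow {1, 2, 3}. f J) = sum_list (map f [{}, {1}, {2}, {3}, {1, 2}, {1, 3}, {2, 3}, {1, 2, 3 :: nat}])"
    by (simp only: sum.distinct_set_conv_list)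
  thus ?thesis by (simp add: add_ac del: One_nat_def)
qed

lemma drho_zero: "i \<in> {1, 2, 3} \<Longrightarrow> drho h i (\<lambda>_. 0) = (\<lambda>_. 0)"
  using drho_cmult[OF schwartz_0, of i h 0] by simp

lemma oscillator_zero: "oscillator h (\<lambda>_. 0) = (\<lambda>_. 0)"
proof -
  have "drho h 1 (\<lambda>_. 0) = (\<lambda>_. 0)" "drho h 2 (\<lambda>_. 0) = (\<lambda>_. 0)" "drho h 3 (\<lambda>_. 0) = (\<lambda>_. 0)"
    by (rule drho_zero; simp)+
  thus ?thesis unfolding oscillator_def by simp
qed

lemma hodge_laplacian_outside: "\<not> J \<subseteq> {1, 2, 3} \<Longrightarrow> hodge_laplacian E u J = (\<lambda>_. 0)"
  by (auto simp: hodge_laplacian_def ext_d_def codiff_def hodge_star_def fun_eq_iff)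

lemma hodge_star_outside: "\<not> J \<subseteq> {1, 2, 3} \<Longrightarrow> hodge_star u J = (\<lambda>_. 0)"
  by (auto simp: hodge_star_def fun_eq_iff)

definition form0 :: "(real \<Rightarrow> complex) \<Rightarrow> real form" where
  "form0 f J = (if J = {} then f else (\<lambda>_. 0))"

lemma degree0_iff: "J \<subseteq> {1, 2, 3 :: nat} \<and> card J = 0 \<longleftrightarrow> J = {}"
  using finite_subset[of J "{1, 2, 3}"] by auto

lemma form0_schwartz: "f \<in> schwartz \<Longrightarrow> form0 f \<in> schwartz_forms 0"
  unfolding schwartz_forms_def degree0_iff by (simp add: form0_def)

lemma schwartz_form0_eq: "u \<in> schwartz_forms 0 \<Longrightarrow> u = form0 (u {})"
  unfolding schwartz_forms_def degree0_iff by (auto simp: form0_def fun_eq_iff)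

lemma l2_form0_eq: "u \<in> l2_forms 0 \<Longrightarrow> u = form0 (u {})"
  unfolding l2_forms_def degree0_iff by (auto simp: form0_def fun_eq_iff)

lemma form0_laplacian:
  assumes f: "f \<in> schwartz"
  shows "hodge_laplacian (drho h) (form0 f) = form0 (oscillator h f)"
proof
  fix J
  have S: "form0 f K \<in> schwartz" for K using f by (simp add: form0_def)
  have Z: "drho h 1 (\<lambda>_. 0) = (\<lambda>_. 0)" "drho h 2 (\<lambda>_. 0) = (\<lambda>_. 0)" "drho h 3 (\<lambda>_. 0) = (\<lambda>_. 0)"
    by (rule drho_zero; simp)+
  have e: "form0 f {} = f" "form0 f {1} = (\<lambda>_. 0)" "form0 f {2} = (\<lambda>_. 0)" "form0 f {3} = (\<lambda>_. 0)" "form0 f {1, 2} = (\<lambda>_. 0)"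
    "form0 f {1, 3} = (\<lambda>_. 0)" "form0 f {2, 3} = (\<lambda>_. 0)" "form0 f {1, 2, 3} = (\<lambda>_. 0)"
    by (simp_all add: form0_def)
  show "hodge_laplacian (drho h) (form0 f) J = form0 (oscillator h f) J"
  proof (cases "J \<subseteq> {1, 2, 3}")
    case True
    from subset_cases[OF this] show ?thesis
      by (elim disjE; hypsubst; simp only: hodge_laplacian_table[OF S] e Z oscillator_zero; simp add: form0_def)
  next
    case False thus ?thesis by (auto simp: hodge_laplacian_outside form0_def)
  qed
qed

lemma ip_form0: "ip (form0 f) (form0 g) = ip1 f g"
proof -
  have "ip1 (\<lambda>_. 0) (\<lambda>_. 0) = 0" by (simp add: ip1_def)
  thus ?thesis unfolding ip_def sum_Pow3 by (simp add: form0_def)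
qed

lemma ip1_self: "ip1 f f = of_real (LBINT x. (cmod (f x))\<^sup>2)"
  unfolding ip1_def complex_norm_square[symmetric] by (simp flip: of_real_power)

lemma eigensystem_functions:
  assumes h: "h \<noteq> 0"
  shows "eigensystem h 0 UNIV (\<lambda>n. form0 (herm h n)) (osc (tau h))"
  unfolding eigensystem_def
proof (intro conjI ballI allI impI)
  note S = herm_schwartz[OF h]
  show "form0 (herm h n) \<in> schwartz_forms 0" for n by (intro form0_schwartz S)
  show L: "hodge_laplacian (drho h) (form0 (herm h n)) = (\<lambda>J x. of_real (osc (tau h) n) * form0 (herm h n) J x)" for n
    unfolding form0_laplacian[OF S] oscillator_herm[OF h] by (auto simp: form0_def fun_eq_iff)
  show "l2_norm (form0 (herm h n)) \<noteq> 0" for n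
    unfolding ip_eq_0_iff[symmetric] ip_form0 by (rule herm_norm[OF h])
  show "osc (tau h) n > 0" for n by (rule osc_pos(2)[OF tau_pos[OF h]])
  show "ip (form0 (herm h n)) (form0 (herm h m)) = 0" if "n \<noteq> m" for n m
    unfolding ip_form0 by (rule herm_orthogonal[OF h that])
  show "l2_norm u = 0" if u: "u \<in> l2_forms 0" and o: "\<forall>n\<in>UNIV. ip u (form0 (herm h n)) = 0" for u
  proof -
    have "ip1 (u {}) (herm h n) = 0" for n using o l2_form0_eq[OF u] ip_form0 by (metis UNIV_I)
    hence "(LBINT x. (cmod (u {} x))\<^sup>2) = 0" by (intro herm_complete[OF h] l2_forms_l2[OF u])
    hence "ip1 (u {}) (u {}) = 0" unfolding ip1_self by simp
    hence "ip u u = 0" using l2_form0_eq[OF u] ip_form0 by metis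
    thus ?thesis by (simp add: ip_eq_0_iff)
  qed
  show "finite {n \<in> UNIV. osc (tau h) n = l}" for l
    using finite_vimageI[OF _ osc_inj[OF tau_pos[OF h]], of "{l}"] by (simp add: vimage_def)
  fix \<phi> assume \<phi>: "\<phi> \<in> schwartz_forms 0"
  define f where "f = \<phi> {}"
  have f: "f \<in> schwartz" "\<phi> = form0 f" using schwartz_forms_schwartz[OF \<phi>] schwartz_form0_eq[OF \<phi>] by (auto simp: f_def)
  show "hodge_laplacian (drho h) \<phi> \<in> l2_forms 0"
    unfolding f(2) form0_laplacian[OF f(1)] by (intro schwartz_forms_l2 form0_schwartz oscillator_schwartz f)
  show "ip (hodge_laplacian (drho h) \<phi>) (form0 (herm h n)) = of_real (osc (tau h) n) * ip \<phi> (form0 (herm h n))" for n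
    unfolding f(2) form0_laplacian[OF f(1)] ip_form0 oscillator_symmetric[OF f(1) S] oscillator_herm[OF h] ip1_cmult_right by simp
qed

definition form1 :: "(real \<Rightarrow> complex) \<Rightarrow> (real \<Rightarrow> complex) \<Rightarrow> (real \<Rightarrow> complex) \<Rightarrow> real form" where
  "form1 f g k J = (if J = {1} then f else if J = {2} then g else if J = {3} then k else (\<lambda>_. 0))"

lemma degree1_iff: "J \<subseteq> {1, 2, 3 :: nat} \<and> card J = 1 \<longleftrightarrow> J = {1} \<or> J = {2} \<or> J = {3}"
  by (auto simp: card_1_singleton_iff)

lemma form1_simps: "form1 f g k {1} = f" "form1 f g k {2} = g" "form1 f g k {3} = k" "form1 f g k {} = (\<lambda>_. 0)"
  "form1 f g k {1, 2} = (\<lambda>_. 0)" "form1 f g k {1, 3} = (\<lambda>_. 0)" "form1 f g k {2, 3} = (\<lambda>_. 0)" "form1 f g k {1, 2, 3} = (\<lambda>_. 0)"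
proof -
  have d: "{2::nat} \<noteq> {1}" "{3::nat} \<noteq> {1}" "{3::nat} \<noteq> {2}" "{1::nat, 2} \<noteq> {1}" "{1::nat, 2} \<noteq> {2}" "{1::nat, 2} \<noteq> {3}"
    "{1::nat, 3} \<noteq> {1}" "{1::nat, 3} \<noteq> {2}" "{1::nat, 3} \<noteq> {3}" "{2::nat, 3} \<noteq> {1}" "{2::nat, 3} \<noteq> {2}" "{2::nat, 3} \<noteq> {3}"
    "{1::nat, 2, 3} \<noteq> {1}" "{1::nat, 2, 3} \<noteq> {2}" "{1::nat, 2, 3} \<noteq> {3}"
    by auto
  show "form1 f g k {1} = f" "form1 f g k {2} = g" "form1 f g k {3} = k" "form1 f g k {} = (\<lambda>_. 0)"
    "form1 f g k {1, 2} = (\<lambda>_. 0)" "form1 f g k {1, 3} = (\<lambda>_. 0)" "form1 f g k {2, 3} = (\<lambda>_. 0)" "form1 f g k {1, 2, 3} = (\<lambda>_. 0)"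
    unfolding form1_def by (simp_all only: d if_True if_False insert_not_empty empty_not_insert refl simp_thms)
qed

lemma form1_schwartz: "f \<in> schwartz \<Longrightarrow> g \<in> schwartz \<Longrightarrow> k \<in> schwartz \<Longrightarrow> form1 f g k \<in> schwartz_forms 1"
  unfolding schwartz_forms_def degree1_iff by (simp add: form1_def)

lemma schwartz_form1_eq: "u \<in> schwartz_forms 1 \<Longrightarrow> u = form1 (u {1}) (u {2}) (u {3})"
  unfolding schwartz_forms_def degree1_iff by (auto simp: form1_def fun_eq_iff)

lemma l2_form1_eq: "u \<in> l2_forms 1 \<Longrightarrow> u = form1 (u {1}) (u {2}) (u {3})"
  unfolding l2_forms_def degree1_iff by (auto simp: form1_def fun_eq_iff)

lemma ip_form1: "ip (form1 f g k) (form1 f' g' k') = ip1 f f' + ip1 g g' + ip1 k k'"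
proof -
  have "ip1 (\<lambda>_. 0) (\<lambda>_. 0) = 0" by (simp add: ip1_def)
  thus ?thesis unfolding ip_def sum_Pow3 form1_simps by simp
qed

lemma form1_laplacian:
  assumes S: "f \<in> schwartz" "g \<in> schwartz" "k \<in> schwartz"
  shows "hodge_laplacian (drho h) (form1 f g k) = form1
    (\<lambda>x. oscillator h f x - drho h 3 g x - drho h 2 k x)
    (\<lambda>x. oscillator h g x + drho h 3 f x + drho h 1 k x)
    (\<lambda>x. oscillator h k x - drho h 1 g x + drho h 2 f x + k x)" (is "_ = ?R")
proof
  fix J
  have S: "form1 f g k K \<in> schwartz" for K using S by (simp add: form1_def)
  have Z: "drho h 1 (\<lambda>_. 0) = (\<lambda>_. 0)" "drho h 2 (\<lambda>_. 0) = (\<lambda>_. 0)" "drho h 3 (\<lambda>_. 0) = (\<lambda>_. 0)"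
    by (rule drho_zero; simp)+
  show "hodge_laplacian (drho h) (form1 f g k) J = ?R J"
  proof (cases "J \<subseteq> {1, 2, 3}")
    case True
    from subset_cases[OF this] show ?thesis
      by (elim disjE; hypsubst; simp only: hodge_laplacian_table[OF S] form1_simps Z oscillator_zero; simp)
  next
    case False thus ?thesis by (auto simp: hodge_laplacian_outside form1_def)
  qed
qed

text \<open>
  The terms of first order in the components form a formally symmetric matrix of differential operators, as X, Y and T are skew.
\<close>

lemma form1_laplacian_symmetric:
  assumes f: "f1 \<in> schwartz" "f2 \<in> schwartz" "f3 \<in> schwartz" and g: "g1 \<in> schwartz" "g2 \<in> schwartz" "g3 \<in> schwartz"
  shows "ip (hodge_laplacian (drho h) (form1 f1 f2 f3)) (form1 g1 g2 g3) = ip (form1 f1 f2 f3) (hodge_laplacian (drho h) (form1 g1 g2 g3))"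
proof -
  have sk: "ip1 (drho h 1 a) b = - ip1 a (drho h 1 b)" "ip1 (drho h 2 a) b = - ip1 a (drho h 2 b)" "ip1 (drho h 3 a) b = - ip1 a (drho h 3 b)"
    if "a \<in> schwartz" "b \<in> schwartz" for a b
    using drho_skew[OF that] by auto
  have l: "a \<in> l2" "oscillator h a \<in> l2" "drho h 1 a \<in> l2" "drho h 2 a \<in> l2" "drho h 3 a \<in> l2" if "a \<in> schwartz" for a
    using that by (auto intro!: schwartz_l2 oscillator_schwartz drho_schwartz)
  note L = l[OF f(1)] l[OF f(2)] l[OF f(3)] l[OF g(1)] l[OF g(2)] l[OF g(3)]
  show ?thesis
    unfolding form1_laplacian[OF f] form1_laplacian[OF g] ip_form1
    by (simp only: ip1_add_left ip1_add_right ip1_diff_left ip1_diff_right l2_add l2_diff L sk f g oscillator_symmetric) simp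
qed

text \<open>
  With \<open>\<epsilon> = sgn h\<close>, the one-form for which \<open>u\<^sub>1 + i \<epsilon> u\<^sub>2\<close>, \<open>u\<^sub>1 - i \<epsilon> u\<^sub>2\<close> and
  \<open>\<epsilon> u\<^sub>3\<close> are \<open>P\<close>, \<open>Q\<close> and \<open>R\<close>.  In these coordinates the Laplacian is expressed by the ladder
  operators, by the same formulas for both signs of \<open>h\<close>.
\<close>

definition helical :: "real \<Rightarrow> (real \<Rightarrow> complex) \<Rightarrow> (real \<Rightarrow> complex) \<Rightarrow> (real \<Rightarrow> complex) \<Rightarrow> real form" where
  "helical h P Q R = form1 (\<lambda>x. (1/2) * (P x + Q x)) (\<lambda>x. (- \<i> * of_real (sgn h) / 2) * (P x - Q x)) (\<lambda>x. of_real (sgn h) * R x)"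

lemma oscillator_cmult: "f \<in> schwartz \<Longrightarrow> oscillator h (\<lambda>x. c * f x) = (\<lambda>x. c * oscillator h f x)"
proof -
  assume f: "f \<in> schwartz"
  have "drho h i (drho h i (\<lambda>x. c * f x)) = (\<lambda>x. c * drho h i (drho h i f) x)" if "i \<in> {1, 2, 3}" for i
    using f that drho_schwartz[OF f that] by (simp only: drho_cmult)
  hence "drho h 1 (drho h 1 (\<lambda>x. c * f x)) = (\<lambda>x. c * drho h 1 (drho h 1 f) x)"
    "drho h 2 (drho h 2 (\<lambda>x. c * f x)) = (\<lambda>x. c * drho h 2 (drho h 2 f) x)"
    "drho h 3 (drho h 3 (\<lambda>x. c * f x)) = (\<lambda>x. c * drho h 3 (drho h 3 f) x)" by blast+
  thus ?thesis unfolding oscillator_def by (simp add: fun_eq_iff algebra_simps del: One_nat_def)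
qed

lemma oscillator_add: "f \<in> schwartz \<Longrightarrow> g \<in> schwartz \<Longrightarrow> oscillator h (\<lambda>x. f x + g x) = (\<lambda>x. oscillator h f x + oscillator h g x)"
proof -
  assume f: "f \<in> schwartz" "g \<in> schwartz"
  have "drho h i (drho h i (\<lambda>x. f x + g x)) = (\<lambda>x. drho h i (drho h i f) x + drho h i (drho h i g) x)" if "i \<in> {1, 2, 3}" for i
    using f that drho_schwartz[OF f(1) that] drho_schwartz[OF f(2) that] by (simp only: drho_add)
  hence "drho h 1 (drho h 1 (\<lambda>x. f x + g x)) = (\<lambda>x. drho h 1 (drho h 1 f) x + drho h 1 (drho h 1 g) x)"
    "drho h 2 (drho h 2 (\<lambda>x. f x + g x)) = (\<lambda>x. drho h 2 (drho h 2 f) x + drho h 2 (drho h 2 g) x)"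
    "drho h 3 (drho h 3 (\<lambda>x. f x + g x)) = (\<lambda>x. drho h 3 (drho h 3 f) x + drho h 3 (drho h 3 g) x)" by blast+
  thus ?thesis unfolding oscillator_def by (simp add: fun_eq_iff algebra_simps del: One_nat_def)
qed

lemma helical_laplacian:
  assumes h: "h \<noteq> 0" and S: "P \<in> schwartz" "Q \<in> schwartz" "R \<in> schwartz"
  shows "hodge_laplacian (drho h) (helical h P Q R) = helical h
     (\<lambda>x. oscillator h P x - of_real (tau h) * P x + \<i> * raise h R x)
     (\<lambda>x. oscillator h Q x + of_real (tau h) * Q x - \<i> * lower h R x)
     (\<lambda>x. oscillator h R x + R x + (raise h Q x - lower h P x) / (2 * \<i>))"
proof -
  define e :: complex where "e = of_real (sgn h)"
  have e: "e * e = 1" "e * (e * z) = z" for z using sgn_sq[OF h] by (auto simp: e_def simp flip: mult.assoc)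
  have pq: "(\<lambda>x. P x + Q x) \<in> schwartz" "(\<lambda>x. P x - Q x) \<in> schwartz" using S by auto
  have c: "(\<lambda>x. a * f x) \<in> schwartz" if "f \<in> schwartz" for f a using that by auto
  have D: "drho h i (\<lambda>x. a * (P x + Q x)) = (\<lambda>x. a * (drho h i P x + drho h i Q x))"
    "drho h i (\<lambda>x. a * (P x - Q x)) = (\<lambda>x. a * (drho h i P x - drho h i Q x))"
    "drho h i (\<lambda>x. a * R x) = (\<lambda>x. a * drho h i R x)" if "i \<in> {1, 2, 3}" for a i
    using that S pq by (simp_all only: drho_cmult drho_add drho_diff)
  have "oscillator h (\<lambda>x. P x + - 1 * Q x) = (\<lambda>x. oscillator h P x + - 1 * oscillator h Q x)"
    using S by (simp only: oscillator_add c oscillator_cmult)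
  hence om: "oscillator h (\<lambda>x. P x - Q x) = (\<lambda>x. oscillator h P x - oscillator h Q x)" by simp
  have O: "oscillator h (\<lambda>x. a * (P x + Q x)) = (\<lambda>x. a * (oscillator h P x + oscillator h Q x))"
    "oscillator h (\<lambda>x. a * (P x - Q x)) = (\<lambda>x. a * (oscillator h P x - oscillator h Q x))"
    "oscillator h (\<lambda>x. a * R x) = (\<lambda>x. a * oscillator h R x)" for a
    using S pq by (simp_all only: oscillator_cmult oscillator_add om)
  have T: "drho h 3 f x = \<i> * e * of_real (tau h) * f x" for f x unfolding e_def by (rule drho_T_tau)
  have D': "drho h 1 (\<lambda>x. a * (P x - Q x)) = (\<lambda>x. a * (drho h 1 P x - drho h 1 Q x))"
    "drho h 2 (\<lambda>x. a * (P x + Q x)) = (\<lambda>x. a * (drho h 2 P x + drho h 2 Q x))"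
    "drho h 1 (\<lambda>x. a * R x) = (\<lambda>x. a * drho h 1 R x)" "drho h 2 (\<lambda>x. a * R x) = (\<lambda>x. a * drho h 2 R x)" for a
    using D[of 1 a] D[of 2 a] by auto
  have s1: "(\<lambda>x. 1 / 2 * (P x + Q x)) \<in> schwartz" "(\<lambda>x. - \<i> * e / 2 * (P x - Q x)) \<in> schwartz" "(\<lambda>x. e * R x) \<in> schwartz"
    by (intro c pq S)+
  show ?thesis
    unfolding helical_def e_def[symmetric] form1_laplacian[OF s1] O D' T raise_def lower_def
    by (intro arg_cong3[where f = form1] ext) (simp_all add: field_simps e del: One_nat_def)
qed

section \<open>Eigenforms of degree one\<close>

lemma osc_Suc: "osc \<tau> (Suc k) = osc \<tau> k + 2 * \<tau>"
  by (simp add: osc_def algebra_simps)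

text \<open>
  The eigenvalues of \<open>* d\<close> on a block of Hermite forms: 0, and the roots of \<open>m\<^sup>2 + m = osc (tau h) k\<close>.
\<close>

definition curl_eigenvalue :: "real \<Rightarrow> nat \<Rightarrow> nat \<Rightarrow> real" where
  "curl_eigenvalue h k j = (if j = 0 then 0 else if j = 1 then sqrt (osc (tau h) k + 1/4) - 1/2 else - sqrt (osc (tau h) k + 1/4) - 1/2)"

lemma curl_eigenvalue_cubic:
  assumes "h \<noteq> 0"
  shows "curl_eigenvalue h k j * ((curl_eigenvalue h k j)\<^sup>2 + curl_eigenvalue h k j - osc (tau h) k) = 0"
  using osc_pos(2)[OF tau_pos[OF assms], of k]
  by (simp add: curl_eigenvalue_def power2_eq_square algebra_simps)

text \<open>
  The eigenform of \<open>* d\<close> for the eigenvalue \<open>m\<close> in the span of \<open>herm h (Suc k)\<close> in \<open>P\<close>,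
  \<open>herm h (k - 1)\<close> in \<open>Q\<close> and \<open>herm h k\<close> in \<open>R\<close>.  For \<open>k = 0\<close> and \<open>j = 1\<close> one has \<open>m = \<tau>\<close>,
  and the general formula gives the zero form.  Its place is taken by the form with \<open>P = herm h 0\<close>,
  which occurs in no other block and on which \<open>* d\<close> is \<open>- \<tau>\<close>; its Laplace eigenvalue is \<open>m\<^sup>2\<close> as well.
\<close>

definition curl_form :: "real \<Rightarrow> nat \<times> nat \<Rightarrow> real form" where
  "curl_form h = (\<lambda>(k, j). if k = 0 \<and> j = 1 then helical h (herm h 0) (\<lambda>_. 0) (\<lambda>_. 0)
     else let m = curl_eigenvalue h k j; t = tau h in helical h
       (\<lambda>x. (- \<i> * of_real (m - t)) * herm h (Suc k) x)
       (\<lambda>x. (- \<i> * of_real (2 * real k * t * (m + t))) * herm h (k - 1) x)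
       (\<lambda>x. of_real (m\<^sup>2 - t\<^sup>2) * herm h k x))"

text \<open>
  By \<open>curl_eigenvalue_cubic\<close> this is \<open>m\<^sup>2\<close> for \<open>m \<noteq> 0\<close>, and \<open>osc (tau h) k\<close> for \<open>m = 0\<close>.
\<close>

definition curl_value :: "real \<Rightarrow> nat \<times> nat \<Rightarrow> real" where
  "curl_value h = (\<lambda>(k, j). osc (tau h) k - curl_eigenvalue h k j)"

lemma helical_scale: "(\<lambda>J x. c * helical h P Q R J x) = helical h (\<lambda>x. c * P x) (\<lambda>x. c * Q x) (\<lambda>x. c * R x)"
  by (auto simp: helical_def form1_def fun_eq_iff algebra_simps)

text \<open>
  On a block the eigenvalue equation becomes that of a matrix of size three; for \<open>k = 0\<close> there is no
  second basis form and its coefficient is zero.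
\<close>

lemma helical_block:
  assumes h: "h \<noteq> 0" and q: "k = 0 \<Longrightarrow> q = 0"
    and P: "(of_real (osc (tau h) k + tau h)) * p + \<i> * r = of_real l * p"
    and Q: "(of_real (osc (tau h) k - tau h)) * q + 2 * \<i> * of_real (real k * tau h) * r = of_real l * q"
    and R: "of_real (osc (tau h) k + 1) * r + (q + 2 * of_real (real (Suc k) * tau h) * p) / (2 * \<i>) = of_real l * r"
  shows "hodge_laplacian (drho h) (helical h (\<lambda>x. p * herm h (Suc k) x) (\<lambda>x. q * herm h (k - 1) x) (\<lambda>x. r * herm h k x))
    = (\<lambda>J x. of_real l * helical h (\<lambda>x. p * herm h (Suc k) x) (\<lambda>x. q * herm h (k - 1) x) (\<lambda>x. r * herm h k x) J x)"
proof -
  note S = herm_schwartz[OF h]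
  have low: "lower h (\<lambda>x. c * herm h n x) = (\<lambda>x. - (c * of_real (2 * real n * tau h)) * herm h (n - 1) x)" for c n
  proof -
    have "lower h (\<lambda>x. c * herm h n x) = (\<lambda>x. c * lower h (herm h n) x)"
      using S by (simp add: lower_def drho_cmult algebra_simps fun_eq_iff)
    thus ?thesis unfolding lower_herm[OF h] by (simp add: fun_eq_iff)
  qed
  have rai: "raise h (\<lambda>x. c * herm h n x) = (\<lambda>x. c * herm h (Suc n) x)" for c n
    using raise_cmult[OF S] by simp
  have os: "oscillator h (\<lambda>x. c * herm h n x) x = c * (of_real (osc (tau h) n) * herm h n x)" for c n x
    unfolding oscillator_cmult[OF S] oscillator_herm[OF h] ..
  have 1: "oscillator h (\<lambda>x. p * herm h (Suc k) x) x - of_real (tau h) * (p * herm h (Suc k) x) + \<i> * raise h (\<lambda>x. r * herm h k x) x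
     = of_real l * (p * herm h (Suc k) x)" for x
  proof -
    have "oscillator h (\<lambda>x. p * herm h (Suc k) x) x - of_real (tau h) * (p * herm h (Suc k) x) + \<i> * raise h (\<lambda>x. r * herm h k x) x
      = ((of_real (osc (tau h) k + tau h)) * p + \<i> * r) * herm h (Suc k) x"
      unfolding os rai osc_Suc by (simp add: algebra_simps del: herm.simps)
    thus ?thesis unfolding P by simp
  qed
  have 2: "oscillator h (\<lambda>x. q * herm h (k - 1) x) x + of_real (tau h) * (q * herm h (k - 1) x) - \<i> * lower h (\<lambda>x. r * herm h k x) x
     = of_real l * (q * herm h (k - 1) x)" for x
  proof (cases k)
    case 0
    thus ?thesis unfolding os low using q by (simp del: herm.simps)
  next
    case (Suc m)
    have lm: "osc (tau h) m = osc (tau h) k - 2 * tau h" using osc_Suc[of "tau h" m] Suc by simp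
    have "oscillator h (\<lambda>x. q * herm h m x) x + of_real (tau h) * (q * herm h m x) - \<i> * lower h (\<lambda>x. r * herm h k x) x
      = ((of_real (osc (tau h) k - tau h)) * q + 2 * \<i> * of_real (real k * tau h) * r) * herm h m x"
      unfolding os low lm by (simp add: Suc algebra_simps del: herm.simps)
    thus ?thesis unfolding Q by (simp add: Suc del: herm.simps)
  qed
  have 3: "oscillator h (\<lambda>x. r * herm h k x) x + r * herm h k x + (raise h (\<lambda>x. q * herm h (k - 1) x) x - lower h (\<lambda>x. p * herm h (Suc k) x) x) / (2 * \<i>)
     = of_real l * (r * herm h k x)" for x
  proof -
    have "q * herm h (Suc (k - 1)) x = q * herm h k x" using q by (cases k) (simp_all del: herm.simps)
    hence "oscillator h (\<lambda>x. r * herm h k x) x + r * herm h k x + (raise h (\<lambda>x. q * herm h (k - 1) x) x - lower h (\<lambda>x. p * herm h (Suc k) x) x) / (2 * \<i>)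
      = (of_real (osc (tau h) k + 1) * r + (q + 2 * of_real (real (Suc k) * tau h) * p) / (2 * \<i>)) * herm h k x"
      unfolding os rai low by (simp add: field_simps del: herm.simps)
    thus ?thesis unfolding R by simp
  qed
  have s: "(\<lambda>x. c * herm h n x) \<in> schwartz" for c n by (intro schwartz_cmult S)
  show ?thesis
    unfolding helical_laplacian[OF h s s s] helical_scale 1 2 3 ..
qed

lemma curl_form_eigen:
  assumes h: "h \<noteq> 0"
  shows "hodge_laplacian (drho h) (curl_form h i) = (\<lambda>J x. of_real (curl_value h i) * curl_form h i J x)"
proof -
  obtain k j where i: "i = (k, j)" by (cases i)
  define m where "m = curl_eigenvalue h k j"
  define t where "t = tau h"
  show ?thesis
  proof (cases "k = 0 \<and> j = 1")
    case True
    have t: "t > 0" unfolding t_def by (rule tau_pos[OF h])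
    have "osc (tau h) 0 + 1/4 = (t + 1/2)\<^sup>2" by (simp add: osc_def t_def power2_eq_square algebra_simps)
    hence "sqrt (osc (tau h) 0 + 1/4) = t + 1/2" using t by simp
    hence v: "curl_value h i = t\<^sup>2" using True
      by (simp add: i curl_value_def curl_eigenvalue_def osc_def t_def[symmetric] power2_eq_square algebra_simps)
    have z: "oscillator h (\<lambda>_. 0) = (\<lambda>_. 0)" "raise h (\<lambda>_. 0) = (\<lambda>_. 0)" "lower h (\<lambda>_. 0) = (\<lambda>_. 0)"
      using raise_cmult[OF schwartz_0, of h 0] drho_zero[of 1 h] drho_zero[of 2 h] by (auto simp: oscillator_zero lower_def raise_def)
    have l0: "lower h (herm h 0) = (\<lambda>_. 0)" using lower_herm[OF h, of 0] by simp
    have e: "oscillator h (herm h 0) x - of_real (tau h) * herm h 0 x = of_real (t\<^sup>2) * herm h 0 x" for x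
      unfolding oscillator_herm[OF h] by (simp add: osc_def t_def algebra_simps power2_eq_square del: herm.simps)
    have "hodge_laplacian (drho h) (helical h (herm h 0) (\<lambda>_. 0) (\<lambda>_. 0))
       = helical h (\<lambda>x. of_real (t\<^sup>2) * herm h 0 x) (\<lambda>x. of_real (t\<^sup>2) * 0) (\<lambda>x. of_real (t\<^sup>2) * 0)"
      unfolding helical_laplacian[OF h herm_schwartz[OF h] schwartz_0 schwartz_0] z l0
      by (intro arg_cong3[where f = "helical h"] ext) (simp_all add: e del: herm.simps of_real_power)
    thus ?thesis unfolding v helical_scale[symmetric] using True by (simp add: i curl_form_def)
  next
    case False
    have cubic: "m * (m\<^sup>2 + m - osc (tau h) k) = 0" unfolding m_def by (rule curl_eigenvalue_cubic[OF h])
    have lan: "osc (tau h) k = t\<^sup>2 + (2 * real k + 1) * t" by (simp add: osc_def t_def power2_eq_square algebra_simps)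
    define l where "l = osc (tau h) k"
    have v: "curl_value h (k, j) = l - m" by (simp add: curl_value_def m_def l_def)
    have "m * m\<^sup>2 + m * m = m * l" using cubic by (simp add: l_def algebra_simps)
    hence id: "(m + 1) * (m\<^sup>2 - t\<^sup>2) = (2 * real k + 1) * t * m - t\<^sup>2"
      unfolding l_def lan by (simp add: algebra_simps power2_eq_square)
    have R: "(l + 1) * (m\<^sup>2 - t\<^sup>2) - (real k * t * (m + t) + real (Suc k) * t * (m - t)) = (l - m) * (m\<^sup>2 - t\<^sup>2)"
      using id by (simp add: algebra_simps power2_eq_square)
    show ?thesis
      unfolding i v curl_form_def Let_def case_prod_conv if_not_P[OF False] m_def[symmetric] t_def[symmetric]
    proof (rule helical_block[OF h])
      show "of_real (osc (tau h) k + tau h) * (- \<i> * of_real (m - t)) + \<i> * of_real (m\<^sup>2 - t\<^sup>2) = of_real (l - m) * (- \<i> * of_real (m - t))"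
        by (simp add: l_def t_def algebra_simps power2_eq_square)
      show "of_real (osc (tau h) k - tau h) * (- \<i> * of_real (2 * real k * t * (m + t))) + 2 * \<i> * of_real (real k * tau h) * of_real (m\<^sup>2 - t\<^sup>2)
         = of_real (l - m) * (- \<i> * of_real (2 * real k * t * (m + t)))"
        by (simp add: l_def t_def algebra_simps power2_eq_square)
      have "of_real (osc (tau h) k + 1) * of_real (m\<^sup>2 - t\<^sup>2) + (- \<i> * of_real (2 * real k * t * (m + t)) + 2 * of_real (real (Suc k) * tau h) * (- \<i> * of_real (m - t))) / (2 * \<i>)
         = of_real ((l + 1) * (m\<^sup>2 - t\<^sup>2) - (real k * t * (m + t) + real (Suc k) * t * (m - t)))"
        by (simp add: l_def t_def field_simps)
      thus "of_real (osc (tau h) k + 1) * of_real (m\<^sup>2 - t\<^sup>2) + (- \<i> * of_real (2 * real k * t * (m + t)) + 2 * of_real (real (Suc k) * tau h) * (- \<i> * of_real (m - t))) / (2 * \<i>)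
         = of_real (l - m) * of_real (m\<^sup>2 - t\<^sup>2)"
        unfolding R by (simp only: of_real_mult)
    qed simp
  qed
qed

lemma ip_helical:
  assumes h: "h \<noteq> 0" and l: "f1 \<in> l2" "f2 \<in> l2" "f3 \<in> l2" "P \<in> l2" "Q \<in> l2" "R \<in> l2"
  shows "ip (form1 f1 f2 f3) (helical h P Q R)
     = (1/2) * ip1 (\<lambda>x. f1 x + (\<i> * of_real (sgn h)) * f2 x) P
     + (1/2) * ip1 (\<lambda>x. f1 x - (\<i> * of_real (sgn h)) * f2 x) Q + ip1 (\<lambda>x. of_real (sgn h) * f3 x) R"
  unfolding helical_def ip_form1
  by (simp only: ip1_add_left ip1_add_right ip1_diff_left ip1_diff_right l2_add l2_diff l2_cmult l ip1_cmult_left ip1_cmult_right)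
     (simp add: field_simps)

lemma ip_helical_helical:
  assumes h: "h \<noteq> 0" and l: "P \<in> l2" "Q \<in> l2" "R \<in> l2" "P' \<in> l2" "Q' \<in> l2" "R' \<in> l2"
  shows "ip (helical h P Q R) (helical h P' Q' R') = (1/2) * ip1 P P' + (1/2) * ip1 Q Q' + ip1 R R'"
proof -
  define e :: complex where "e = of_real (sgn h)"
  have e: "e * e = 1" "e * (e * z) = z" for z using sgn_sq[OF h] by (auto simp: e_def simp flip: mult.assoc)
  have m: "(\<lambda>x. 1 / 2 * (P x + Q x)) \<in> l2" "(\<lambda>x. - \<i> * of_real (sgn h) / 2 * (P x - Q x)) \<in> l2" "(\<lambda>x. of_real (sgn h) * R x) \<in> l2"
    by (intro l2_cmult l2_add l2_diff l)+
  have "(\<lambda>x. 1 / 2 * (P x + Q x) + (\<i> * e) * (- \<i> * e / 2 * (P x - Q x))) = P"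
    "(\<lambda>x. 1 / 2 * (P x + Q x) - (\<i> * e) * (- \<i> * e / 2 * (P x - Q x))) = Q" "(\<lambda>x. e * (e * R x)) = R"
    by (auto simp: fun_eq_iff field_simps e)
  thus ?thesis
    using ip_helical[OF h m l(4-6)] unfolding helical_def[of h P Q R] e_def by simp
qed

lemma norm_zero_ip:
  assumes "\<And>J. u J \<in> l2" "\<And>J. v J \<in> l2" "l2_norm u = 0"
  shows "ip u v = 0"
proof -
  have "cmod (ip u v) \<le> 0"
  proof (rule field_le_epsilon)
    fix d :: real assume d: "d > 0"
    define n where "n = (l2_norm v)\<^sup>2"
    have n: "n \<ge> 0" by (simp add: n_def)
    have "cmod (ip u v) \<le> (l2_norm u)\<^sup>2 / (d / (n + 1)) + (d / (n + 1)) * (l2_norm v)\<^sup>2"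
      using d n by (intro ip_bound assms) auto
    also have "\<dots> = d * (n / (n + 1))" using assms(3) by (simp add: n_def)
    also have "\<dots> \<le> d * 1" using d n by (intro mult_left_mono) auto
    finally show "cmod (ip u v) \<le> 0 + d" by simp
  qed
  thus ?thesis by simp
qed

text \<open>
  The index and the coefficient of the Hermite function in the component \<open>P\<close>; \<open>curl_Q\<close> and \<open>curl_R\<close> are
  the coefficients in the other two.  With them the exceptional form is treated like the others.
\<close>

definition curl_P :: "real \<Rightarrow> nat \<times> nat \<Rightarrow> nat \<times> complex" where
  "curl_P h = (\<lambda>(k, j). if k = 0 \<and> j = 1 then (0, 1) else (Suc k, - \<i> * of_real (curl_eigenvalue h k j - tau h)))"

definition curl_Q :: "real \<Rightarrow> nat \<times> nat \<Rightarrow> complex" where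
  "curl_Q h = (\<lambda>(k, j). if k = 0 \<and> j = 1 then 0 else - \<i> * of_real (2 * real k * tau h * (curl_eigenvalue h k j + tau h)))"

definition curl_R :: "real \<Rightarrow> nat \<times> nat \<Rightarrow> complex" where
  "curl_R h = (\<lambda>(k, j). if k = 0 \<and> j = 1 then 0 else of_real ((curl_eigenvalue h k j)\<^sup>2 - (tau h)\<^sup>2))"

lemma curl_form_helical:
  "curl_form h i = helical h (\<lambda>x. snd (curl_P h i) * herm h (fst (curl_P h i)) x)
     (\<lambda>x. curl_Q h i * herm h (fst i - 1) x) (\<lambda>x. curl_R h i * herm h (fst i) x)"
  by (cases i) (simp add: curl_form_def curl_P_def curl_Q_def curl_R_def Let_def del: herm.simps)

lemma curl_value_props:
  assumes h: "h \<noteq> 0"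
  shows "curl_value h (k, 0) = osc (tau h) k" 
    "curl_value h (k, 1) = (sqrt (osc (tau h) k + 1/4) - 1/2)\<^sup>2"
    "curl_value h (k, 2) = (sqrt (osc (tau h) k + 1/4) + 1/2)\<^sup>2"
    "sqrt (osc (tau h) k + 1/4) > 1/2"
proof -
  have p: "osc (tau h) k > 0" by (rule osc_pos(2)[OF tau_pos[OF h]])
  show "curl_value h (k, 0) = osc (tau h) k" by (simp add: curl_value_def curl_eigenvalue_def)
  have s: "(sqrt (osc (tau h) k + 1/4))\<^sup>2 = osc (tau h) k + 1/4" using p by simp
  show "curl_value h (k, 1) = (sqrt (osc (tau h) k + 1/4) - 1/2)\<^sup>2"
    unfolding power2_diff s by (simp add: curl_value_def curl_eigenvalue_def power2_eq_square)
  show "curl_value h (k, 2) = (sqrt (osc (tau h) k + 1/4) + 1/2)\<^sup>2"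
    unfolding power2_sum s by (simp add: curl_value_def curl_eigenvalue_def power2_eq_square)
  have "sqrt (osc (tau h) k + 1/4) > sqrt ((1/2)\<^sup>2)" using p by (subst real_sqrt_less_iff) (simp add: power2_eq_square)
  thus "sqrt (osc (tau h) k + 1/4) > 1/2" by simp
qed

lemma curl_value_pos: "h \<noteq> 0 \<Longrightarrow> j \<in> {0, 1, 2} \<Longrightarrow> curl_value h (k, j) > 0"
  using curl_value_props[of h k] osc_pos(2)[OF tau_pos, of h k] by (auto simp: zero_less_power simp del: One_nat_def)

lemma curl_value_inj:
  assumes h: "h \<noteq> 0" and j: "j \<in> {0, 1, 2}" and eq: "curl_value h (k, j) = curl_value h (k', j)"
  shows "k = k'"
proof -
  note P = curl_value_props[OF h]
  have "osc (tau h) k = osc (tau h) k'"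
  proof -
    consider "j = 0" | "j = 1" | "j = 2" using j by auto
    thus ?thesis
    proof cases
      case 2
      have "sqrt (osc (tau h) k + 1/4) - 1/2 = sqrt (osc (tau h) k' + 1/4) - 1/2"
        using eq P(4)[of k] P(4)[of k'] unfolding 2 P by (subst (asm) power2_eq_iff_nonneg) auto
      thus ?thesis by simp
    next
      case 3
      have "sqrt (osc (tau h) k + 1/4) + 1/2 = sqrt (osc (tau h) k' + 1/4) + 1/2"
        using eq P(4)[of k] P(4)[of k'] unfolding 3 P by (subst (asm) power2_eq_iff_nonneg) auto
      thus ?thesis by simp
    qed (use eq P in auto)
  qed
  thus ?thesis using osc_inj[OF tau_pos[OF h]] by (simp add: inj_eq)
qed

lemma curl_value_inj_type:
  assumes h: "h \<noteq> 0" and j: "j \<in> {0, 1, 2}" "j' \<in> {0, 1, 2}" and eq: "curl_value h (k, j) = curl_value h (k, j')"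
  shows "j = j'"
proof -
  have "curl_eigenvalue h k j = curl_eigenvalue h k j'" using eq by (simp add: curl_value_def)
  thus ?thesis using j curl_value_props(4)[OF h, of k] by (auto simp: curl_eigenvalue_def)
qed

lemma curl_P_nonzero:
  assumes h: "h \<noteq> 0" and j: "j \<in> {0, 1, 2}"
  shows "snd (curl_P h (k, j)) \<noteq> 0"
proof -
  have t: "tau h > 0" by (rule tau_pos[OF h])
  have "curl_eigenvalue h k j \<noteq> tau h" if n: "\<not> (k = 0 \<and> j = 1)"
  proof
    assume e: "curl_eigenvalue h k j = tau h"
    hence j1: "j = 1" using j t curl_value_props(4)[OF h, of k] by (auto simp: curl_eigenvalue_def)
    hence "sqrt (osc (tau h) k + 1/4) = tau h + 1/2" using e by (simp add: curl_eigenvalue_def)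
    hence "(sqrt (osc (tau h) k + 1/4))\<^sup>2 = (tau h + 1/2)\<^sup>2" by simp
    hence "osc (tau h) k + 1/4 = (tau h + 1/2)\<^sup>2" using osc_pos(2)[OF tau_pos[OF h], of k] by simp
    hence "tau h * (2 * real k) = 0" by (simp add: osc_def power2_eq_square algebra_simps)
    thus False using t n j1 by simp
  qed
  thus ?thesis by (auto simp: curl_P_def)
qed

text \<open>
  Within a block the three eigenvalues are distinct, so forms with a common eigenvalue come from different
  blocks and have components along different Hermite functions.
\<close>

lemma curl_form_orthogonal:
  assumes h: "h \<noteq> 0" and i: "i \<in> UNIV \<times> {0, 1, 2}" and j: "j \<in> UNIV \<times> {0, 1, 2}" and ne: "i \<noteq> j"
    and eq: "curl_value h i = curl_value h j"
  shows "ip (curl_form h i) (curl_form h j) = 0"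
proof -
  note S = herm_schwartz[OF h]
  have s: "(\<lambda>x. c * herm h n x) \<in> schwartz" for c n by (intro schwartz_cmult S)
  note sl = schwartz_l2[OF s]
  obtain k1 j1 where 1: "i = (k1, j1)" "j1 \<in> {0, 1, 2}" using i by blast
  obtain k2 j2 where 2: "j = (k2, j2)" "j2 \<in> {0, 1, 2}" using j by blast
  have k12: "k1 \<noteq> k2"
  proof
    assume k: "k1 = k2"
    hence "j1 = j2" using curl_value_inj_type[OF h 1(2) 2(2), of k2] eq by (simp only: 1(1) 2(1))
    thus False using ne k by (simp add: 1(1) 2(1))
  qed
  hence k: "fst i \<noteq> fst j" by (simp add: 1(1) 2(1))
  have P: "fst (curl_P h i) \<noteq> fst (curl_P h j)"
    using k12 by (simp add: 1(1) 2(1) curl_P_def)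
  have Q: "curl_Q h i * (cnj (curl_Q h j) * ip1 (herm h (fst i - 1)) (herm h (fst j - 1))) = 0"
  proof (cases "fst i = 0 \<or> fst j = 0")
    case True
    hence "curl_Q h i = 0 \<or> curl_Q h j = 0" by (auto simp: 1(1) 2(1) curl_Q_def)
    thus ?thesis by auto
  next
    case False
    hence "fst i - 1 \<noteq> fst j - 1" using k by auto
    thus ?thesis using herm_orthogonal[OF h] by simp
  qed
  show ?thesis unfolding curl_form_helical
    by (subst ip_helical_helical[OF h sl sl sl sl sl sl])
       (simp only: ip1_cmult_left ip1_cmult_right herm_orthogonal[OF h P] herm_orthogonal[OF h k], use Q in \<open>simp add: mult_ac\<close>)
qed

text \<open>
  Pairing \<open>u\<close> with the forms of one block gives a polynomial of degree two in \<open>m\<close> whose coefficients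
  are combinations of the Hermite coefficients of \<open>u\<close>.  It has three zeros, so the
  coefficients vanish and completeness of the Hermite functions applies to each component.  For
  \<open>k = 0\<close> one Hermite coefficient is absent and two zeros are enough.
\<close>

lemma curl_form_complete:
  assumes h: "h \<noteq> 0" and u: "u \<in> l2_forms 1" and o: "\<forall>i\<in>UNIV \<times> {0, 1, 2}. ip u (curl_form h i) = 0"
  shows "l2_norm u = 0"
proof -
  note S = herm_schwartz[OF h]
  have s: "(\<lambda>x. c * herm h n x) \<in> schwartz" for c n by (intro schwartz_cmult S)
  note sl = schwartz_l2[OF s]
  define e :: complex where "e = of_real (sgn h)"
  define t where "t = tau h"
  have t: "t > 0" unfolding t_def by (rule tau_pos[OF h])
  define A B C where "A = (\<lambda>x. u {1} x + (\<i> * e) * u {2} x)" and "B = (\<lambda>x. u {1} x - (\<i> * e) * u {2} x)" and "C = (\<lambda>x. e * u {3} x)"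
  note ul = l2_forms_l2[OF u]
  have l: "A \<in> l2" "B \<in> l2" "C \<in> l2" unfolding A_def B_def C_def by (intro l2_add l2_diff l2_cmult ul)+
  define a b c where "a n = ip1 A (herm h n)" and "b n = ip1 B (herm h n)" and "c n = ip1 C (herm h n)" for n
  have orth: "(1/2) * (cnj (snd (curl_P h i)) * a (fst (curl_P h i))) + (1/2) * (cnj (curl_Q h i) * b (fst i - 1)) + cnj (curl_R h i) * c (fst i) = 0"
    if "i \<in> UNIV \<times> {0, 1, 2}" for i
  proof -
    have "ip u (curl_form h i) = 0" using o that by blast
    hence "ip (form1 (u {1}) (u {2}) (u {3})) (curl_form h i) = 0" by (subst l2_form1_eq[OF u, symmetric])
    thus ?thesis unfolding curl_form_helical
      by (subst (asm) ip_helical[OF h ul ul ul sl sl sl])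
         (simp only: A_def B_def C_def a_def b_def c_def e_def ip1_cmult_right)
  qed
  have a0: "a 0 = 0" using orth[of "(0, 1)"] by (simp add: curl_P_def curl_Q_def curl_R_def)
  have lin: "\<i> * of_real (m - t) * a (Suc k) + \<i> * of_real (2 * real k * t * (m + t)) * b (k - 1) + 2 * (of_real (m\<^sup>2 - t\<^sup>2) * c k) = 0"
    if "m = curl_eigenvalue h k j" "j \<in> {0, 1, 2}" "\<not> (k = 0 \<and> j = 1)" for m k j
  proof -
    have "(1/2) * (\<i> * of_real (m - t) * a (Suc k)) + (1/2) * (\<i> * of_real (2 * real k * t * (m + t)) * b (k - 1)) + of_real (m\<^sup>2 - t\<^sup>2) * c k = 0"
      using orth[of "(k, j)"] that(2) unfolding curl_P_def curl_Q_def curl_R_def case_prod_conv if_not_P[OF that(3)] that(1)[symmetric] t_def[symmetric]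
      by (simp del: of_real_diff of_real_mult of_real_add)
    moreover have "U + V + 2 * W = 2 * ((1/2) * U + (1/2) * V + W)" for U V W :: complex by simp
    ultimately show ?thesis by (simp only: mult_zero_right)
  qed
  have abc: "a (Suc k) = 0 \<and> (k \<noteq> 0 \<longrightarrow> b (k - 1) = 0) \<and> c k = 0" for k
  proof -
    define X Y Z where "X = \<i> * a (Suc k)" and "Y = \<i> * of_real (2 * real k * t) * b (k - 1)" and "Z = 2 * c k"
    have eq: "of_real (m - t) * X + of_real (m + t) * Y + of_real (m\<^sup>2 - t\<^sup>2) * Z = 0"
      if "m = curl_eigenvalue h k j" "j \<in> {0, 1, 2}" "\<not> (k = 0 \<and> j = 1)" for m j
      using lin[OF that] by (simp add: X_def Y_def Z_def algebra_simps)
    have 0: "- X + Y - of_real t * Z = 0"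
    proof -
      have "of_real t * (- X + Y - of_real t * Z) = 0" using eq[of 0 0] by (simp add: curl_eigenvalue_def power2_eq_square algebra_simps)
      thus ?thesis using t by simp
    qed
    \<comment> \<open>Subtracting the equation for the root 0 from that for \<open>m\<close> leaves a multiple of \<open>m\<close>.\<close>
    have quad: "of_real m * Z + X + Y = 0"
      if "m = curl_eigenvalue h k j" "j \<in> {1, 2}" "\<not> (k = 0 \<and> j = 1)" for m j
    proof -
      have m0: "m \<noteq> 0" using that(1,2) curl_value_props(4)[OF h, of k] by (auto simp: curl_eigenvalue_def)
      have "of_real m * (of_real m * Z + X + Y) = of_real (m - t) * X + of_real (m + t) * Y + of_real (m\<^sup>2 - t\<^sup>2) * Z - of_real t * (- X + Y - of_real t * Z)"
        by (simp add: algebra_simps power2_eq_square)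
      also have "\<dots> = 0" using eq[OF that(1) _ that(3)] that(2) 0 by simp
      finally show ?thesis using m0 by simp
    qed
    define m1 m2 where "m1 = curl_eigenvalue h k 1" and "m2 = curl_eigenvalue h k 2"
    have m: "m1 > 0" "m2 < - t" 
    proof -
      show "m1 > 0" using curl_value_props(4)[OF h, of k] by (simp add: m1_def curl_eigenvalue_def)
      have "(t + 1/2)\<^sup>2 \<le> osc (tau h) k + 1/4" using t by (simp add: osc_def t_def[symmetric] power2_eq_square algebra_simps)
      hence "t + 1/2 \<le> sqrt (osc (tau h) k + 1/4)" by (rule real_le_rsqrt)
      thus "m2 < - t" by (simp add: m2_def curl_eigenvalue_def)
    qed
    have q2: "of_real m2 * Z + X + Y = 0" using quad[OF m2_def] by simp
    show ?thesis
    proof (cases "k = 0")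
      case True
      hence Y: "Y = 0" by (simp add: Y_def)
      have "of_real (m2 - t) * Z = (of_real m2 * Z + X + Y) + (- X + Y - of_real t * Z)" using Y by (simp add: algebra_simps)
      hence "Z = 0" using q2 0 m t by (simp del: of_real_diff)
      hence "X = 0" using q2 Y by simp
      thus ?thesis using \<open>Z = 0\<close> True by (simp add: X_def Z_def)
    next
      case False
      have q1: "of_real m1 * Z + X + Y = 0" using quad[OF m1_def] False by simp
      have "of_real (m1 - m2) * Z = (of_real m1 * Z + X + Y) - (of_real m2 * Z + X + Y)" by (simp add: algebra_simps)
      hence Z: "Z = 0" using q1 q2 m t by (simp del: of_real_diff)
      hence "X + Y = 0" "- X + Y = 0" using q1 0 by simp_all
      hence "X = 0" "Y = 0" by (auto simp: add_eq_0_iff)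
      thus ?thesis using Z False t by (simp add: X_def Y_def Z_def)
    qed
  qed
  have "a n = 0" for n using a0 abc by (cases n) auto
  hence A0: "(LBINT x. (cmod (A x))\<^sup>2) = 0" unfolding a_def by (intro herm_complete[OF h l(1)])
  have "b n = 0" for n using abc[of "Suc n"] by simp
  hence B0: "(LBINT x. (cmod (B x))\<^sup>2) = 0" unfolding b_def by (intro herm_complete[OF h l(2)])
  have "c n = 0" for n using abc by simp
  hence C0: "(LBINT x. (cmod (C x))\<^sup>2) = 0" unfolding c_def by (intro herm_complete[OF h l(3)])
  have ee: "e * e = 1" "e * (e * z) = z" for z using sgn_sq[OF h] by (auto simp: e_def simp flip: mult.assoc)
  have "u = helical h A B C"
  proof -
    have "(\<lambda>x. 1 / 2 * (A x + B x)) = u {1}" "(\<lambda>x. - \<i> * of_real (sgn h) / 2 * (A x - B x)) = u {2}" "(\<lambda>x. of_real (sgn h) * C x) = u {3}"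
      unfolding e_def[symmetric] by (auto simp: A_def B_def C_def fun_eq_iff field_simps ee)
    thus ?thesis unfolding helical_def by (simp only: l2_form1_eq[OF u, symmetric])
  qed
  hence "ip u u = (1/2) * ip1 A A + (1/2) * ip1 B B + ip1 C C" using ip_helical_helical[OF h l l] by simp
  hence "ip u u = 0" by (simp add: ip1_self A0 B0 C0)
  thus ?thesis by (simp add: ip_eq_0_iff)
qed

lemma eigensystem_one_forms:
  assumes h: "h \<noteq> 0"
  shows "eigensystem h 1 (UNIV \<times> {0, 1, 2}) (curl_form h) (curl_value h)"
  unfolding eigensystem_def
proof (intro conjI ballI allI impI)
  note S = herm_schwartz[OF h]
  have s: "(\<lambda>x. c * herm h n x) \<in> schwartz" for c n by (intro schwartz_cmult S)
  note sl = schwartz_l2[OF s]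
  have hel: "helical h P Q R \<in> schwartz_forms 1" if "P \<in> schwartz" "Q \<in> schwartz" "R \<in> schwartz" for P Q R
    unfolding helical_def by (intro form1_schwartz schwartz_cmult schwartz_add schwartz_diff that)
  have cs: "curl_form h i \<in> schwartz_forms 1" for i unfolding curl_form_helical by (intro hel s)
  show "curl_form h i \<in> schwartz_forms 1" for i by (rule cs)
  show "hodge_laplacian (drho h) (curl_form h i) = (\<lambda>J x. of_real (curl_value h i) * curl_form h i J x)" for i
    by (rule curl_form_eigen[OF h])
  show "0 < curl_value h i" if "i \<in> UNIV \<times> {0, 1, 2}" for i using that curl_value_pos[OF h] by blast
  show "l2_norm (curl_form h i) \<noteq> 0" if i: "i \<in> UNIV \<times> {0, 1, 2}" for i
  proof
    assume "l2_norm (curl_form h i) = 0"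
    define a where "a = fst (curl_P h i)"
    define v where "v = helical h (\<lambda>x. 1 * herm h a x) (\<lambda>x. 0 * herm h 0 x) (\<lambda>x. 0 * herm h 0 x)"
    have v: "v \<in> schwartz_forms 1" unfolding v_def by (intro hel s)
    have "ip (curl_form h i) v = 0"
      using \<open>l2_norm (curl_form h i) = 0\<close>
      by (intro norm_zero_ip l2_forms_l2[OF schwartz_forms_l2[OF cs]] l2_forms_l2[OF schwartz_forms_l2[OF v]])
    moreover have "ip (curl_form h i) v = (1/2) * (snd (curl_P h i) * ip1 (herm h a) (herm h a))"
      unfolding v_def curl_form_helical a_def[symmetric]
      by (subst ip_helical_helical[OF h sl sl sl sl sl sl]) (simp only: ip1_cmult_left ip1_cmult_right complex_cnj_zero complex_cnj_one, simp)
    ultimately show False using curl_P_nonzero[OF h] i herm_norm[OF h, of a] by auto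
  qed
  show "ip (curl_form h i) (curl_form h j) = 0" if "i \<in> UNIV \<times> {0, 1, 2}" "j \<in> UNIV \<times> {0, 1, 2}" "i \<noteq> j"
    "curl_value h i = curl_value h j" for i j
    by (rule curl_form_orthogonal[OF h that])
  show "finite {i \<in> UNIV \<times> {0, 1, 2}. curl_value h i = l}" for l
  proof (rule finite_subset)
    show "{i \<in> UNIV \<times> {0, 1, 2}. curl_value h i = l} \<subseteq> (\<Union>j\<in>{0, 1, 2}. (\<lambda>k. (k, j)) ` {k. curl_value h (k, j) = l})" by auto
    have "finite {k. curl_value h (k, j) = l}" if "j \<in> {0, 1, 2}" for j
    proof -
      have "inj (\<lambda>k. curl_value h (k, j))" using curl_value_inj[OF h that] by (auto intro: injI)
      from finite_vimageI[OF _ this, of "{l}"] show ?thesis by (simp add: vimage_def)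
    qed
    thus "finite (\<Union>j\<in>{0, 1, 2}. (\<lambda>k. (k, j)) ` {k. curl_value h (k, j) = l})" by blast
  qed
  show "hodge_laplacian (drho h) \<phi> \<in> l2_forms 1" if \<phi>: "\<phi> \<in> schwartz_forms 1" for \<phi>
  proof -
    note f = schwartz_forms_schwartz[OF \<phi>]
    have "hodge_laplacian (drho h) (form1 (\<phi> {1}) (\<phi> {2}) (\<phi> {3})) \<in> schwartz_forms 1"
      unfolding form1_laplacian[OF f f f]
      by (intro form1_schwartz schwartz_add schwartz_diff oscillator_schwartz drho_schwartz f) auto
    thus ?thesis using schwartz_form1_eq[OF \<phi>] schwartz_forms_l2 by metis
  qed
  show "ip (hodge_laplacian (drho h) \<phi>) (curl_form h i) = of_real (curl_value h i) * ip \<phi> (curl_form h i)"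
    if \<phi>: "\<phi> \<in> schwartz_forms 1" for \<phi> i
  proof -
    note f = schwartz_forms_schwartz[OF \<phi>] and g = schwartz_forms_schwartz[OF cs[of i]]
    have "ip (hodge_laplacian (drho h) \<phi>) (curl_form h i) = ip \<phi> (hodge_laplacian (drho h) (curl_form h i))"
      using form1_laplacian_symmetric[OF f f f g g g, of h "{1}" "{2}" "{3}" "{1}" "{2}" "{3}"]
        schwartz_form1_eq[OF \<phi>] schwartz_form1_eq[OF cs[of i]] by simp
    also have "\<dots> = of_real (curl_value h i) * ip \<phi> (curl_form h i)"
      unfolding curl_form_eigen[OF h] by (simp add: ip_def ip1_cmult_right sum_distrib_left)
    finally show ?thesis .
  qed
  show "l2_norm u = 0" if "u \<in> l2_forms 1" "\<forall>i\<in>UNIV \<times> {0, 1, 2}. ip u (curl_form h i) = 0" for u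
    by (rule curl_form_complete[OF h that])
qed

section \<open>Hodge duality\<close>

lemma hodge_star_eq:
  assumes "J \<subseteq> {1, 2, 3}"
  obtains c :: complex where "hodge_star u J = (\<lambda>x. c * u ({1, 2, 3} - J) x)"
proof -
  define c :: complex where "c = (-1) ^ card {(i, j). i \<in> {1, 2, 3} - J \<and> j \<in> J \<and> j < i}"
  have "hodge_star u J x = c * u ({1, 2, 3} - J) x" for x
    unfolding hodge_star_def c_def using assms by (simp only: if_True)
  thus ?thesis using that[of c] by blast
qed

lemma card_complement3: "J \<subseteq> {1, 2, 3 :: nat} \<Longrightarrow> card ({1, 2, 3} - J) = 3 - card J"
  by (subst card_Diff_subset) (auto intro: finite_subset)

lemma card_le3: "J \<subseteq> {1, 2, 3 :: nat} \<Longrightarrow> card J \<le> 3"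
  using card_mono[of "{1, 2, 3 :: nat}" J] by simp

lemma hodge_star_schwartz:
  assumes u: "u \<in> schwartz_forms q" and q: "q \<le> 3"
  shows "hodge_star u \<in> schwartz_forms (3 - q)"
  unfolding schwartz_forms_def mem_Collect_eq
proof (intro allI)
  fix J
  show "if J \<subseteq> {1, 2, 3} \<and> card J = 3 - q then hodge_star u J \<in> schwartz else hodge_star u J = (\<lambda>_. 0)"
  proof (cases "J \<subseteq> {1, 2, 3}")
    case True
    obtain c where c: "hodge_star u J = (\<lambda>x. c * u ({1, 2, 3} - J) x)" by (rule hodge_star_eq[OF True])
    have "u ({1, 2, 3} - J) = (\<lambda>_. 0)" if "card J \<noteq> 3 - q"
    proof -
      have "card ({1, 2, 3} - J) \<noteq> q" using card_complement3[OF True] card_le3[OF True] that q by simp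
      thus ?thesis using u unfolding schwartz_forms_def by auto
    qed
    moreover have "(\<lambda>x. c * u ({1, 2, 3} - J) x) \<in> schwartz" by (rule schwartz_cmult[OF schwartz_forms_schwartz[OF u]])
    ultimately show ?thesis unfolding c using True by (cases "card J = 3 - q") (simp_all only: simp_thms if_True if_False mult_zero_right)
  qed (simp add: hodge_star_outside)
qed

lemma hodge_star_l2:
  assumes u: "u \<in> l2_forms q" and q: "q \<le> 3"
  shows "hodge_star u \<in> l2_forms (3 - q)"
  unfolding l2_forms_def mem_Collect_eq
proof (intro allI)
  fix J
  show "if J \<subseteq> {1, 2, 3} \<and> card J = 3 - q then hodge_star u J \<in> borel_measurable lborel \<and> integrable lborel (\<lambda>x. (cmod (hodge_star u J x))\<^sup>2)
     else hodge_star u J = (\<lambda>_. 0)"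
  proof (cases "J \<subseteq> {1, 2, 3}")
    case True
    obtain c where c: "hodge_star u J = (\<lambda>x. c * u ({1, 2, 3} - J) x)" by (rule hodge_star_eq[OF True])
    have "u ({1, 2, 3} - J) = (\<lambda>_. 0)" if "card J \<noteq> 3 - q"
    proof -
      have "card ({1, 2, 3} - J) \<noteq> q" using card_complement3[OF True] card_le3[OF True] that q by simp
      thus ?thesis using u unfolding l2_forms_def by auto
    qed
    moreover have "hodge_star u J \<in> l2" unfolding c by (rule l2_cmult[OF l2_forms_l2[OF u]])
    ultimately show ?thesis using True unfolding l2_def mem_Collect_eq
      by (cases "card J = 3 - q") (simp_all only: simp_thms if_True if_False c mult_zero_right)
  qed (simp add: hodge_star_outside)
qed

lemma hodge_star_star:
  assumes "\<And>J. \<not> J \<subseteq> {1, 2, 3} \<Longrightarrow> u J = (\<lambda>_. 0)"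
  shows "hodge_star (hodge_star u) = u"
proof
  fix J
  show "hodge_star (hodge_star u) J = u J"
  proof (cases "J \<subseteq> {1, 2, 3}")
    case True
    from subset_cases[OF this] show ?thesis
      by (elim disjE; hypsubst; simp only: hodge_star_table minus_minus)
  qed (use assms in \<open>simp add: hodge_star_outside\<close>)
qed

lemma ip_hodge_star: "ip (hodge_star u) (hodge_star v) = ip u v"
  unfolding ip_def sum_Pow3 hodge_star_table ip1_uminus_left ip1_uminus_right by simp

text \<open>
  The Hodge star exchanges the two rows of the component formulas that belong to complementary index sets.
\<close>

lemma hodge_laplacian_star:
  assumes u: "u \<in> schwartz_forms q" and q: "q \<le> 3"
  shows "hodge_laplacian (drho h) (hodge_star u) = hodge_star (hodge_laplacian (drho h) u)"
proof
  fix J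
  note S = schwartz_forms_schwartz[OF u] and S' = schwartz_forms_schwartz[OF hodge_star_schwartz[OF u q]]
  have um: "drho h 1 (\<lambda>x. - u K x) = (\<lambda>x. - drho h 1 (u K) x)" "drho h 2 (\<lambda>x. - u K x) = (\<lambda>x. - drho h 2 (u K) x)"
    "drho h 3 (\<lambda>x. - u K x) = (\<lambda>x. - drho h 3 (u K) x)" for K
    by (rule drho_uminus[OF S]; simp)+
  have ou: "oscillator h (\<lambda>x. - u K x) = (\<lambda>x. - oscillator h (u K) x)" for K
    using oscillator_cmult[OF S, of h "-1" K] by simp
  show "hodge_laplacian (drho h) (hodge_star u) J = hodge_star (hodge_laplacian (drho h) u) J"
  proof (cases "J \<subseteq> {1, 2, 3}")
    case True
    from subset_cases[OF this] show ?thesis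
      by (elim disjE; hypsubst; simp only: hodge_laplacian_table[OF S'] hodge_star_table hodge_laplacian_table[OF S] um ou; simp add: algebra_simps)
  qed (simp add: hodge_star_outside hodge_laplacian_outside)
qed

text \<open>
  The Hodge star is an isometry that commutes with the Laplacian and is its own inverse in dimension 3.
\<close>

lemma eigensystem_dual:
  assumes E: "eigensystem h q I e \<nu>" and q: "q \<le> 3"
  shows "eigensystem h (3 - q) I (\<lambda>i. hodge_star (e i)) \<nu>"
  unfolding eigensystem_def
proof (intro conjI ballI allI impI)
  note D = eigensystemD[OF E]
  have q': "3 - q \<le> 3" "3 - (3 - q) = q" using q by auto
  have ss: "hodge_star (hodge_star u) = u" if "u \<in> l2_forms p" for u p
    by (rule hodge_star_star) (use that in \<open>auto simp: l2_forms_def\<close>)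
  have nn: "l2_norm (hodge_star u) = 0 \<longleftrightarrow> l2_norm u = 0" for u
    by (simp only: ip_eq_0_iff[symmetric] ip_hodge_star)
  show "hodge_star (e i) \<in> schwartz_forms (3 - q)" if "i \<in> I" for i by (rule hodge_star_schwartz[OF D(1)[OF that] q])
  show "hodge_laplacian (drho h) (hodge_star (e i)) = (\<lambda>J x. of_real (\<nu> i) * hodge_star (e i) J x)" if "i \<in> I" for i
    unfolding hodge_laplacian_star[OF D(1)[OF that] q] D(2)[OF that] by (simp add: hodge_star_def fun_eq_iff del: One_nat_def)
  show "l2_norm (hodge_star (e i)) \<noteq> 0" if "i \<in> I" for i using D(3)[OF that] by (simp only: nn) simp
  show "\<nu> i > 0" if "i \<in> I" for i by (rule D(4)[OF that])
  show "ip (hodge_star (e i)) (hodge_star (e j)) = 0" if "i \<in> I" "j \<in> I" "i \<noteq> j" "\<nu> i = \<nu> j" for i j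
    unfolding ip_hodge_star by (rule D(5)[OF that])
  show "l2_norm u = 0" if u: "u \<in> l2_forms (3 - q)" and o: "\<forall>i\<in>I. ip u (hodge_star (e i)) = 0" for u
  proof -
    have "ip (hodge_star u) (e i) = 0" if "i \<in> I" for i
      using o that ip_hodge_star[of "hodge_star u" "e i"] ss[OF u] by simp
    moreover have "hodge_star u \<in> l2_forms q" using hodge_star_l2[OF u q'(1)] q'(2) by simp
    ultimately have "l2_norm (hodge_star u) = 0" by (intro D(6))
    thus ?thesis by (simp only: nn)
  qed
  show "finite {i \<in> I. \<nu> i = l}" for l by (rule D(7))
  fix \<phi> assume \<phi>: "\<phi> \<in> schwartz_forms (3 - q)"
  define \<psi> where "\<psi> = hodge_star \<phi>"
  have \<psi>: "\<psi> \<in> schwartz_forms q" using hodge_star_schwartz[OF \<phi> q'(1)] q'(2) by (simp add: \<psi>_def)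
  have \<phi>\<psi>: "\<phi> = hodge_star \<psi>" unfolding \<psi>_def using ss[OF schwartz_forms_l2[OF \<phi>]] by simp
  show "hodge_laplacian (drho h) \<phi> \<in> l2_forms (3 - q)"
    unfolding \<phi>\<psi> hodge_laplacian_star[OF \<psi> q] by (rule hodge_star_l2[OF D(8)[OF \<psi>] q])
  show "ip (hodge_laplacian (drho h) \<phi>) (hodge_star (e i)) = of_real (\<nu> i) * ip \<phi> (hodge_star (e i))" if "i \<in> I" for i
    unfolding \<phi>\<psi> hodge_laplacian_star[OF \<psi> q] ip_hodge_star by (rule D(9)[OF \<psi> that])
qed

section \<open>The spectral zeta functions\<close>

lemma osc_progression: "osc \<tau> k = \<tau> * (\<tau> + 1) + 2 * \<tau> * real k"
  by (simp add: osc_def algebra_simps)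

lemma summable_powr_linear:
  assumes c: "c > 0" "\<And>k. \<nu> k \<ge> c * (real k + 1)" and s: "Re s > 1"
  shows "summable (\<lambda>k. norm (of_real (\<nu> k) powr (- s) :: complex))"
proof (rule summable_comparison_test'[where N = 0])
  show "summable (\<lambda>k. c powr (- Re s) * (real k + 1) powr (- Re s))"
    using s by (intro summable_mult summable_powr_Suc) simp
  show "norm (norm (of_real (\<nu> k) powr (- s) :: complex)) \<le> c powr (- Re s) * (real k + 1) powr (- Re s)" for k
  proof -
    have p: "c * (real k + 1) > 0" using c by simp
    hence "\<nu> k > 0" using c(2)[of k] by simp
    moreover have "\<nu> k powr (- Re s) \<le> (c * (real k + 1)) powr (- Re s)"
      using p c(2) s by (intro powr_mono2') auto
    ultimately show ?thesis using c by (simp add: norm_of_real_powr powr_mult)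
  qed
qed

lemma osc_linear: "\<tau> > 0 \<Longrightarrow> osc \<tau> k \<ge> \<tau> * (real k + 1)"
  unfolding osc_def by (intro mult_left_mono) auto

text \<open>
  The squares of the roots grow linearly in \<open>k\<close>, like their product.  For the smaller one this uses that
  the quotient of the roots increases with \<open>k\<close> towards 1.
\<close>

lemma root_linear:
  assumes t: "\<tau> > 0"
  defines "c \<equiv> (sqrt (osc \<tau> 0 + 1/4) - 1/2) / (sqrt (osc \<tau> 0 + 1/4) + 1/2)"
  shows "c > 0" "(sqrt (osc \<tau> k + 1/4) - 1/2)\<^sup>2 \<ge> c * \<tau> * (real k + 1)" "(sqrt (osc \<tau> k + 1/4) + 1/2)\<^sup>2 \<ge> \<tau> * (real k + 1)"
proof -
  define y z where "y = sqrt (osc \<tau> k + 1/4)" and "z = sqrt (osc \<tau> 0 + 1/4)"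
  note P = osc_pos(2)[OF t]
  have y: "y > 1/2" "(y - 1/2) * (y + 1/2) = osc \<tau> k" and z: "z > 1/2"
    using pair_roots[OF P[of k]] pair_roots[OF P[of 0]] by (auto simp: y_def z_def)
  have zy: "z \<le> y" unfolding y_def z_def using t by (simp add: osc_def)
  show c: "c > 0" unfolding c_def z_def[symmetric] using z by simp
  have "c \<le> (y - 1/2) / (y + 1/2)"
    unfolding c_def z_def[symmetric] using y z zy by (simp add: field_simps)
  hence "c * osc \<tau> k \<le> (y - 1/2) / (y + 1/2) * ((y - 1/2) * (y + 1/2))"
    unfolding y(2) using P by (intro mult_right_mono) (auto simp: less_imp_le)
  also have "\<dots> = (y - 1/2)\<^sup>2" using y(1) by (simp add: power2_eq_square)
  finally have "c * osc \<tau> k \<le> (y - 1/2)\<^sup>2" .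
  moreover have "c * (\<tau> * (real k + 1)) \<le> c * osc \<tau> k" using c osc_linear[OF t] by (intro mult_left_mono) auto
  ultimately show "(sqrt (osc \<tau> k + 1/4) - 1/2)\<^sup>2 \<ge> c * \<tau> * (real k + 1)" by (simp add: y_def mult.assoc)
  have "osc \<tau> k \<le> (y + 1/2) * (y + 1/2)" unfolding y(2)[symmetric] using y by (intro mult_right_mono) auto
  thus "(sqrt (osc \<tau> k + 1/4) + 1/2)\<^sup>2 \<ge> \<tau> * (real k + 1)"
    using osc_linear[OF t, of k] by (simp add: y_def power2_eq_square)
qed

definition osc_zeta :: "real \<Rightarrow> complex \<Rightarrow> complex" where
  "osc_zeta \<tau> = progression_zeta (\<tau> * (\<tau> + 1)) \<tau>"

lemma osc_zeta_sums:
  assumes "\<tau> > 0" "Re s > 1"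
  shows "(\<lambda>k. of_real (osc \<tau> k) powr (- s)) sums osc_zeta \<tau> s"
  unfolding osc_zeta_def osc_progression using assms
  by (intro progression_zeta_sums) (auto simp: algebra_simps)

lemma osc_zeta_analytic:
  assumes t: "\<tau> > 0"
  shows "osc_zeta \<tau> analytic_on {s. Re s > -1/4} - {1}" "osc_zeta \<tau> meromorphic_on {s. Re s > -1/4}"
proof -
  have r: "0 < \<tau>" "\<tau> < \<tau> * (\<tau> + 1)" using t by (auto simp: algebra_simps)
  have "open ({z. Re z > -1/2} - {1})" by (intro open_Diff open_halfspace_Re_gt) auto
  hence "osc_zeta \<tau> analytic_on {z. Re z > -1/2} - {1}"
    unfolding osc_zeta_def using progression_zeta_analytic[OF r] by (simp add: analytic_on_open)
  thus "osc_zeta \<tau> analytic_on {s. Re s > -1/4} - {1}" by (rule analytic_on_subset) auto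
  have "progression_defect (\<tau> * (\<tau> + 1)) \<tau> analytic_on {z. Re z > -1/2}"
    using progression_defect_holomorphic(1)[OF r] by (simp add: analytic_on_open open_halfspace_Re_gt)
  hence d: "progression_defect (\<tau> * (\<tau> + 1)) \<tau> analytic_on {s. Re s > -1/4}" by (rule analytic_on_subset) auto
  have p: "(\<lambda>z. of_real (\<tau> * (\<tau> + 1) - \<tau>) powr (1 - z) / of_real (2 * \<tau>) :: complex) analytic_on {s. Re s > -1/4}"
    using r by (intro analytic_intros) (auto simp del: of_real_add of_real_diff of_real_mult)
  show "osc_zeta \<tau> meromorphic_on {s. Re s > -1/4}"
    unfolding osc_zeta_def progression_zeta_def
    by (intro meromorphic_on_divide meromorphic_on_add analytic_on_imp_meromorphic_on[OF d] analytic_on_imp_meromorphic_on[OF p]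
        meromorphic_on_diff meromorphic_on_id meromorphic_on_const)
qed

lemma torsion_cont_analytic:
  assumes t: "\<tau> > 0"
  shows "torsion_cont \<tau> analytic_on {s. Re s > -1/4}"
proof -
  have "torsion_cont \<tau> holomorphic_on {s. Re s > -1/4}"
    unfolding torsion_cont_def using t by (intro holomorphic_intros torsion_remainder_derivatives(1)) auto
  thus ?thesis by (simp add: analytic_on_open open_halfspace_Re_gt)
qed

lemma spectral_zeta_functions:
  assumes h: "h \<noteq> 0" and q: "q = 0 \<or> q = 3" and s: "Re s > -1/4" "s \<noteq> 1"
  shows "spectral_zeta h q s = osc_zeta (tau h) s"
proof -
  note t = tau_pos[OF h]
  have E: "\<exists>e. eigensystem h q UNIV e (osc (tau h))"
    using eigensystem_functions[OF h] eigensystem_dual[OF eigensystem_functions[OF h]] q by auto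
  then obtain e where E: "eigensystem h q UNIV e (osc (tau h))" by blast
  have "(\<Sum>\<^sub>\<infinity>lam\<in>positive_spectrum h q. of_nat (multiplicity_of h q lam) * of_real lam powr (- z)) = osc_zeta (tau h) z"
    if z: "Re z > 1" for z
    by (rule eigensystem_zeta[OF E], rule norm_summable_imp_has_sum)
       (intro summable_powr_linear[OF t osc_linear[OF t] z] osc_zeta_sums[OF t z])+
  thus ?thesis unfolding spectral_zeta_def
    by (intro continuation_eqI[OF osc_zeta_analytic(2)[OF t], where c = 1])
       (use s in \<open>auto intro: analytic_on_subset[OF osc_zeta_analytic(1)[OF t]]\<close>)
qed

text \<open>
  In every block the three eigenvalues contribute \<open>3 l powr (- s) + pair_term l s\<close> with \<open>l = osc (tau h) k\<close>.
\<close>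

lemma spectral_zeta_forms:
  assumes h: "h \<noteq> 0" and q: "q = 1 \<or> q = 2" and s: "Re s > -1/4" "s \<noteq> 1"
  shows "spectral_zeta h q s = 3 * osc_zeta (tau h) s + torsion_cont (tau h) s"
proof -
  note t = tau_pos[OF h]
  define F where "F s = 3 * osc_zeta (tau h) s + torsion_cont (tau h) s" for s
  have E: "\<exists>e. eigensystem h q (UNIV \<times> {0, 1, 2}) e (curl_value h)"
    using eigensystem_one_forms[OF h] eigensystem_dual[OF eigensystem_one_forms[OF h]] q by auto
  then obtain e where E: "eigensystem h q (UNIV \<times> {0, 1, 2}) e (curl_value h)" by blast
  have an: "F analytic_on {s. Re s > -1/4} - {1}"
    unfolding F_def by (intro analytic_intros osc_zeta_analytic(1)[OF t] analytic_on_subset[OF torsion_cont_analytic[OF t]]) auto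
  have mero: "F meromorphic_on {s. Re s > -1/4}"
    unfolding F_def by (intro meromorphic_on_add meromorphic_on_mult meromorphic_on_const osc_zeta_analytic(2)[OF t]
        analytic_on_imp_meromorphic_on[OF torsion_cont_analytic[OF t]])
  have val: "(\<Sum>\<^sub>\<infinity>lam\<in>positive_spectrum h q. of_nat (multiplicity_of h q lam) * of_real lam powr (- z)) = F z"
    if z: "Re z > 1" for z
  proof (rule eigensystem_zeta[OF E])
    define w where "w i = (of_real (curl_value h i) powr (- z) :: complex)" for i
    have v: "curl_value h (k, 0) = osc (tau h) k" "curl_value h (k, 1) = (sqrt (osc (tau h) k + 1/4) - 1/2)\<^sup>2"
      "curl_value h (k, 2) = (sqrt (osc (tau h) k + 1/4) + 1/2)\<^sup>2" for k
      using curl_value_props[OF h, of k] by auto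
    have sm: "summable (\<lambda>k. norm (w (k, j)))" if "j \<in> {0, 1, 2}" for j
    proof -
      have "summable (\<lambda>k. norm (w (k, 0)))" "summable (\<lambda>k. norm (w (k, 2)))" unfolding w_def v
        by (intro summable_powr_linear[OF t _ z] osc_linear[OF t] root_linear(3)[OF t])+
      moreover have "summable (\<lambda>k. norm (w (k, 1)))" unfolding w_def v
        by (rule summable_powr_linear[OF _ root_linear(2)[OF t] z]) (intro mult_pos_pos root_linear(1)[OF t] t)
      ultimately show ?thesis using that by auto
    qed
    define S where "S j = (\<Sum>k. w (k, j))" for j
    have S: "(\<lambda>k. w (k, j)) sums S j" if "j \<in> {0, 1, 2}" for j
      unfolding S_def by (rule summable_sums[OF summable_norm_cancel[OF sm[OF that]]])
    have hs: "(w has_sum S j) ((\<lambda>k. (k, j)) ` UNIV)" if "j \<in> {0, 1, 2}" for j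
    proof -
      have "((w \<circ> (\<lambda>k. (k, j))) has_sum S j) UNIV"
        unfolding o_def by (rule norm_summable_imp_has_sum[OF sm[OF that] S[OF that]])
      thus ?thesis by (subst has_sum_reindex) (auto simp: inj_on_def)
    qed
    have "(w has_sum (S 0 + S 1 + S 2)) ((range (\<lambda>k. (k, 0)) \<union> range (\<lambda>k. (k, 1))) \<union> range (\<lambda>k. (k, 2)))"
      by (intro has_sum_Un_disjoint hs) auto
    also have "(range (\<lambda>k. (k, 0)) \<union> range (\<lambda>k. (k, 1))) \<union> range (\<lambda>k. (k, 2)) = (UNIV :: nat set) \<times> {0, 1, 2}" by auto
    also have "S 0 + S 1 + S 2 = F z"
    proof -
      have S0: "S 0 = osc_zeta (tau h) z"
        using sums_unique2[OF S[of 0]] osc_zeta_sums[OF t z] by (simp add: w_def v)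
      have "(\<lambda>k. w (k, 1) + w (k, 2) - 2 * w (k, 0)) sums (S 1 + S 2 - 2 * S 0)"
        by (intro sums_add sums_diff sums_mult S) auto
      moreover have "w (k, 1) + w (k, 2) - 2 * w (k, 0) = pair_term (osc (tau h) k) z" for k
        unfolding w_def v pair_term_def by simp
      ultimately have "(\<lambda>k. pair_term (osc (tau h) k) z) sums (S 1 + S 2 - 2 * S 0)" by simp
      moreover have "Re z > 0" using z by simp
      ultimately have "S 1 + S 2 - 2 * S 0 = torsion_cont (tau h) z"
        using pair_term_sums[OF t] sums_unique2 by blast
      thus ?thesis by (simp add: F_def S0 algebra_simps)
    qed
    finally show "((\<lambda>i. of_real (curl_value h i) powr (- z)) has_sum F z) (UNIV \<times> {0, 1, 2})" unfolding w_def .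
  qed
  show ?thesis unfolding spectral_zeta_def F_def[symmetric]
    by (intro continuation_eqI[OF mero, where c = 1])
       (use s val in \<open>auto intro: analytic_on_subset[OF an]\<close>)
qed

text \<open>
  By duality \<open>- \<zeta>\<^sub>1 + 2 \<zeta>\<^sub>2 - 3 \<zeta>\<^sub>3\<close> is \<open>\<zeta>\<^sub>1 - 3 \<zeta>\<^sub>0\<close>, where the poles at \<open>s = 1\<close> cancel.  At
  \<open>s = 1\<close> itself the separately continued values need not add up.
\<close>

lemma torsion_zeta_eq:
  assumes "h \<noteq> 0" "Re s > -1/4" "s \<noteq> 1"
  shows "torsion_zeta h s = torsion_cont (2 * pi * \<bar>h\<bar>) s"
proof -
  have "{..3::nat} = {0, 1, 2, 3}" by auto
  hence "torsion_zeta h s = - spectral_zeta h 1 s + 2 * spectral_zeta h 2 s - 3 * spectral_zeta h 3 s"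
    by (simp add: torsion_zeta_def)
  also have "\<dots> = torsion_cont (tau h) s"
    using assms by (simp add: spectral_zeta_functions spectral_zeta_forms)
  finally show ?thesis by (simp add: tau_def)
qed

section \<open>Sums over the central characters\<close>

text \<open>
  The Hurwitz zeta function of \<open>p\<close>.  The first term stands apart because the interval of length 1 about
  \<open>p\<close> may contain 0, where the midpoint rule breaks down.
\<close>

definition shifted_zeta :: "real \<Rightarrow> complex \<Rightarrow> complex" where
  "shifted_zeta p z = of_real p powr (- z) + progression_zeta (1 + p) (1/2) z"

lemma shifted_zeta_sums:
  assumes p: "p > 0" and z: "Re z > 1"
  shows "(\<lambda>k. of_real (real k + p) powr (- z)) sums shifted_zeta p z"
proof -
  have "(\<lambda>k. of_real ((1 + p) + 2 * (1/2) * real k) powr (- z)) sums progression_zeta (1 + p) (1/2) z"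
    using p z by (intro progression_zeta_sums) auto
  moreover have "(1 + p) + 2 * (1/2) * real k = real (Suc k) + p" for k by simp
  ultimately have "(\<lambda>k. of_real (real (Suc k) + p) powr (- z)) sums progression_zeta (1 + p) (1/2) z"
    by (simp only:)
  from sums_Suc[OF this] show ?thesis by (simp add: shifted_zeta_def add.commute)
qed

lemma shifted_zeta_holomorphic: "p > 0 \<Longrightarrow> shifted_zeta p holomorphic_on {z. Re z > - 1/2} - {1}"
  unfolding shifted_zeta_def
  by (intro holomorphic_intros progression_zeta_analytic) auto

lemma shifted_zeta_0: "p > 0 \<Longrightarrow> shifted_zeta p 0 = of_real (1/2 - p)"
  by (simp add: shifted_zeta_def progression_zeta_0)

text \<open>
  The flag \<open>w\<close> selects the weight \<open>k + p\<close>, for \<open>balanced_cont\<close>, or 1, for \<open>asymmetry_cont\<close>.  An integral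
  over the counting measure stands for the series, as in \<open>weighted_remainder\<close>.
\<close>

definition weighted_remainder_sum :: "bool \<Rightarrow> real \<Rightarrow> complex \<Rightarrow> complex" where
  "weighted_remainder_sum w p s =
     (\<integral>k. of_real (if w then real k + p else 1) * torsion_remainder (2 * pi * (real k + p)) s \<partial>count_space UNIV)"

lemma weighted_remainder_sum_properties:
  assumes p: "0 < p" "p < 1"
  shows "weighted_remainder_sum w p holomorphic_on {s. Re s > -1/4}"
    and "(weighted_remainder_sum w p has_field_derivative 0) (at 0)"
    and "Re s > -1/4 \<Longrightarrow> (\<lambda>k. of_real (if w then real k + p else 1) * torsion_remainder (2 * pi * (real k + p)) s)
           sums weighted_remainder_sum w p s"
    and "Re s > -1/4 \<Longrightarrow> summable (\<lambda>k. norm (of_real (if w then real k + p else 1) * torsion_remainder (2 * pi * (real k + p)) s))"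
proof -
  define c where "c k = (if w then real k + p else 1)" for k
  define \<tau> where "\<tau> k = 2 * pi * (real k + p)" for k
  have \<tau>: "\<tau> k \<ge> 2 * pi * p" for k unfolding \<tau>_def by simp
  have b: "norm (\<bar>c k\<bar> * \<tau> k powr (- 35/16)) \<le> (1 + 1/p) * p powr (- 19/16) * (real k + 1) powr (- 19/16)" for k
  proof -
    have x: "real k + p > 0" using p by (simp add: add_nonneg_pos)
    have "\<bar>c k\<bar> \<le> (1 + 1/p) * (real k + p)"
    proof -
      have "1 \<le> (1 / p) * (real k + p)" using p by (simp add: field_simps)
      moreover have "0 \<le> (1 / p) * (real k + p)" "0 \<le> real k + p" using p by simp_all
      ultimately show ?thesis by (auto simp: c_def distrib_right)
    qed
    moreover have "\<tau> k powr (- 35/16) \<le> (real k + p) powr (- 35/16)"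
      unfolding \<tau>_def using x pi_gt3 by (intro powr_mono2') (auto simp: mult_le_cancel_right1)
    ultimately have "\<bar>c k\<bar> * \<tau> k powr (- 35/16) \<le> ((1 + 1/p) * (real k + p)) * (real k + p) powr (- 35/16)"
      using p by (intro mult_mono) auto
    also have "\<dots> = (1 + 1/p) * ((real k + p) powr 1 * (real k + p) powr (- 35/16))" using x by simp
    also have "(real k + p) powr 1 * (real k + p) powr (- 35/16) = (real k + p) powr (- 19/16)"
      by (subst powr_add[symmetric]) simp
    also have "\<dots> \<le> (p * (real k + 1)) powr (- 19/16)"
    proof (rule powr_mono2')
      show "0 < p * (real k + 1)" using p by (intro mult_pos_pos) auto
      show "p * (real k + 1) \<le> real k + p" using p mult_right_mono[of p 1 "real k"] by (simp add: algebra_simps)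
    qed simp
    also have "\<dots> = p powr (- 19/16) * (real k + 1) powr (- 19/16)" using p by (simp add: powr_mult)
    finally show ?thesis using p by (simp add: mult_left_mono mult.assoc)
  qed
  have "summable (\<lambda>k. (1 + 1/p) * p powr (- 19/16) * (real k + 1) powr (- 19/16))"
    by (intro summable_mult summable_powr_Suc) simp
  hence "summable (\<lambda>k. norm (\<bar>c k\<bar> * \<tau> k powr (- 35/16)))"
    by (rule summable_comparison_test'[where N = 0]) (use b in simp)
  hence int: "integrable (count_space UNIV) (\<lambda>k. \<bar>c k\<bar> * \<tau> k powr (- 35/16))"
    by (simp add: integrable_count_space_nat_iff)
  have *: "2 * pi * p > 0" using p by simp
  note W = weighted_remainder[OF _ _ * \<tau> int, simplified]
  have W_def: "weighted_remainder_sum w p = (\<lambda>s. \<integral>k. of_real (c k) * torsion_remainder (\<tau> k) s \<partial>count_space UNIV)"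
    by (simp add: fun_eq_iff weighted_remainder_sum_def c_def \<tau>_def)
  show "weighted_remainder_sum w p holomorphic_on {s. Re s > -1/4}"
    unfolding W_def using W(1) by simp
  show "(weighted_remainder_sum w p has_field_derivative 0) (at 0)"
    unfolding W_def using W(2) by simp
  assume "Re s > -1/4"
  hence i: "integrable (count_space UNIV) (\<lambda>k. of_real (c k) * torsion_remainder (\<tau> k) s)"
    using W(3)[of s] by simp
  show "(\<lambda>k. of_real (if w then real k + p else 1) * torsion_remainder (2 * pi * (real k + p)) s)
           sums weighted_remainder_sum w p s"
    unfolding W_def using sums_integral_count_space_nat[OF i] by (simp add: c_def \<tau>_def)
  show "summable (\<lambda>k. norm (of_real (if w then real k + p else 1) * torsion_remainder (2 * pi * (real k + p)) s))"
    using i unfolding integrable_count_space_nat_iff c_def \<tau>_def .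
qed

text \<open>
  At \<open>\<tau> = 2 \<pi> (k + p)\<close> the main terms are multiples of \<open>(k + p) powr (- 2 s - 1)\<close> and sum up to a
  Hurwitz zeta function.
\<close>

lemma torsion_cont_progression:
  assumes p: "0 < p" "p < 1" and s: "Re s > 1"
  shows "(\<lambda>k. of_real (real k + p) * torsion_cont (2 * pi * (real k + p)) s) sums
           (s / 2 * of_real (2 * pi) powr (- 2 * s - 1) * shifted_zeta p (2 * s) + weighted_remainder_sum True p s)"
    and "summable (\<lambda>k. norm (of_real (real k + p) * torsion_cont (2 * pi * (real k + p)) s))"
    and "(\<lambda>k. torsion_cont (2 * pi * (real k + p)) s) sums
           (s / 2 * of_real (2 * pi) powr (- 2 * s - 1) * shifted_zeta p (2 * s + 1) + weighted_remainder_sum False p s)"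
    and "summable (\<lambda>k. norm (torsion_cont (2 * pi * (real k + p)) s))"
proof -
  define K where "K = s / 2 * (of_real (2 * pi) powr (- 2 * s - 1) :: complex)"
  have x: "real k + p > 0" for k using p by (simp add: add_nonneg_pos)
  have pw: "of_real (2 * pi * (real k + p)) powr (- 2 * s - 1) = (of_real (2 * pi) powr (- 2 * s - 1) * of_real (real k + p) powr (- (2 * s + 1)) :: complex)" for k
  proof -
    have "(of_real (2 * pi) * of_real (real k + p) :: complex) powr (- 2 * s - 1) = of_real (2 * pi) powr (- 2 * s - 1) * of_real (real k + p) powr (- 2 * s - 1)"
      using x[of k] by (intro powr_times_real) auto
    moreover have "- 2 * s - 1 = - (2 * s + 1)" by simp
    ultimately show ?thesis by (simp only: of_real_mult)
  qed
  have x1: "of_real (real k + p) * of_real (real k + p) powr (- (2 * s + 1)) = (of_real (real k + p) powr (- (2 * s)) :: complex)" for k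
  proof -
    have "- (2 * s) = 1 + - (2 * s + 1)" by simp
    hence "(of_real (real k + p) powr (- (2 * s)) :: complex) = of_real (real k + p) powr (1 + - (2 * s + 1))" by (simp only:)
    thus ?thesis using x[of k] by (simp only: powr_add) (simp add: add_nonneg_eq_0_iff)
  qed
  have 1: "of_real (real k + p) * torsion_cont (2 * pi * (real k + p)) s
     = K * of_real (real k + p) powr (- (2 * s)) + of_real (real k + p) * torsion_remainder (2 * pi * (real k + p)) s" for k
    unfolding torsion_cont_def pw x1[symmetric] K_def by (simp only: distrib_left mult_ac)
  have 2: "torsion_cont (2 * pi * (real k + p)) s
     = K * of_real (real k + p) powr (- (2 * s + 1)) + of_real 1 * torsion_remainder (2 * pi * (real k + p)) s" for k
    unfolding torsion_cont_def pw K_def by (simp only: distrib_left mult_ac of_real_1 mult_1_left)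
  have s': "Re s > -1/4" "Re (2 * s) > 1" "Re (2 * s + 1) > 1" using s by auto
  have nsum: "summable (\<lambda>k. norm (of_real (real k + p) powr (- z) :: complex))" if "Re z > 1" for z
  proof -
    have b: "norm (norm (of_real (real k + p) powr (- z) :: complex)) \<le> p powr (- Re z) * (real k + 1) powr (- Re z)" for k
    proof -
      have "(real k + p) powr (- Re z) \<le> (p * (real k + 1)) powr (- Re z)"
      proof (rule powr_mono2')
        show "0 < p * (real k + 1)" using p by (intro mult_pos_pos) auto
        show "p * (real k + 1) \<le> real k + p" using p mult_right_mono[of p 1 "real k"] by (simp add: algebra_simps)
      qed (use that in simp)
      thus ?thesis using x[of k] p by (simp add: norm_of_real_powr powr_mult del: of_real_add)
    qed
    have "summable (\<lambda>k. p powr (- Re z) * (real k + 1) powr (- Re z))"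
      using that by (intro summable_mult summable_powr_Suc) simp
    thus ?thesis by (rule summable_comparison_test'[where N = 0]) (rule b)
  qed
  have add: "summable (\<lambda>k. norm (f k + g k))" if "summable (\<lambda>k. norm (f k))" "summable (\<lambda>k. norm (g k))" for f g :: "nat \<Rightarrow> complex"
    by (rule summable_comparison_test'[OF summable_add[OF that], of 0]) (simp add: norm_triangle_ineq)
  have scal: "summable (\<lambda>k. norm (K * f k))" if "summable (\<lambda>k. norm (f k))" for f :: "nat \<Rightarrow> complex"
    unfolding norm_mult by (rule summable_mult[OF that])
  show "(\<lambda>k. of_real (real k + p) * torsion_cont (2 * pi * (real k + p)) s) sums
           (s / 2 * of_real (2 * pi) powr (- 2 * s - 1) * shifted_zeta p (2 * s) + weighted_remainder_sum True p s)"
    unfolding 1 K_def[symmetric]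
    using weighted_remainder_sum_properties(3)[OF p s'(1), of True]
    by (intro sums_add sums_mult shifted_zeta_sums p s') simp
  show "(\<lambda>k. torsion_cont (2 * pi * (real k + p)) s) sums
           (s / 2 * of_real (2 * pi) powr (- 2 * s - 1) * shifted_zeta p (2 * s + 1) + weighted_remainder_sum False p s)"
    unfolding 2 K_def[symmetric]
    using weighted_remainder_sum_properties(3)[OF p s'(1), of False]
    by (intro sums_add sums_mult shifted_zeta_sums p s') simp
  show "summable (\<lambda>k. norm (of_real (real k + p) * torsion_cont (2 * pi * (real k + p)) s))"
    unfolding 1 using weighted_remainder_sum_properties(4)[OF p s'(1), of True]
    by (intro add scal nsum s') simp
  show "summable (\<lambda>k. norm (torsion_cont (2 * pi * (real k + p)) s))"
    unfolding 2 using weighted_remainder_sum_properties(4)[OF p s'(1), of False]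
    by (intro add scal nsum s') simp
qed

text \<open>
  The continuation of \<open>e(s; H\<^sub>r\<^sub>e\<^sub>d, \<alpha>)\<close>, see \<open>torsion_families\<close>.
\<close>

definition asymmetry_cont :: "real \<Rightarrow> complex \<Rightarrow> complex" where
  "asymmetry_cont \<alpha> s = s / 2 * of_real (2 * pi) powr (- 2 * s - 1) * asymmetry_series \<alpha> (2 * s + 1)
     + (weighted_remainder_sum False \<alpha> s - weighted_remainder_sum False (1 - \<alpha>) s)"

text \<open>
  The continuation of the sum of \<open>\<bar>n + \<alpha>\<bar>\<close> times the torsion zeta function at \<open>n + \<alpha>\<close>, that is, of
  \<open>t(s; N, \<alpha>) + \<alpha> e(s; H\<^sub>r\<^sub>e\<^sub>d, \<alpha>)\<close>.
\<close>

definition balanced_cont :: "real \<Rightarrow> complex \<Rightarrow> complex" where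
  "balanced_cont \<alpha> s = s / 2 * of_real (2 * pi) powr (- 2 * s - 1) * (shifted_zeta \<alpha> (2 * s) + shifted_zeta (1 - \<alpha>) (2 * s))
     + (weighted_remainder_sum True \<alpha> s + weighted_remainder_sum True (1 - \<alpha>) s)"

lemma asymmetry_cont_holomorphic:
  assumes a: "0 < \<alpha>" "\<alpha> < 1"
  shows "asymmetry_cont \<alpha> holomorphic_on {s. Re s > -1/4}"
    and "(asymmetry_cont \<alpha> has_field_derivative asymmetry_series \<alpha> 1 / (4 * of_real pi)) (at 0)"
proof -
  have comp: "(\<lambda>s. asymmetry_series \<alpha> (2 * s + 1)) holomorphic_on {s. Re s > -1/4}"
  proof -
    have "(asymmetry_series \<alpha> \<circ> (\<lambda>s. 2 * s + 1)) holomorphic_on {s. Re s > -1/4}"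
      by (rule holomorphic_on_compose_gen[OF _ asymmetry_series_holomorphic(1)[OF a]])
         (auto intro!: holomorphic_intros)
    thus ?thesis by (simp add: o_def)
  qed
  have a': "0 < 1 - \<alpha>" "1 - \<alpha> < 1" using a by auto
  note W = weighted_remainder_sum_properties(1,2)[OF a, of False] weighted_remainder_sum_properties(1,2)[OF a', of False]
  show "asymmetry_cont \<alpha> holomorphic_on {s. Re s > -1/4}"
    unfolding asymmetry_cont_def
    by (intro holomorphic_intros comp W) auto
  define g where "g s = of_real (2 * pi) powr (- 2 * s - 1) * asymmetry_series \<alpha> (2 * s + 1) / 2" for s
  have "g holomorphic_on {s. Re s > -1/4}" unfolding g_def by (intro holomorphic_intros comp) auto
  hence "(g has_field_derivative deriv g 0) (at 0)"
    by (rule holomorphic_derivI[OF _ open_halfspace_Re_gt]) simp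
  hence "((\<lambda>s. s * g s + (weighted_remainder_sum False \<alpha> s - weighted_remainder_sum False (1 - \<alpha>) s))
     has_field_derivative (1 * g 0 + deriv g 0 * 0 + (0 - 0))) (at 0)"
    by (intro DERIV_add DERIV_diff DERIV_mult DERIV_ident W)
  moreover have "g 0 = asymmetry_series \<alpha> 1 / (4 * of_real pi)"
    by (simp add: g_def powr_minus_divide field_simps)
  moreover have "asymmetry_cont \<alpha> = (\<lambda>s. s * g s + (weighted_remainder_sum False \<alpha> s - weighted_remainder_sum False (1 - \<alpha>) s))"
    by (simp add: fun_eq_iff asymmetry_cont_def g_def)
  ultimately show "(asymmetry_cont \<alpha> has_field_derivative asymmetry_series \<alpha> 1 / (4 * of_real pi)) (at 0)"
    by simp
qed

text \<open>
  The Hurwitz zeta values \<open>1/2 - \<alpha>\<close> and \<open>1/2 - (1 - \<alpha>)\<close> at 0 cancel, so together with the factor \<open>s\<close>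
  the main term has a double zero at 0.
\<close>

lemma balanced_cont_holomorphic:
  assumes a: "0 < \<alpha>" "\<alpha> < 1"
  shows "balanced_cont \<alpha> holomorphic_on {s. Re s > -1/4} - {1/2}"
    and "(balanced_cont \<alpha> has_field_derivative 0) (at 0)"
    and "balanced_cont \<alpha> meromorphic_on {s. Re s > -1/4}"
proof -
  have comp: "(\<lambda>s. shifted_zeta p (2 * s)) holomorphic_on {s. Re s > -1/4} - {1/2}" if "p > 0" for p
  proof -
    have "(shifted_zeta p \<circ> (\<lambda>s. 2 * s)) holomorphic_on {s. Re s > -1/4} - {1/2}"
      by (rule holomorphic_on_compose_gen[OF _ shifted_zeta_holomorphic[OF that]])
         (auto intro!: holomorphic_intros simp: field_simps)
    thus ?thesis by (simp add: o_def)
  qed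
  have a': "0 < 1 - \<alpha>" "1 - \<alpha> < 1" using a by auto
  note W = weighted_remainder_sum_properties(1,2)[OF a, of True] weighted_remainder_sum_properties(1,2)[OF a', of True]
  show hol: "balanced_cont \<alpha> holomorphic_on {s. Re s > -1/4} - {1/2}"
    unfolding balanced_cont_def
    by (intro holomorphic_intros comp holomorphic_on_subset[OF W(1)] holomorphic_on_subset[OF W(3)]) (use a in auto)
  define g where "g s = of_real (2 * pi) powr (- 2 * s - 1) * (shifted_zeta \<alpha> (2 * s) + shifted_zeta (1 - \<alpha>) (2 * s)) / 2" for s
  have op: "open ({s. Re s > -1/4} - {1/2})" by (intro open_Diff open_halfspace_Re_gt) auto
  have "g holomorphic_on {s. Re s > -1/4} - {1/2}" unfolding g_def
    by (intro holomorphic_intros comp) (use a in auto)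
  hence "(g has_field_derivative deriv g 0) (at 0)"
    by (rule holomorphic_derivI[OF _ op]) simp
  hence "((\<lambda>s. s * g s + (weighted_remainder_sum True \<alpha> s + weighted_remainder_sum True (1 - \<alpha>) s))
     has_field_derivative (1 * g 0 + deriv g 0 * 0 + (0 + 0))) (at 0)"
    by (intro DERIV_add DERIV_mult DERIV_ident W)
  moreover have "g 0 = 0" using a a' by (simp add: g_def shifted_zeta_0)
  moreover have "balanced_cont \<alpha> = (\<lambda>s. s * g s + (weighted_remainder_sum True \<alpha> s + weighted_remainder_sum True (1 - \<alpha>) s))"
    by (simp add: fun_eq_iff balanced_cont_def g_def)
  ultimately show "(balanced_cont \<alpha> has_field_derivative 0) (at 0)" by simp
  have pole: "shifted_zeta p meromorphic_on {z. Re z > -1/2}" if "p > 0" for p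
  proof -
    have "progression_defect (1 + p) (1/2) analytic_on {z. Re z > -1/2}"
      using that progression_defect_holomorphic(1)[of "1/2" "1 + p"]
      by (subst analytic_on_open) (auto simp: open_halfspace_Re_gt)
    moreover have "(\<lambda>z. of_real (1 + p - 1/2) powr (1 - z) / of_real (2 * (1/2)) :: complex) analytic_on {z. Re z > -1/2}"
      using that by (intro analytic_intros) (auto simp del: of_real_add of_real_diff)
    moreover have "(\<lambda>z. of_real p powr (- z) :: complex) analytic_on {z. Re z > -1/2}"
      using that by (intro analytic_intros) auto
    ultimately show ?thesis unfolding shifted_zeta_def progression_zeta_def
      using that
      by (intro meromorphic_intros analytic_on_imp_meromorphic_on analytic_intros)
         (auto simp del: of_real_add of_real_diff)
  qed
  have pole': "(\<lambda>s. shifted_zeta p (2 * s)) meromorphic_on {s. Re s > -1/4}" if "p > 0" for p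
    by (rule meromorphic_on_compose[OF pole[OF that]]) (auto intro!: analytic_intros)
  have "F analytic_on {s. Re s > -1/4}" if "F holomorphic_on {s. Re s > -1/4}" for F
    using that by (subst analytic_on_open) (auto simp: open_halfspace_Re_gt)
  note an = analytic_on_imp_meromorphic_on[OF this]
  show "balanced_cont \<alpha> meromorphic_on {s. Re s > -1/4}"
    unfolding balanced_cont_def
    by (intro meromorphic_on_add meromorphic_on_mult pole' a a' an[OF W(1)] an[OF W(3)] an) (auto intro!: holomorphic_intros)
qed

section \<open>The relative torsion and the spectral invariants\<close>

text \<open>
  The formula \<open>F\<close> may fail at a finite set \<open>P\<close> of poles, of which 0 is not a member.
\<close>

lemma deriv_eq_transfer:
  assumes "\<And>s. Re s > d \<Longrightarrow> s \<notin> P \<Longrightarrow> f s = F s" "d < 0" "finite P" "0 \<notin> P"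
    and "(F has_field_derivative D) (at 0)"
  shows "deriv f 0 = D"
proof -
  have "open ({s. Re s > d} - P)"
    using assms by (intro open_Diff open_halfspace_Re_gt finite_imp_closed) auto
  hence "eventually (\<lambda>s. s \<in> {s. Re s > d} - P) (nhds 0)"
    using assms by (intro eventually_nhds_in_open) auto
  hence "eventually (\<lambda>s. f s = F s) (nhds 0)"
    by eventually_elim (use assms(1) in auto)
  hence "(f has_field_derivative D) (at 0)"
    using assms(5) by (subst DERIV_cong_ev[OF refl _ refl]) auto
  thus ?thesis by (rule DERIV_imp_deriv)
qed

lemma set_integrable_powr_to_inf:
  assumes "\<delta> > 0" "e < -1"
  shows "set_integrable lborel {\<delta><..} (\<lambda>x. x powr e :: real)"
proof -
  have "(\<lambda>x. x powr e) integrable_on {\<delta>..}"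
    using has_integral_powr_to_inf[OF assms(2,1)] by (rule has_integral_integrable)
  hence "(\<lambda>x. x powr e) absolutely_integrable_on {\<delta>..}"
    by (intro nonnegative_absolutely_integrable_1) auto
  hence "set_integrable lborel {\<delta>..} (\<lambda>x. x powr e)"
    unfolding set_integrable_def by (subst (asm) integrable_completion) auto
  thus ?thesis by (rule set_integrable_subset) auto
qed

lemma powr_integral_to_inf:
  assumes d: "\<delta> > 0" and w: "Re w > 1"
  shows "set_integrable lborel {\<delta><..} (\<lambda>x. of_real x powr (- w) :: complex)"
    and "(LBINT x:{\<delta><..}. of_real x powr (- w) :: complex) = of_real \<delta> powr (1 - w) / (w - 1)"
proof -
  define f where "f x = (of_real x powr (- w) :: complex)" for x :: real
  define F where "F x = (of_real x powr (1 - w) / (1 - w) :: complex)" for x :: real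
  have w1: "w \<noteq> 1" using w by auto
  have cont: "continuous_on {\<delta><..} f"
    unfolding f_def using d by (intro continuous_intros) auto
  have si: "set_integrable lborel {\<delta><..} (\<lambda>x. x powr (- Re w))"
    by (rule set_integrable_powr_to_inf) (use d w in auto)
  have meas: "set_borel_measurable borel {\<delta><..} f"
    unfolding set_borel_measurable_def using cont by (intro borel_measurable_continuous_on_indicator) auto
  show I: "set_integrable lborel {\<delta><..} (\<lambda>x. of_real x powr (- w) :: complex)"
    unfolding f_def[symmetric]
  proof (rule set_integrable_bound[OF si])
    show "AE x in lborel. x \<in> {\<delta><..} \<longrightarrow> norm (f x) \<le> norm (x powr (- Re w))"
      using d by (auto simp: f_def norm_of_real_powr)
  qed (use meas in \<open>simp add: set_borel_measurable_def\<close>)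
  have e: "einterval (ereal \<delta>) \<infinity> = {\<delta><..}" by (auto simp: einterval_def)
  have "(LBINT x=ereal \<delta>..\<infinity>. f x) = 0 - F \<delta>"
  proof (rule interval_integral_FTC_integrable[where F = F])
    show "(F has_vector_derivative f x) (at x)" if "ereal \<delta> < ereal x" "ereal x < \<infinity>" for x
    proof -
      have x: "x > 0" using that d by simp
      have "((\<lambda>z. z powr (1 - w) / (1 - w)) has_field_derivative of_real x powr (- w)) (at (of_real x))"
        using x w1 by (auto intro!: derivative_eq_intros simp: complex_nonpos_Reals_iff)
      thus ?thesis unfolding F_def f_def by (rule has_vector_derivative_real_field)
    qed
    show "isCont f x" if "ereal \<delta> < ereal x" "ereal x < \<infinity>" for x
      using cont that continuous_on_eq_continuous_at[of "{\<delta><..}" f] by simp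
    show "set_integrable lborel (einterval (ereal \<delta>) \<infinity>) f" unfolding e using I by (simp add: f_def[symmetric])
    have "isCont F \<delta>" unfolding F_def using d w1 by (intro continuous_intros) auto
    thus "((F \<circ> real_of_ereal) \<longlongrightarrow> F \<delta>) (at_right (ereal \<delta>))"
      by (simp add: ereal_tendsto_simps isCont_def filterlim_at_split)
    have "((\<lambda>x. x powr (1 - Re w)) \<longlongrightarrow> 0) at_top"
      using w by (intro tendsto_neg_powr filterlim_ident) auto
    hence "((\<lambda>x. x powr (1 - Re w) / norm (1 - w)) \<longlongrightarrow> 0 / norm (1 - w)) at_top"
      using w1 by (intro tendsto_intros) auto
    moreover have "eventually (\<lambda>x. norm (F x) = x powr (1 - Re w) / norm (1 - w)) at_top"
      using eventually_gt_at_top[of 0] by eventually_elim (simp add: F_def norm_divide norm_of_real_powr)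
    ultimately have "((\<lambda>x. norm (F x)) \<longlongrightarrow> 0) at_top"
      using tendsto_cong[of "\<lambda>x. norm (F x)" _ at_top 0] by simp
    hence "(F \<longlongrightarrow> 0) at_top" by (rule tendsto_norm_zero_cancel)
    thus "((F \<circ> real_of_ereal) \<longlongrightarrow> 0) (at_left \<infinity>)" by (simp add: ereal_tendsto_simps)
  qed auto
  thus "(LBINT x:{\<delta><..}. of_real x powr (- w) :: complex) = of_real \<delta> powr (1 - w) / (w - 1)"
    using w1 by (simp add: interval_lebesgue_integral_def e f_def F_def field_simps)
qed

lemma torsion_value:
  assumes "h \<noteq> 0"
  shows "torsion h = of_real (1 / (4 * pi * \<bar>h\<bar>))"
  unfolding torsion_def
proof (rule deriv_eq_transfer[where d = "-1/4" and P = "{1}" and F = "torsion_cont (2 * pi * \<bar>h\<bar>)"])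
  define t where "t = 2 * pi * \<bar>h\<bar>"
  have t: "t > 0" using assms by (simp add: t_def)
  have "((\<lambda>s. of_real t powr (- 2 * s - 1) / 2 :: complex) has_field_derivative
      deriv (\<lambda>s. of_real t powr (- 2 * s - 1) / 2) 0) (at 0)"
    by (rule holomorphic_derivI[of _ UNIV]) (use t in \<open>auto intro!: holomorphic_intros\<close>)
  from DERIV_mult[OF DERIV_ident this]
  have "((\<lambda>s. s / 2 * of_real t powr (- 2 * s - 1)) has_field_derivative (1 / (2 * of_real t))) (at (0::complex))"
    using t by (simp add: powr_minus_divide mult.commute)
  from DERIV_add[OF this torsion_remainder_derivatives(2)[OF t]]
  have "(torsion_cont t has_field_derivative (1 / (2 * of_real t))) (at 0)"
    by (simp add: torsion_cont_def[abs_def])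
  thus "(torsion_cont (2 * pi * \<bar>h\<bar>) has_field_derivative of_real (1 / (4 * pi * \<bar>h\<bar>))) (at 0)"
    by (simp add: t_def mult.assoc)
qed (use torsion_zeta_eq[OF assms] in auto)

text \<open>
  Beyond \<open>\<delta>\<close> the main term integrates to \<open>s (2 \<pi>) powr (- 2 s - 1) \<delta> powr (1 - 2 s) / (2 s - 1)\<close>,
  with derivative \<open>- \<delta> / (2 \<pi>)\<close> at 0.  Below \<open>\<delta>\<close> the integrand \<open>torsion h * h\<close> is the constant
  \<open>1 / (4 \<pi>)\<close>.
\<close>

lemma relative_torsion_eq_0:
  assumes d: "\<delta> > 0"
  shows "relative_torsion \<delta> = 0"
proof -
  define M where "M = restrict_space lborel {\<delta><..}"
  have sp: "space M = {\<delta><..}" by (simp add: M_def space_restrict_space)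
  have IM: "(LBINT h:{\<delta><..}. f h) = (\<integral>h. f h \<partial>M)" for f :: "real \<Rightarrow> complex"
    unfolding M_def set_lebesgue_integral_def by (subst integral_restrict_space) auto
  have iM: "integrable M f \<longleftrightarrow> set_integrable lborel {\<delta><..} f" for f :: "real \<Rightarrow> 'a :: euclidean_space"
    unfolding M_def set_integrable_def by (rule integrable_restrict_space) auto
  define J where "J s = (\<integral>h. of_real h * torsion_remainder (2 * pi * h) s \<partial>M)" for s
  have [measurable]: "(\<lambda>h. h) \<in> borel_measurable M" unfolding M_def by (intro measurable_restrict_space1) auto
  have int: "integrable M (\<lambda>h. \<bar>h\<bar> * (2 * pi * h) powr (- 35/16))"
  proof -
    have "integrable M (\<lambda>h. (2 * pi) powr (- 35/16) * h powr (- 19/16))"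
      unfolding iM using d by (intro set_integrable_mult_right set_integrable_powr_to_inf) auto
    also have "?this \<longleftrightarrow> integrable M (\<lambda>h. \<bar>h\<bar> * (2 * pi * h) powr (- 35/16))"
    proof (rule Bochner_Integration.integrable_cong[OF refl])
      fix h assume "h \<in> space M"
      hence h: "h > 0" using d by (simp add: sp)
      have "h powr (- 19/16) = h powr (1 + - 35/16)" by simp
      also have "\<dots> = h * h powr (- 35/16)" using h by (simp only: powr_add) simp
      finally show "(2 * pi) powr (- 35/16) * h powr (- 19/16) = \<bar>h\<bar> * (2 * pi * h) powr (- 35/16)"
        using h by (simp add: powr_mult)
    qed
    finally show ?thesis .
  qed
  have W: "J holomorphic_on {s. Re s > -1/4}" "(J has_field_derivative 0) (at 0)"
    "Re s > -1/4 \<Longrightarrow> integrable M (\<lambda>h. of_real h * torsion_remainder (2 * pi * h) s)" for s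
    unfolding J_def
    using weighted_remainder[of "\<lambda>h. h" M "\<lambda>h. 2 * pi * h" "2 * pi * \<delta>", OF _ _ _ _ int] d
    by (auto simp: sp)
  define g where "g s = of_real (2 * pi) powr (- 2 * s - 1) * (of_real \<delta> powr (1 - 2 * s) :: complex)" for s
  define F where "F s = s * (g s / (2 * s - 1)) + 2 * J s" for s
  have ga: "g holomorphic_on A" for A unfolding g_def using d by (intro holomorphic_intros) auto
  have Fhol: "F holomorphic_on {s. Re s > -1/4} - {1/2}"
    unfolding F_def by (intro holomorphic_intros ga holomorphic_on_subset[OF W(1)]) (auto simp: field_simps)
  have op: "open ({s. Re s > -1/4} - {1/2})" by (intro open_Diff open_halfspace_Re_gt) auto
  have op': "open {s. Re s > -1/4}" by (rule open_halfspace_Re_gt)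
  have Fan: "F analytic_on {s. Re s > -1/4} - {1/2}" using Fhol op by (simp add: analytic_on_open)
  have Fmero: "F meromorphic_on {s. Re s > -1/4}"
    unfolding F_def
    by (intro meromorphic_on_add meromorphic_on_mult meromorphic_on_divide meromorphic_on_diff meromorphic_on_const
          meromorphic_on_id analytic_on_imp_meromorphic_on[of g] analytic_on_imp_meromorphic_on[of J])
       (use ga W(1) op' in \<open>auto simp: analytic_on_open\<close>)
  have val: "F s = 2 * (LBINT h:{\<delta><..}. torsion_zeta h s * of_real h)" if s: "Re s > 1" for s
  proof -
    have s': "Re s > -1/4" "s \<noteq> 1" "Re (2 * s) > 1" "2 * s \<noteq> 1" using s by (auto simp: complex_eq_iff)
    define K where "K = s / 2 * (of_real (2 * pi) powr (- 2 * s - 1) :: complex)"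
    have eq: "torsion_zeta h s * of_real h = K * of_real h powr (- (2 * s)) + of_real h * torsion_remainder (2 * pi * h) s"
      if "h \<in> space M" for h
    proof -
      have h: "h > 0" using that d by (simp add: sp)
      have "(of_real (2 * pi) * of_real h :: complex) powr (- 2 * s - 1) = of_real (2 * pi) powr (- 2 * s - 1) * of_real h powr (- 2 * s - 1)"
        using h by (intro powr_times_real) auto
      moreover have "(of_real h powr (- 2 * s - 1) :: complex) * of_real h = of_real h powr (- (2 * s))"
        using h by (simp add: powr_diff)
      ultimately show ?thesis
        using torsion_zeta_eq[of h s] h s' by (simp add: torsion_cont_def K_def algebra_simps)
    qed
    have i1: "integrable M (\<lambda>h. of_real h powr (- (2 * s)) :: complex)"
      unfolding iM by (rule powr_integral_to_inf(1)[OF d s'(3)])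
    have "(LBINT h:{\<delta><..}. torsion_zeta h s * of_real h) = (\<integral>h. K * of_real h powr (- (2 * s)) + of_real h * torsion_remainder (2 * pi * h) s \<partial>M)"
      unfolding IM by (intro Bochner_Integration.integral_cong refl eq)
    also have "\<dots> = K * (\<integral>h. of_real h powr (- (2 * s)) \<partial>M) + J s"
      unfolding J_def using i1 W(3)[OF s'(1)] by simp
    also have "(\<integral>h. of_real h powr (- (2 * s)) \<partial>M) = of_real \<delta> powr (1 - 2 * s) / (2 * s - 1)"
      unfolding IM[symmetric] by (rule powr_integral_to_inf(2)[OF d s'(3)])
    finally have I: "(LBINT h:{\<delta><..}. torsion_zeta h s * of_real h) = K * (of_real \<delta> powr (1 - 2 * s) / (2 * s - 1)) + J s" .
    have e: "2 * (s / 2 * P * (Q / w)) = s * (P * Q / w)" for P Q w :: complex by simp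
    show ?thesis unfolding I F_def g_def K_def distrib_left e ..
  qed
  have cont: "continuation (\<lambda>s. 2 * (LBINT h:{\<delta><..}. torsion_zeta h s * of_real h)) s = F s"
    if "Re s > -1/4" "s \<notin> {1/2}" for s
    by (rule continuation_eqI[OF Fmero, where c = 1])
       (use that val in \<open>auto intro: analytic_on_subset[OF Fan]\<close>)
  have "((\<lambda>s. g s / (2 * s - 1)) has_field_derivative deriv (\<lambda>s. g s / (2 * s - 1)) 0) (at 0)"
    by (rule holomorphic_derivI[OF _ op]) (auto intro!: holomorphic_intros ga simp: field_simps)
  hence "(F has_field_derivative (1 * (g 0 / (2 * 0 - 1)) + deriv (\<lambda>s. g s / (2 * s - 1)) 0 * 0 + 2 * 0)) (at 0)"
    unfolding F_def by (intro DERIV_add DERIV_mult DERIV_cmult DERIV_ident W)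
  hence "(F has_field_derivative - of_real (\<delta> / (2 * pi))) (at 0)"
    using d by (simp add: g_def powr_minus_divide)
  from deriv_eq_transfer[where d = "-1/4" and P = "{1/2}", OF cont _ _ _ this]
  have A: "deriv (continuation (\<lambda>s. 2 * (LBINT h:{\<delta><..}. torsion_zeta h s * of_real h))) 0 = - of_real (\<delta> / (2 * pi))"
    by simp
  have "(LBINT h:{0<..<\<delta>}. torsion h * of_real h) = (LBINT h:{0<..<\<delta>}. of_real (1 / (4 * pi)))"
    by (rule set_lebesgue_integral_cong) (auto simp: torsion_value)
  also have "\<dots> = of_real (\<delta> / (4 * pi))" using d by (simp add: set_integral_const scaleR_conv_of_real)
  finally show ?thesis unfolding relative_torsion_def A by simp
qed

lemma int_has_sum_halves:
  fixes f :: "int \<Rightarrow> complex"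
  assumes "summable (\<lambda>k. norm (f (int k)))" "(\<lambda>k. f (int k)) sums a"
    and "summable (\<lambda>k. norm (f (- int k - 1)))" "(\<lambda>k. f (- int k - 1)) sums b"
  shows "(f has_sum a) {0..}" "(f has_sum b) {..- 1}" "(f has_sum (a + b)) UNIV"
proof -
  have "bij_betw int UNIV {0..}"
    by (rule bij_betwI[of _ _ _ nat]) auto
  moreover have "((\<lambda>k. f (int k)) has_sum a) UNIV"
    using assms(1,2) by (rule norm_summable_imp_has_sum)
  ultimately show 1: "(f has_sum a) {0..}" by (subst (asm) has_sum_reindex_bij_betw)
  have "bij_betw (\<lambda>k. - int k - 1) UNIV {..- 1}"
    by (rule bij_betwI[of _ _ _ "\<lambda>n. nat (- n - 1)"]) auto
  moreover have "((\<lambda>k. f (- int k - 1)) has_sum b) UNIV"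
    using assms(3,4) by (rule norm_summable_imp_has_sum)
  ultimately show 2: "(f has_sum b) {..- 1}" by (subst (asm) has_sum_reindex_bij_betw)
  have "({0..} \<union> {..- 1} :: int set) = UNIV" by auto
  moreover have "({0..} \<inter> {..- 1} :: int set) = {}" by auto
  ultimately show "(f has_sum (a + b)) UNIV" using has_sum_Un_disjoint[OF 1 2] by simp
qed

lemma asymmetry_series_eq:
  assumes "0 < \<alpha>" "\<alpha> < 1" "Re z > 1"
  shows "asymmetry_series \<alpha> z = shifted_zeta \<alpha> z - shifted_zeta (1 - \<alpha>) z"
  unfolding asymmetry_series_def
  by (rule sums_unique[symmetric], intro sums_diff shifted_zeta_sums) (use assms in auto)

text \<open>
  The characters with \<open>n \<ge> 0\<close> have \<open>\<bar>n + \<alpha>\<bar> = k + \<alpha>\<close> and those with \<open>n = - k - 1\<close> have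
  \<open>\<bar>n + \<alpha>\<bar> = k + (1 - \<alpha>)\<close>.  The multiplicity \<open>\<bar>n\<bar>\<close> is \<open>\<bar>n + \<alpha>\<bar> - \<alpha>\<close> in the first family and
  \<open>\<bar>n + \<alpha>\<bar> + \<alpha>\<close> in the second, which is where the term \<open>\<alpha> e(s)\<close> comes from.
\<close>

lemma torsion_families:
  assumes a: "0 < \<alpha>" "\<alpha> < 1" and s: "Re s > 1"
  shows "(\<Sum>\<^sub>\<infinity>n\<in>{0 :: int..}. torsion_zeta (of_int n + \<alpha>) s) - (\<Sum>\<^sub>\<infinity>n\<in>{..- 1 :: int}. torsion_zeta (of_int n + \<alpha>) s)
           = asymmetry_cont \<alpha> s"
    and "(\<Sum>\<^sub>\<infinity>n\<in>(UNIV :: int set). of_int \<bar>n\<bar> * torsion_zeta (of_int n + \<alpha>) s)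
           = balanced_cont \<alpha> s - of_real \<alpha> * asymmetry_cont \<alpha> s"
proof -
  have a': "0 < 1 - \<alpha>" "1 - \<alpha> < 1" using a by auto
  define u v where "u k = torsion_cont (2 * pi * (real k + \<alpha>)) s" and "v k = torsion_cont (2 * pi * (real k + (1 - \<alpha>))) s" for k
  have s': "Re s > -1/4" "s \<noteq> 1" "Re (2 * s + 1) > 1" using s by auto
  have tz1: "torsion_zeta (of_int (int k) + \<alpha>) s = u k" for k
  proof -
    have "real k + \<alpha> > 0" using a by (simp add: add_nonneg_pos)
    thus ?thesis using torsion_zeta_eq[of "real k + \<alpha>" s] s' by (simp add: u_def)
  qed
  have tz2: "torsion_zeta (of_int (- int k - 1) + \<alpha>) s = v k" for k
  proof -
    have "real k + (1 - \<alpha>) > 0" using a by (simp add: add_nonneg_pos)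
    hence "\<bar>- real k - 1 + \<alpha>\<bar> = real k + (1 - \<alpha>)" "- real k - 1 + \<alpha> \<noteq> 0" by auto
    thus ?thesis using torsion_zeta_eq[of "- real k - 1 + \<alpha>" s] s' by (simp add: v_def)
  qed
  note U = torsion_cont_progression[OF a s, folded u_def]
  note V = torsion_cont_progression[OF a' s, folded v_def]
  define K where "K = s / 2 * (of_real (2 * pi) powr (- 2 * s - 1) :: complex)"
  have 1: "((\<lambda>n. torsion_zeta (of_int n + \<alpha>) s) has_sum (K * shifted_zeta \<alpha> (2 * s + 1) + weighted_remainder_sum False \<alpha> s)) {0::int..}"
    and 2: "((\<lambda>n. torsion_zeta (of_int n + \<alpha>) s) has_sum (K * shifted_zeta (1 - \<alpha>) (2 * s + 1) + weighted_remainder_sum False (1 - \<alpha>) s)) {..-1::int}"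
    using int_has_sum_halves(1,2)[of "\<lambda>n. torsion_zeta (of_int n + \<alpha>) s"] U(3,4) V(3,4)
    unfolding tz1 tz2 K_def by blast+
  show "(\<Sum>\<^sub>\<infinity>n\<in>{0 :: int..}. torsion_zeta (of_int n + \<alpha>) s) - (\<Sum>\<^sub>\<infinity>n\<in>{..- 1 :: int}. torsion_zeta (of_int n + \<alpha>) s)
           = asymmetry_cont \<alpha> s"
    unfolding infsumI[OF 1] infsumI[OF 2] asymmetry_cont_def asymmetry_series_eq[OF a s'(3)] K_def[symmetric]
    by (simp add: algebra_simps)
  have e1: "of_int \<bar>int k\<bar> * u k = of_real (real k + \<alpha>) * u k - of_real \<alpha> * u k" for k
    by (simp add: algebra_simps)
  have e2: "of_int \<bar>- int k - 1\<bar> * v k = of_real (real k + (1 - \<alpha>)) * v k + of_real \<alpha> * v k" for k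
    by (simp add: algebra_simps)
  have "(\<lambda>k. of_real (real k + \<alpha>) * u k - of_real \<alpha> * u k) sums
     ((K * shifted_zeta \<alpha> (2 * s) + weighted_remainder_sum True \<alpha> s) - of_real \<alpha> * (K * shifted_zeta \<alpha> (2 * s + 1) + weighted_remainder_sum False \<alpha> s))"
    unfolding K_def by (intro sums_diff sums_mult U)
  moreover have "(\<lambda>k. of_real (real k + (1 - \<alpha>)) * v k + of_real \<alpha> * v k) sums
     ((K * shifted_zeta (1 - \<alpha>) (2 * s) + weighted_remainder_sum True (1 - \<alpha>) s) + of_real \<alpha> * (K * shifted_zeta (1 - \<alpha>) (2 * s + 1) + weighted_remainder_sum False (1 - \<alpha>) s))"
    unfolding K_def by (intro sums_add sums_mult V)
  moreover have "summable (\<lambda>k. norm (of_real (real k + \<alpha>) * u k - of_real \<alpha> * u k))"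
    by (rule summable_comparison_test'[OF summable_add[OF U(2) summable_mult[OF U(4), of "\<bar>\<alpha>\<bar>"]], of 0])
       (auto intro: order_trans[OF norm_triangle_ineq4] simp: norm_mult)
  moreover have "summable (\<lambda>k. norm (of_real (real k + (1 - \<alpha>)) * v k + of_real \<alpha> * v k))"
    by (rule summable_comparison_test'[OF summable_add[OF V(2) summable_mult[OF V(4), of "\<bar>\<alpha>\<bar>"]], of 0])
       (auto intro: order_trans[OF norm_triangle_ineq] simp: norm_mult)
  ultimately have HS: "((\<lambda>n. of_int \<bar>n\<bar> * torsion_zeta (of_int n + \<alpha>) s) has_sum
     (((K * shifted_zeta \<alpha> (2 * s) + weighted_remainder_sum True \<alpha> s) - of_real \<alpha> * (K * shifted_zeta \<alpha> (2 * s + 1) + weighted_remainder_sum False \<alpha> s))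
     + ((K * shifted_zeta (1 - \<alpha>) (2 * s) + weighted_remainder_sum True (1 - \<alpha>) s) + of_real \<alpha> * (K * shifted_zeta (1 - \<alpha>) (2 * s + 1) + weighted_remainder_sum False (1 - \<alpha>) s)))) (UNIV :: int set)"
    using int_has_sum_halves(3)[of "\<lambda>n. of_int \<bar>n\<bar> * torsion_zeta (of_int n + \<alpha>) s"]
    unfolding tz1 tz2 e1 e2 by blast
  show "(\<Sum>\<^sub>\<infinity>n\<in>(UNIV :: int set). of_int \<bar>n\<bar> * torsion_zeta (of_int n + \<alpha>) s)
           = balanced_cont \<alpha> s - of_real \<alpha> * asymmetry_cont \<alpha> s"
    unfolding infsumI[OF HS] balanced_cont_def asymmetry_cont_def
      asymmetry_series_eq[OF a s'(3)] K_def[symmetric]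
    by (simp only: ring_distribs) (simp add: algebra_simps)
qed

lemma asymmetry_Hred_eq:
  assumes a: "0 < \<alpha>" "\<alpha> < 1"
  shows "asymmetry_Hred \<alpha> = asymmetry_series \<alpha> 1 / (4 * of_real pi)"
proof -
  have an: "asymmetry_cont \<alpha> analytic_on {s. Re s > -1/4}"
    using asymmetry_cont_holomorphic(1)[OF a] by (simp add: analytic_on_open open_halfspace_Re_gt)
  have cont: "continuation (\<lambda>s. (\<Sum>\<^sub>\<infinity>n\<in>{0 :: int..}. torsion_zeta (of_int n + \<alpha>) s) - (\<Sum>\<^sub>\<infinity>n\<in>{..- 1 :: int}. torsion_zeta (of_int n + \<alpha>) s)) s
      = asymmetry_cont \<alpha> s" if "Re s > -1/4" "s \<notin> {}" for s
    by (rule continuation_eqI[OF analytic_on_imp_meromorphic_on[OF an], where c = 1])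
       (use that torsion_families(1)[OF a] in \<open>auto intro: analytic_on_subset[OF an]\<close>)
  show ?thesis unfolding asymmetry_Hred_def
    by (rule deriv_eq_transfer[where d = "-1/4" and P = "{}", OF cont _ _ _ asymmetry_cont_holomorphic(2)[OF a]]) auto
qed

text \<open>
  The balanced part has derivative zero at 0, so only \<open>- \<alpha> e(s)\<close> is left.
\<close>

lemma torsion_N_eq:
  assumes a: "0 < \<alpha>" "\<alpha> < 1"
  shows "torsion_N \<alpha> = - (asymmetry_Hred \<alpha> * of_real \<alpha>)"
proof -
  define F where "F s = balanced_cont \<alpha> s - of_real \<alpha> * asymmetry_cont \<alpha> s" for s
  have op: "open ({s. Re s > -1/4} - {1/2})" by (intro open_Diff open_halfspace_Re_gt) auto
  have an: "F analytic_on {s. Re s > -1/4} - {1/2}"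
    unfolding F_def analytic_on_open[OF op]
    by (intro holomorphic_intros balanced_cont_holomorphic(1) a holomorphic_on_subset[OF asymmetry_cont_holomorphic(1)[OF a]]) auto
  have "asymmetry_cont \<alpha> analytic_on {s. Re s > -1/4}"
    using asymmetry_cont_holomorphic(1)[OF a] by (simp add: analytic_on_open open_halfspace_Re_gt)
  hence mero: "F meromorphic_on {s. Re s > -1/4}"
    unfolding F_def by (intro meromorphic_intros balanced_cont_holomorphic(3) a analytic_on_imp_meromorphic_on[of "asymmetry_cont \<alpha>"])
  have cont: "continuation (\<lambda>s. \<Sum>\<^sub>\<infinity>n\<in>(UNIV :: int set). of_int \<bar>n\<bar> * torsion_zeta (of_int n + \<alpha>) s) s = F s"
    if "Re s > -1/4" "s \<notin> {1/2}" for s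
    by (rule continuation_eqI[OF mero, where c = 1])
       (use that torsion_families(2)[OF a] in \<open>auto simp: F_def[symmetric] intro: analytic_on_subset[OF an]\<close>)
  have "(F has_field_derivative 0 - of_real \<alpha> * (asymmetry_series \<alpha> 1 / (4 * of_real pi))) (at 0)"
    unfolding F_def by (intro DERIV_diff DERIV_cmult balanced_cont_holomorphic(2) asymmetry_cont_holomorphic(2) a)
  from deriv_eq_transfer[where d = "-1/4" and P = "{1/2}", OF cont _ _ _ this] show ?thesis
    unfolding torsion_N_def asymmetry_Hred_eq[OF a] by simp
qed

text \<open>
  After multiplication by \<open>\<alpha>\<close> the first term of the series is bounded away from \<open>\<alpha> = 1\<close>; the others are
  dominated by \<open>1 / k\<^sup>2\<close>.
\<close>

lemma asymmetry_integrable: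
  assumes b: "0 < \<beta>" "\<beta> < 1"
  shows "set_integrable lborel {0<..<\<beta>} (\<lambda>\<alpha>. asymmetry_Hred \<alpha> * of_real \<alpha>)"
proof -
  define q where "q k \<alpha> = 1 / (real k + \<alpha>) - 1 / (real k + (1 - \<alpha>))" for k \<alpha>
  define D where "D \<alpha> = (\<Sum>k. q k \<alpha>)" for \<alpha>
  define B where "B = 1 + 1 / (1 - \<beta>) + (\<Sum>k. 1 / (real k + 1)\<^sup>2)"
  have s2: "summable (\<lambda>k. 1 / (real k + 1)\<^sup>2)"
    using summable_powr_Suc[of "-2"] by (simp add: powr_minus_divide)
  have [measurable]: "D \<in> borel_measurable borel" unfolding D_def q_def by measurable
  have bound: "norm (D \<alpha> * \<alpha>) \<le> B" and DD: "asymmetry_Hred \<alpha> = of_real (D \<alpha> / (4 * pi))" if a: "\<alpha> \<in> {0<..<\<beta>}" for \<alpha>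
  proof -
    have a01: "0 < \<alpha>" "\<alpha> < 1" using a b by auto
    have "summable (\<lambda>k. of_real (real k + \<alpha>) powr (- 1) - of_real (real k + (1 - \<alpha>)) powr (- 1) :: complex)"
      using asymmetry_series_holomorphic(2)[OF a01, of 1] by simp
    moreover have qc: "of_real (real k + \<alpha>) powr (- 1) - of_real (real k + (1 - \<alpha>)) powr (- 1) = (of_real (q k \<alpha>) :: complex)" for k
      using a01 by (simp add: q_def powr_minus_divide add_nonneg_eq_0_iff)
    ultimately have sq: "summable (\<lambda>k. q k \<alpha>)" by (simp only: summable_of_real_iff)
    have "asymmetry_series \<alpha> 1 = of_real (D \<alpha>)"
      unfolding asymmetry_series_def qc D_def by (rule suminf_of_real[OF sq, symmetric])
    thus "asymmetry_Hred \<alpha> = of_real (D \<alpha> / (4 * pi))" by (simp add: asymmetry_Hred_eq[OF a01])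
    have qb: "norm (q (Suc k) \<alpha>) \<le> 1 / (real k + 1)\<^sup>2" for k
    proof -
      have "q (Suc k) \<alpha> = (1 - 2 * \<alpha>) / ((real k + 1 + \<alpha>) * (real k + 1 + (1 - \<alpha>)))"
        unfolding q_def using a01 by (subst diff_frac_eq) (auto simp: add_ac)
      moreover have "\<bar>1 - 2 * \<alpha>\<bar> \<le> 1" using a01 by auto
      moreover have "(real k + 1)\<^sup>2 \<le> (real k + 1 + \<alpha>) * (real k + 1 + (1 - \<alpha>))"
        unfolding power2_eq_square using a01 by (intro mult_mono) auto
      ultimately show ?thesis using a01 by (auto simp: abs_mult intro!: frac_le)
    qed
    have sn: "summable (\<lambda>k. norm (q (Suc k) \<alpha>))" by (rule summable_comparison_test'[OF s2, of 0]) (use qb in simp)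
    have "D \<alpha> = (\<Sum>k. q (Suc k) \<alpha>) + q 0 \<alpha>" unfolding D_def by (subst suminf_split_head[OF sq]) simp
    hence "\<bar>D \<alpha> * \<alpha>\<bar> \<le> \<bar>(\<Sum>k. q (Suc k) \<alpha>) * \<alpha>\<bar> + \<bar>q 0 \<alpha> * \<alpha>\<bar>"
      by (simp only: distrib_right abs_triangle_ineq)
    also have "\<bar>(\<Sum>k. q (Suc k) \<alpha>) * \<alpha>\<bar> = \<bar>\<Sum>k. q (Suc k) \<alpha>\<bar> * \<alpha>" using a01 by (simp add: abs_mult)
    also have "\<bar>\<Sum>k. q (Suc k) \<alpha>\<bar> * \<alpha> \<le> (\<Sum>k. 1 / (real k + 1)\<^sup>2) * 1"
    proof (rule mult_mono)
      have "norm (\<Sum>k. q (Suc k) \<alpha>) \<le> (\<Sum>k. norm (q (Suc k) \<alpha>))" by (rule summable_norm[OF sn])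
      also have "\<dots> \<le> (\<Sum>k. 1 / (real k + 1)\<^sup>2)" by (rule suminf_le[OF qb sn s2])
      finally show "\<bar>\<Sum>k. q (Suc k) \<alpha>\<bar> \<le> (\<Sum>k. 1 / (real k + 1)\<^sup>2)" by simp
    qed (use a01 s2 in \<open>auto intro!: suminf_nonneg\<close>)
    also have "\<bar>q 0 \<alpha> * \<alpha>\<bar> \<le> 1 + 1 / (1 - \<beta>)"
    proof -
      have "q 0 \<alpha> * \<alpha> = 1 - \<alpha> / (1 - \<alpha>)" using a01 by (simp add: q_def field_simps)
      moreover have "0 \<le> \<alpha> / (1 - \<alpha>)" using a01 by simp
      moreover have "\<alpha> / (1 - \<alpha>) \<le> 1 / (1 - \<beta>)" using a b by (intro frac_le) auto
      ultimately show ?thesis by linarith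
    qed
    finally show "norm (D \<alpha> * \<alpha>) \<le> B" by (simp add: B_def)
  qed
  have "set_integrable lborel {0<..<\<beta>} (\<lambda>\<alpha>. of_real (D \<alpha> * \<alpha> / (4 * pi)) :: complex)"
  proof (rule set_integrable_bound)
    show "set_integrable lborel {0<..<\<beta>} (\<lambda>\<alpha>. B / (4 * pi))"
      unfolding set_integrable_def by (intro integrable_scaleR_left integrable_real_indicator) (use b in auto)
    show "set_borel_measurable lborel {0<..<\<beta>} (\<lambda>\<alpha>. of_real (D \<alpha> * \<alpha> / (4 * pi)) :: complex)"
      unfolding set_borel_measurable_def by measurable
    show "AE \<alpha> in lborel. \<alpha> \<in> {0<..<\<beta>} \<longrightarrow> norm (of_real (D \<alpha> * \<alpha> / (4 * pi)) :: complex) \<le> norm (B / (4 * pi))"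
      using bound by (intro AE_I2 impI) (auto simp: norm_divide norm_mult abs_mult intro!: divide_right_mono order_trans[OF _ abs_ge_self])
  qed
  also have "?this \<longleftrightarrow> set_integrable lborel {0<..<\<beta>} (\<lambda>\<alpha>. asymmetry_Hred \<alpha> * of_real \<alpha>)"
    by (rule set_integrable_cong) (auto simp: DD)
  finally show ?thesis .
qed

theorem proposition5p11p0p1:
  fixes \<delta> :: real
  assumes "\<delta> > 0"
  shows "(\<forall>\<beta>\<in>{0<..<1}. set_integrable lborel {0<..<\<beta>} torsion_N
            \<and> set_integrable lborel {0<..<\<beta>} (\<lambda>\<alpha>. asymmetry_Hred \<alpha> * of_real \<alpha>))
       \<and> ((\<lambda>\<beta>. (LBINT \<alpha>:{0<..<\<beta>}. torsion_N \<alpha>)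
                 + (LBINT \<alpha>:{0<..<\<beta>}. asymmetry_Hred \<alpha> * of_real \<alpha>))
            \<longlongrightarrow> relative_torsion \<delta>) (at_left 1)
       \<and> set_integrable lborel {0<..<1} (\<lambda>\<alpha>. torsion_N \<alpha> + asymmetry_Hred \<alpha> * of_real \<alpha>)
       \<and> relative_torsion \<delta>
           = (LBINT \<alpha>:{0<..<1}. torsion_N \<alpha> + asymmetry_Hred \<alpha> * of_real \<alpha>)"
proof (intro conjI ballI)
  fix \<beta> :: real assume b: "\<beta> \<in> {0<..<1}"
  show A: "set_integrable lborel {0<..<\<beta>} (\<lambda>\<alpha>. asymmetry_Hred \<alpha> * of_real \<alpha>)"
    using b by (intro asymmetry_integrable) auto
  have "set_integrable lborel {0<..<\<beta>} (\<lambda>\<alpha>. - (asymmetry_Hred \<alpha> * of_real \<alpha>))"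
    using A by (simp add: set_integrable_def)
  also have "?this \<longleftrightarrow> set_integrable lborel {0<..<\<beta>} torsion_N"
    by (rule set_integrable_cong) (use b in \<open>auto simp: torsion_N_eq\<close>)
  finally show "set_integrable lborel {0<..<\<beta>} torsion_N" .
next
  have cancel: "(LBINT \<alpha>:{0<..<\<beta>}. torsion_N \<alpha>) + (LBINT \<alpha>:{0<..<\<beta>}. asymmetry_Hred \<alpha> * of_real \<alpha>) = 0"
    if "\<beta> < 1" for \<beta>
  proof -
    have "(LBINT \<alpha>:{0<..<\<beta>}. torsion_N \<alpha>) = (LBINT \<alpha>:{0<..<\<beta>}. - (asymmetry_Hred \<alpha> * of_real \<alpha>))"
      by (rule set_lebesgue_integral_cong) (use that in \<open>auto simp: torsion_N_eq\<close>)
    thus ?thesis by (simp add: set_lebesgue_integral_def)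
  qed
  have "eventually (\<lambda>\<beta>. \<beta> < 1) (at_left (1::real))" by (simp add: eventually_at_filter)
  hence "eventually (\<lambda>\<beta>. (LBINT \<alpha>:{0<..<\<beta>}. torsion_N \<alpha>)
     + (LBINT \<alpha>:{0<..<\<beta>}. asymmetry_Hred \<alpha> * of_real \<alpha>) = relative_torsion \<delta>) (at_left 1)"
    by eventually_elim (simp add: cancel relative_torsion_eq_0[OF assms])
  thus "((\<lambda>\<beta>. (LBINT \<alpha>:{0<..<\<beta>}. torsion_N \<alpha>) + (LBINT \<alpha>:{0<..<\<beta>}. asymmetry_Hred \<alpha> * of_real \<alpha>))
            \<longlongrightarrow> relative_torsion \<delta>) (at_left 1)" by (rule tendsto_eventually)
next
  have "set_integrable lborel {0::real<..<1} (\<lambda>_. 0 :: complex)" by (simp add: set_integrable_def)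
  also have "?this \<longleftrightarrow> set_integrable lborel {0<..<1} (\<lambda>\<alpha>. torsion_N \<alpha> + asymmetry_Hred \<alpha> * of_real \<alpha>)"
    by (rule set_integrable_cong) (auto simp: torsion_N_eq)
  finally show "set_integrable lborel {0<..<1} (\<lambda>\<alpha>. torsion_N \<alpha> + asymmetry_Hred \<alpha> * of_real \<alpha>)" .
next
  have "(LBINT \<alpha>:{0<..<1}. torsion_N \<alpha> + asymmetry_Hred \<alpha> * of_real \<alpha>) = (LBINT \<alpha>:{0::real<..<1}. 0)"
    by (rule set_lebesgue_integral_cong) (auto simp: torsion_N_eq)
  thus "relative_torsion \<delta> = (LBINT \<alpha>:{0<..<1}. torsion_N \<alpha> + asymmetry_Hred \<alpha> * of_real \<alpha>)"
    using relative_torsion_eq_0[OF assms] by (simp add: set_lebesgue_integral_def)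
qed

end
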